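(* The Hopf algebras $\mathfrak M\mathrm{Sym}$ and $\mathfrak m\mathrm{Sym}$ are continuously dual Hopf algebras via the Hall inner product. The bases $\{g_\lambda\mid\lambda\in\Lambda\}$ and $\{G_\lambda\mid\lambda\in\Lambda\}$ are dual bases. The bases $\{\tilde g_\lambda\mid\lambda\in\Lambda\}$ and $\{\tilde K_\lambda\mid\lambda\in\Lambda\}$ are dual bases.
   Context: $\Lambda$ is the set of all partitions; Young diagrams are in English notation. $\mathrm{Sym}$ is the Hopf algebra of symmetric functions over $\mathbb Z$; the Hall inner product is defined by $\langle s_\lambda,s_\mu\rangle=\delta_{\lambda\mu}$ on Schur functions and extends to a pairing between $\mathrm{Sym}$ and its completion $\prod_\lambda\mathbb Z s_\lambda$. Reverse plane partitions: fillings $T$ of $\lambda$ with positive integers weakly increasing along rows and down columns; $x^T=\prod_ix_i^{T(i)}$ with $T(i)$ the number of columns of $T$ containing an entry $i$. $g_\lambda=\sum_Tx^T$ over reverse plane partitions of shape $\lambda$; $\tilde g_\lambda(x_1,x_2,\dots)=(-1)^{|\lambda|}g_\lambda(-x_1,-x_2,\dots)$. $\mathfrak M\mathrm{Sym}=\bigoplus_\lambda\mathbb Z g_\lambda=\mathrm{Sym}$, with the Hopf structure of $\mathrm{Sym}$. Set-valued tableaux: fillings of $\lambda$ with nonempty finite sets of positive integers such that the maximum in a box is $\le$ the minimum in the box immediately to its right, and $<$ the minimum in the box immediately below; $x^T=\prod_ix_i^{a_i}$ with $a_i$ the number of boxes whose set contains $i$, and $|T|=\sum_ia_i$. $\tilde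 K_\lambda=\sum_Tx^T$ and the stable Grothendieck polynomial is $G_\lambda=\sum_T(-1)^{|T|-|\lambda|}x^T$, both over all set-valued tableaux of shape $\lambda$. $\mathfrak m\mathrm{Sym}=\prod_\lambda\mathbb Z\tilde K_\lambda$ is the space of arbitrary (infinite) linear combinations of the $\tilde K_\lambda$; it equals the completion $\prod_\lambda\mathbb Z s_\lambda$ with Hopf structure extended continuously from $\mathrm{Sym}$. Continuous duality: the space $V$ of arbitrary $\mathbb Z$-linear combinations of elements $v_s$ ($s\in S$) and its continuous dual $V_c^*$ (functionals respecting infinite linear combinations; free with basis $f_s$, $f_s(v_{s'})=\delta_{ss'}$) are called continuous duals with dual bases $\{v_s\},\{f_s\}$; for Hopf algebras the structure maps are required to be transposes of each other. *)

theory Defs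
  imports "HOL-Library.Multiset" "HOL-Library.FuncSet" "HOL-Library.Function_Algebras"
begin

section \<open>Infinite linear combinations, bases and continuous duality\<close>

text \<open>
  All modules below are groups of formal series: maps from a set of monomials to the integers,
  added pointwise.  An infinite linear combination is formed coefficientwise and
  makes sense if every coefficient of it is a finite sum.
\<close>

definition summable_comb :: "('s \<Rightarrow> 'm \<Rightarrow> int) \<Rightarrow> ('s \<Rightarrow> int) \<Rightarrow> bool" where
  "summable_comb v c \<longleftrightarrow> (\<forall>m. finite {s. c s * v s m \<noteq> 0})"

definition comb :: "('s \<Rightarrow> 'm \<Rightarrow> int) \<Rightarrow> ('s \<Rightarrow> int) \<Rightarrow> 'm \<Rightarrow> int" where
  "comb v c = (\<lambda>m. \<Sum>s | c s * v s m \<noteq> 0. c s * v s m)"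

definition expands :: "('s \<Rightarrow> 'm \<Rightarrow> int) \<Rightarrow> ('s \<Rightarrow> int) \<Rightarrow> ('m \<Rightarrow> int) \<Rightarrow> bool" where
  "expands v c f \<longleftrightarrow> summable_comb v c \<and> f = comb v c"

definition fin_span :: "('s \<Rightarrow> 'm \<Rightarrow> int) \<Rightarrow> ('m \<Rightarrow> int) set" where
  "fin_span v = {f. \<exists>c. finite {s. c s \<noteq> 0} \<and> expands v c f}"

definition inf_span :: "('s \<Rightarrow> 'm \<Rightarrow> int) \<Rightarrow> ('m \<Rightarrow> int) set" where
  "inf_span v = {f. \<exists>c. expands v c f}"

definition is_basis :: "('s \<Rightarrow> 'm \<Rightarrow> int) \<Rightarrow> ('m \<Rightarrow> int) set \<Rightarrow> bool" where
  "is_basis v A \<longleftrightarrow>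
     (\<forall>c. finite {s. c s \<noteq> 0} \<longrightarrow> (\<exists>f\<in>A. expands v c f)) \<and>
     (\<forall>f\<in>A. \<exists>!c. finite {s. c s \<noteq> 0} \<and> expands v c f)"

text \<open>\<open>V\<close> is the space of arbitrary linear combinations of the \<open>v s\<close>, i.e. a product of copies
  of the integers indexed by \<open>s\<close>.\<close>

definition is_topological_basis :: "('s \<Rightarrow> 'm \<Rightarrow> int) \<Rightarrow> ('m \<Rightarrow> int) set \<Rightarrow> bool" where
  "is_topological_basis v V \<longleftrightarrow>
     (\<forall>c. \<exists>f\<in>V. expands v c f) \<and> (\<forall>f\<in>V. \<exists>!c. expands v c f)"

definition continuous_functional ::
    "('s \<Rightarrow> 'm \<Rightarrow> int) \<Rightarrow> (('m \<Rightarrow> int) \<Rightarrow> int) \<Rightarrow> bool" where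
  "continuous_functional v \<phi> \<longleftrightarrow>
     (\<forall>c f. expands v c f \<longrightarrow>
        finite {s. c s * \<phi> (v s) \<noteq> 0} \<and>
        \<phi> f = (\<Sum>s | c s * \<phi> (v s) \<noteq> 0. c s * \<phi> (v s)))"

text \<open>
  The pairing \<open>P\<close> identifies \<open>A\<close> with the group of continuous functionals on \<open>V\<close>, and under this
  identification \<open>fs\<close> is the basis dual to \<open>vs\<close>.
\<close>

definition continuously_dual ::
    "(('m \<Rightarrow> int) \<Rightarrow> ('m \<Rightarrow> int) \<Rightarrow> int) \<Rightarrow> ('m \<Rightarrow> int) set \<Rightarrow> ('m \<Rightarrow> int) set \<Rightarrow>
     ('s \<Rightarrow> 'm \<Rightarrow> int) \<Rightarrow> ('s \<Rightarrow> 'm \<Rightarrow> int) \<Rightarrow> bool" where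
  "continuously_dual P A V fs vs \<longleftrightarrow>
     is_basis fs A \<and> is_topological_basis vs V \<and>
     (\<forall>f\<in>A. \<forall>g\<in>A. \<forall>h\<in>V. P (f + g) h = P f h + P g h) \<and>
     (\<forall>f\<in>A. continuous_functional vs (P f)) \<and>
     (\<forall>\<phi>. continuous_functional vs \<phi> \<longrightarrow> (\<exists>!f. f \<in> A \<and> (\<forall>h\<in>V. P f h = \<phi> h))) \<and>
     (\<forall>s t. P (fs s) (vs t) = (if s = t then 1 else 0))"

definition coords :: "('s \<Rightarrow> 'm \<Rightarrow> int) \<Rightarrow> ('m \<Rightarrow> int) \<Rightarrow> 's \<Rightarrow> int" where
  "coords v f = (THE c. expands v c f)"

text \<open>The pairing making \<open>v\<close> orthonormal; it is meant for arguments of which one is a finite and the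
  other a possibly infinite linear combination of \<open>v\<close>.\<close>

definition orthonormal_pairing ::
    "('s \<Rightarrow> 'm \<Rightarrow> int) \<Rightarrow> ('m \<Rightarrow> int) \<Rightarrow> ('m \<Rightarrow> int) \<Rightarrow> int" where
  "orthonormal_pairing v f h =
     (\<Sum>s | coords v f s * coords v h s \<noteq> 0. coords v f s * coords v h s)"


section \<open>Hopf algebras of formal series\<close>

text \<open>
  The (completed) tensor square of a group of formal series is realised by series in two sets of
  variables, \<open>f \<otimes> g\<close> being \<open>f(x) g(y)\<close>.  It is spanned by finite, respectively
  arbitrary, linear combinations of the products of basis elements.
\<close>

definition tensor :: "('m \<Rightarrow> int) \<Rightarrow> ('m \<Rightarrow> int) \<Rightarrow> 'm \<times> 'm \<Rightarrow> int" where
  "tensor f g = (\<lambda>(a, b). f a * g b)"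

definition tensor_family :: "('s \<Rightarrow> 'm \<Rightarrow> int) \<Rightarrow> 's \<times> 's \<Rightarrow> 'm \<times> 'm \<Rightarrow> int" where
  "tensor_family v = (\<lambda>(s, t). tensor (v s) (v t))"

text \<open>\<open>\<phi> \<otimes> id\<close> and \<open>id \<otimes> \<phi>\<close>: apply \<open>\<phi>\<close> to a series in one set of variables, with the monomial
  in the other set of variables held fixed.\<close>

definition on_left :: "(('m \<Rightarrow> int) \<Rightarrow> 'k \<Rightarrow> int) \<Rightarrow> ('m \<times> 'm \<Rightarrow> int) \<Rightarrow> 'k \<times> 'm \<Rightarrow> int" where
  "on_left \<phi> F = (\<lambda>(k, b). \<phi> (\<lambda>a. F (a, b)) k)"

definition on_right :: "(('m \<Rightarrow> int) \<Rightarrow> 'k \<Rightarrow> int) \<Rightarrow> ('m \<times> 'm \<Rightarrow> int) \<Rightarrow> 'm \<times> 'k \<Rightarrow> int" where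
  "on_right \<phi> F = (\<lambda>(a, k). \<phi> (\<lambda>b. F (a, b)) k)"

definition additive_subgroup :: "('m \<Rightarrow> int) set \<Rightarrow> bool" where
  "additive_subgroup A \<longleftrightarrow> 0 \<in> A \<and> (\<forall>f\<in>A. \<forall>g\<in>A. f + g \<in> A \<and> - f \<in> A)"

definition additive_on :: "('m \<Rightarrow> int) set \<Rightarrow> (('m \<Rightarrow> int) \<Rightarrow> 'b::plus) \<Rightarrow> bool" where
  "additive_on A \<phi> \<longleftrightarrow> (\<forall>f\<in>A. \<forall>g\<in>A. \<phi> (f + g) = \<phi> f + \<phi> g)"

text \<open>\<open>mul\<close> is the multiplication as a map on the tensor square \<open>square\<close>, so that the product of
  \<open>f\<close> and \<open>g\<close> is \<open>mul (tensor f g)\<close>.\<close>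

record 'm hopf =
  carr :: "('m \<Rightarrow> int) set"
  square :: "('m \<times> 'm \<Rightarrow> int) set"
  one :: "'m \<Rightarrow> int"
  mul :: "('m \<times> 'm \<Rightarrow> int) \<Rightarrow> 'm \<Rightarrow> int"
  counit :: "('m \<Rightarrow> int) \<Rightarrow> int"
  comul :: "('m \<Rightarrow> int) \<Rightarrow> 'm \<times> 'm \<Rightarrow> int"
  antip :: "('m \<Rightarrow> int) \<Rightarrow> 'm \<Rightarrow> int"

text \<open>The product of the tensor square:
  \<open>(f \<otimes> g) (f' \<otimes> g') = f f' \<otimes> g g'\<close>.\<close>

definition square_mul ::
    "'m hopf \<Rightarrow> ('m \<times> 'm \<Rightarrow> int) \<Rightarrow> ('m \<times> 'm \<Rightarrow> int) \<Rightarrow> 'm \<times> 'm \<Rightarrow> int" where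
  "square_mul H F G =
     (\<lambda>(a, b). mul H (\<lambda>(a1, a2). mul H (\<lambda>(b1, b2). F (a1, b1) * G (a2, b2)) b) a)"

locale hopf_algebra =
  fixes H :: "'m hopf"
  assumes carr_group: "additive_subgroup (carr H)"
    and square_group: "additive_subgroup (square H)"
    and tensor_closed: "\<lbrakk>f \<in> carr H; g \<in> carr H\<rbrakk> \<Longrightarrow> tensor f g \<in> square H"
    and one_closed: "one H \<in> carr H"
    and mul_closed: "F \<in> square H \<Longrightarrow> mul H F \<in> carr H"
    and comul_closed: "f \<in> carr H \<Longrightarrow> comul H f \<in> square H"
    and antip_closed: "f \<in> carr H \<Longrightarrow> antip H f \<in> carr H"
    and mul_additive: "additive_on (square H) (mul H)"
    and counit_additive: "additive_on (carr H) (counit H)"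
    and comul_additive: "additive_on (carr H) (comul H)"
    and antip_additive: "additive_on (carr H) (antip H)"
    and mul_assoc: "\<lbrakk>f \<in> carr H; g \<in> carr H; h \<in> carr H\<rbrakk> \<Longrightarrow>
      mul H (tensor (mul H (tensor f g)) h) = mul H (tensor f (mul H (tensor g h)))"
    and one_mul: "f \<in> carr H \<Longrightarrow> mul H (tensor (one H) f) = f"
    and mul_one: "f \<in> carr H \<Longrightarrow> mul H (tensor f (one H)) = f"
    and coassoc: "f \<in> carr H \<Longrightarrow>
      on_left (comul H) (comul H f) ((a, b), c) = on_right (comul H) (comul H f) (a, (b, c))"
    and counit_left: "f \<in> carr H \<Longrightarrow> counit H (\<lambda>a. comul H f (a, b)) = f b"
    and counit_right: "f \<in> carr H \<Longrightarrow> counit H (\<lambda>b. comul H f (a, b)) = f a"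
    and comul_one: "comul H (one H) = tensor (one H) (one H)"
    and comul_mul: "\<lbrakk>f \<in> carr H; g \<in> carr H\<rbrakk> \<Longrightarrow>
      comul H (mul H (tensor f g)) = square_mul H (comul H f) (comul H g)"
    and counit_one: "counit H (one H) = 1"
    and counit_mul: "\<lbrakk>f \<in> carr H; g \<in> carr H\<rbrakk> \<Longrightarrow>
      counit H (mul H (tensor f g)) = counit H f * counit H g"
    and antip_left: "f \<in> carr H \<Longrightarrow>
      mul H (on_left (antip H) (comul H f)) = (\<lambda>m. counit H f * one H m)"
    and antip_right: "f \<in> carr H \<Longrightarrow>
      mul H (on_right (antip H) (comul H f)) = (\<lambda>m. counit H f * one H m)"

text \<open>
  \<open>P\<close> pairs \<open>A\<close> with \<open>V\<close> and \<open>P2\<close> pairs their tensor squares.  The conditions on \<open>tensor_family\<close>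
  say that \<open>P2\<close> is the pairing induced by \<open>P\<close>.
\<close>

definition continuously_dual_hopf ::
    "(('m \<Rightarrow> int) \<Rightarrow> ('m \<Rightarrow> int) \<Rightarrow> int) \<Rightarrow>
     (('m \<times> 'm \<Rightarrow> int) \<Rightarrow> ('m \<times> 'm \<Rightarrow> int) \<Rightarrow> int) \<Rightarrow>
     'm hopf \<Rightarrow> 'm hopf \<Rightarrow> ('s \<Rightarrow> 'm \<Rightarrow> int) \<Rightarrow> ('s \<Rightarrow> 'm \<Rightarrow> int) \<Rightarrow> bool" where
  "continuously_dual_hopf P P2 A V fs vs \<longleftrightarrow>
     hopf_algebra A \<and> hopf_algebra V \<and>
     continuously_dual P (carr A) (carr V) fs vs \<and>
     continuously_dual P2 (square A) (square V) (tensor_family fs) (tensor_family vs) \<and>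
     (\<forall>F\<in>square A. \<forall>h\<in>carr V. P (mul A F) h = P2 F (comul V h)) \<and>
     (\<forall>f\<in>carr A. \<forall>K\<in>square V. P2 (comul A f) K = P f (mul V K)) \<and>
     (\<forall>h\<in>carr V. P (one A) h = counit V h) \<and>
     (\<forall>f\<in>carr A. P f (one V) = counit A f) \<and>
     (\<forall>f\<in>carr A. \<forall>h\<in>carr V. P (antip A f) h = P f (antip V h))"


section \<open>Partitions and tableaux\<close>

typedef partition = "{xs :: nat list. sorted_wrt (\<ge>) xs \<and> 0 \<notin> set xs}"
  morphisms parts Partition
  by (rule exI[of _ "[]"]) simp

definition psize :: "partition \<Rightarrow> nat" where
  "psize lam = sum_list (parts lam)"

text \<open>Boxes are pairs (row, column), both counted from 0.\<close>

definition diagram :: "partition \<Rightarrow> (nat \<times> nat) set" where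
  "diagram lam = {(i, j). i < length (parts lam) \<and> j < parts lam ! i}"

definition conjugate :: "partition \<Rightarrow> partition" where
  "conjugate lam = (THE mu. diagram mu = {(j, i). (i, j) \<in> diagram lam})"

text \<open>
  The alphabet of positive integers is replaced by the order-isomorphic alphabet of natural
  numbers: the entry \<open>i\<close> stands for \<open>i + 1\<close>, and the variables are indexed from 0.
  A filling is a function that is \<open>undefined\<close> outside of the diagram.
\<close>

definition ssyts :: "partition \<Rightarrow> (nat \<times> nat \<Rightarrow> nat) set" where
  "ssyts lam = {T \<in> diagram lam \<rightarrow>\<^sub>E UNIV.
     (\<forall>i j. (i, Suc j) \<in> diagram lam \<longrightarrow> T (i, j) \<le> T (i, Suc j)) \<and>
     (\<forall>i j. (Suc i, j) \<in> diagram lam \<longrightarrow> T (i, j) < T (Suc i, j))}"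

definition rpps :: "partition \<Rightarrow> (nat \<times> nat \<Rightarrow> nat) set" where
  "rpps lam = {T \<in> diagram lam \<rightarrow>\<^sub>E UNIV.
     (\<forall>i j. (i, Suc j) \<in> diagram lam \<longrightarrow> T (i, j) \<le> T (i, Suc j)) \<and>
     (\<forall>i j. (Suc i, j) \<in> diagram lam \<longrightarrow> T (i, j) \<le> T (Suc i, j))}"

definition svts :: "partition \<Rightarrow> (nat \<times> nat \<Rightarrow> nat set) set" where
  "svts lam = {T \<in> diagram lam \<rightarrow>\<^sub>E {B. finite B \<and> B \<noteq> {}}.
     (\<forall>i j. (i, Suc j) \<in> diagram lam \<longrightarrow> Max (T (i, j)) \<le> Min (T (i, Suc j))) \<and>
     (\<forall>i j. (Suc i, j) \<in> diagram lam \<longrightarrow> Max (T (i, j)) < Min (T (Suc i, j)))}"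


section \<open>Symmetric functions\<close>

text \<open>A monomial in the variables indexed by the natural numbers is the multiset of its factors;
  its degree is the size of the multiset.\<close>

type_synonym monomial = "nat multiset"
type_synonym series = "monomial \<Rightarrow> int"

definition ssyt_monomial :: "partition \<Rightarrow> (nat \<times> nat \<Rightarrow> nat) \<Rightarrow> monomial" where
  "ssyt_monomial lam T = (\<Sum>x\<in>diagram lam. {#T x#})"

definition rpp_monomial :: "partition \<Rightarrow> (nat \<times> nat \<Rightarrow> nat) \<Rightarrow> monomial" where
  "rpp_monomial lam T =
     (\<Sum>j\<in>snd ` diagram lam. mset_set {T (i, j) | i. (i, j) \<in> diagram lam})"

definition svt_monomial :: "partition \<Rightarrow> (nat \<times> nat \<Rightarrow> nat set) \<Rightarrow> monomial" where
  "svt_monomial lam T = (\<Sum>x\<in>diagram lam. mset_set (T x))"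

definition schur :: "partition \<Rightarrow> series" where
  "schur lam = (\<lambda>m. int (card {T \<in> ssyts lam. ssyt_monomial lam T = m}))"

definition dual_groth :: "partition \<Rightarrow> series" where
  "dual_groth lam = (\<lambda>m. int (card {T \<in> rpps lam. rpp_monomial lam T = m}))"

text \<open>\<open>f(-x)\<close>\<close>

definition negate_vars :: "series \<Rightarrow> series" where
  "negate_vars f = (\<lambda>m. (-1) ^ size m * f m)"

definition dual_groth_tilde :: "partition \<Rightarrow> series" where
  "dual_groth_tilde lam = (\<lambda>m. (-1) ^ psize lam * negate_vars (dual_groth lam) m)"

definition K_tilde :: "partition \<Rightarrow> series" where
  "K_tilde lam = (\<lambda>m. int (card {T \<in> svts lam. svt_monomial lam T = m}))"

definition groth :: "partition \<Rightarrow> series" where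
  "groth lam = (\<lambda>m. \<Sum>T | T \<in> svts lam \<and> svt_monomial lam T = m.
     (-1) ^ (size (svt_monomial lam T) - psize lam))"

definition hall :: "series \<Rightarrow> series \<Rightarrow> int" where
  "hall = orthonormal_pairing schur"

definition hall2 :: "(monomial \<times> monomial \<Rightarrow> int) \<Rightarrow> (monomial \<times> monomial \<Rightarrow> int) \<Rightarrow> int" where
  "hall2 = orthonormal_pairing (tensor_family schur)"

definition series_one :: series where
  "series_one = (\<lambda>m. if m = {#} then 1 else 0)"

definition series_mul :: "(monomial \<times> monomial \<Rightarrow> int) \<Rightarrow> series" where
  "series_mul F = (\<lambda>m. \<Sum>a | a \<subseteq># m. F (a, m - a))"

text \<open>The coproduct of a symmetric function \<open>f\<close> is \<open>f(x, y) = f(x\<^sub>0, y\<^sub>0, x\<^sub>1, y\<^sub>1, \<dots>)\<close>.\<close>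

definition series_comul :: "series \<Rightarrow> monomial \<times> monomial \<Rightarrow> int" where
  "series_comul f =
     (\<lambda>(a, b). f (image_mset (\<lambda>i. 2 * i) a + image_mset (\<lambda>i. 2 * i + 1) b))"

text \<open>The antipode sends \<open>s\<^sub>\<lambda>\<close> to \<open>(-1)\<^bsup>|\<lambda>|\<^esup>\<close> times the Schur function of the conjugate partition.\<close>

definition series_antip :: "series \<Rightarrow> series" where
  "series_antip f =
     comb (\<lambda>lam m. (-1) ^ psize lam * schur (conjugate lam) m) (coords schur f)"

definition M_Sym :: "monomial hopf" where
  "M_Sym = \<lparr>carr = fin_span dual_groth, square = fin_span (tensor_family dual_groth),
     one = series_one, mul = series_mul, counit = (\<lambda>f. f {#}), comul = series_comul,
     antip = series_antip\<rparr>"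

definition m_Sym :: "monomial hopf" where
  "m_Sym = \<lparr>carr = inf_span K_tilde, square = inf_span (tensor_family K_tilde),
     one = series_one, mul = series_mul, counit = (\<lambda>f. f {#}), comul = series_comul,
     antip = series_antip\<rparr>"

end

(* The Cauchy identity sum_lambda g_lambda(x) G_lambda(y) = prod 1 / (1 - x_i y_j) carries the whole
   proof. Adding one variable to g or to G amounts to a sum over strips between two partitions, and
   the one-variable operators for g and G commute up to the factor 1 / (1 - x y): this can be checked
   row by row, because the strips above (below) two given partitions form a product of intervals, and
   the discrepancy between corresponding rows telescopes. Commuting one variable at a time gives first
   a Pieri rule for G and then the Cauchy identity. Its part of equal degree in x and y is the Cauchy
   identity for Schur functions. As the right-hand side is symmetric in x and in y, triangularity
   yields the symmetry of s, G and g, and comparison of the two identities yields duality.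
   The kernel is multiplicative in x and in y, so product and coproduct are adjoint. The antipode
   axiom is proved by removing one variable at a time, where the alternating sum over a vertical strip
   followed by a horizontal strip cancels. *)
theory Submission
  imports Defs "HOL-Computational_Algebra.Polynomial"
begin

section \<open>Triangular changes of basis\<close>

text \<open>A \<open>groth\<close> series has terms in infinitely many degrees in general, so the
  Hall pairing makes sense only between a finite and an infinite combination. Duality is therefore
  treated through integer matrices that are triangular for the degree, which keeps every sum finite.
  One locale serves three times: for the pair \<open>dual_groth\<close>, \<open>groth\<close>; for
  the tilde pair, after conjugation by signs; and for the tensor squares, after Kronecker products.
  The Cauchy identity must be proved before any symmetry is known, so monomials are always taken
  apart at their largest variable. For g a new variable x contributes x^c over every smaller shape,
  c being the number of columns of the skew shape; for G a new variable y contributes y^n (1 - y)^r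
  over horizontal strips with n boxes, r being the number of free corners. The factor 1 / (1 - x y)
  comes from the first row of the upper partition, the only row without a bound: each box beyond the
  longer of the two given first rows adds one x and one y.\<close>

lemma comb_eq_sum:
  assumes "finite S" "\<And>s. s \<notin> S \<Longrightarrow> c s * v s m = 0"
  shows "comb v c m = (\<Sum>s\<in>S. c s * v s m)"
  unfolding comb_def by (rule sum.mono_neutral_left) (use assms in auto)

lemma finite_support_bound:
  fixes c :: "'s \<Rightarrow> int" and deg :: "'s \<Rightarrow> nat"
  assumes "finite {s. c s \<noteq> 0}"
  obtains d where "\<And>s. d < deg s \<Longrightarrow> c s = 0"
proof
  define d where "d = Max (insert 0 (deg ` {s. c s \<noteq> 0}))"
  fix s assume d: "d < deg s"
  show "c s = 0"
  proof (rule ccontr)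
    assume "c s \<noteq> 0"
    then have "deg s \<le> d" unfolding d_def using assms by (intro Max_ge) auto
    with d show False by simp
  qed
qed

text \<open>The condition \<open>independent\<close> concerns arbitrary infinite combinations. Since
  \<open>finite_nonzero\<close> makes every coefficient function summable, the two identify
  \<open>inf_span s\<close> with the group of all integer functions on the index set.\<close>

locale graded_family =
  fixes s :: "'s \<Rightarrow> 'm \<Rightarrow> int" and deg :: "'s \<Rightarrow> nat"
  assumes finite_nonzero: "finite {i. s i m \<noteq> 0}"
    and independent: "comb s c = (\<lambda>m. 0) \<Longrightarrow> c = (\<lambda>i. 0)"
    and finite_deg_le: "finite {i. deg i \<le> d}"
begin

lemma comb_sum: "comb s c m = (\<Sum>i | s i m \<noteq> 0. c i * s i m)"
  by (rule comb_eq_sum) (use finite_nonzero in auto)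

lemma summable: "summable_comb s c"
  unfolding summable_comb_def
proof
  fix m
  show "finite {i. c i * s i m \<noteq> 0}"
    by (rule finite_subset[OF _ finite_nonzero[of m]]) auto
qed

lemma expands_iff: "expands s c f \<longleftrightarrow> f = comb s c"
  by (simp add: expands_def summable)

lemma comb_plus: "comb s (\<lambda>i. c i + d i) = comb s c + comb s d"
  by (rule ext) (simp add: comb_sum sum.distrib algebra_simps)

lemma comb_minus: "comb s (\<lambda>i. - c i) = - comb s c"
  by (rule ext) (simp add: comb_sum sum_negf)

lemma comb_inject: "comb s c = comb s d \<longleftrightarrow> c = d"
proof
  assume *: "comb s c = comb s d"
  have "comb s (\<lambda>i. c i + - d i) = (\<lambda>m. 0)"
    using * by (simp only: comb_plus comb_minus) (simp add: fun_eq_iff)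
  from independent[OF this] show "c = d" by (simp add: fun_eq_iff)
qed simp

lemma coords_comb [simp]: "coords s (comb s c) = c"
  unfolding coords_def by (rule the_equality) (simp_all add: expands_iff comb_inject)

lemma comb_unit: "comb s (\<lambda>j. if j = i then 1 else 0) = s i"
proof
  fix m
  show "comb s (\<lambda>j. if j = i then 1 else 0) m = s i m"
    by (subst comb_eq_sum[of "{i}"]) auto
qed

lemma inf_span_eq: "inf_span s = range (comb s)"
  by (auto simp: inf_span_def expands_iff)

lemma fin_span_eq: "fin_span s = comb s ` {c. finite {i. c i \<noteq> 0}}"
  by (auto simp: fin_span_def expands_iff)

lemma comb_coords: "f \<in> inf_span s \<Longrightarrow> comb s (coords s f) = f"
  by (auto simp: inf_span_eq)

lemma pairing_comb:
  assumes "finite S" "\<And>i. i \<notin> S \<Longrightarrow> c i * d i = 0"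
  shows "orthonormal_pairing s (comb s c) (comb s d) = (\<Sum>i\<in>S. c i * d i)"
  unfolding orthonormal_pairing_def coords_comb
  by (rule sum.mono_neutral_left) (use assms in auto)

end

text \<open>With \<open>A\<close> and \<open>B\<close> regarded as matrices that are triangular
    with respect to \<open>deg\<close>, the
  hypothesis \<open>inverse_left\<close> is \<open>B\<^sup>T A = 1\<close>; triangularity gives
      \<open>B A\<^sup>T = 1\<close> as well.\<close>

locale dual_transition = graded_family s deg for s :: "'s \<Rightarrow> 'm \<Rightarrow> int" and deg +
  fixes A B :: "'s \<Rightarrow> 's \<Rightarrow> int" and f G :: "'s \<Rightarrow> 'm \<Rightarrow> int"
  assumes B_lower: "B i j \<noteq> 0 \<Longrightarrow> deg j \<le> deg i"
    and A_upper: "A i j \<noteq> 0 \<Longrightarrow> deg i \<le> deg j"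
    and A_diag: "deg i = deg j \<Longrightarrow> A i j = (if i = j then 1 else 0)"
    and inverse_left: "(\<Sum>i | deg i \<le> deg k. B i j * A i k) = (if j = k then 1 else 0)"
    and f_eq: "f i = comb s (B i)"
    and G_eq: "G i = comb s (A i)"
begin

abbreviation D where "D n \<equiv> {i. deg i \<le> n}"

lemma inverse_left':
  assumes "finite U" "D (deg k) \<subseteq> U"
  shows "(\<Sum>i\<in>U. B i j * A i k) = (if j = k then 1 else 0)"
proof -
  have "(\<Sum>i\<in>U. B i j * A i k) = (\<Sum>i\<in>D (deg k). B i j * A i k)"
    by (rule sum.mono_neutral_right) (use assms A_upper in auto)
  then show ?thesis by (simp add: inverse_left)
qed

text \<open>For fixed \<open>k\<close>, both \<open>X\<close> and the unit vector at
  \<open>k\<close> solve the linear system with the transpose of \<open>A\<close> and right-hand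
  side \<open>A k l\<close>. Their difference \<open>Y\<close> is killed by the transpose of
  \<open>A\<close>, which is unitriangular, so it vanishes by induction on the degree.\<close>

lemma inverse_right: "(\<Sum>j\<in>D (deg i). B i j * A k j) = (if i = k then 1 else 0)"
proof -
  define X where "X = (\<lambda>i. \<Sum>j\<in>D (deg i). B i j * A k j)"
  define Y where "Y = (\<lambda>i. X i - (if i = k then 1 else 0))"
  have sum_X: "(\<Sum>i\<in>D (deg l). A i l * X i) = A k l" for l
  proof -
    have "X i = (\<Sum>j\<in>D (deg l). B i j * A k j)" if "i \<in> D (deg l)" for i
      unfolding X_def
      by (rule sum.mono_neutral_left) (use that finite_deg_le B_lower in \<open>auto dest:
          order_trans\<close>)
    then have "(\<Sum>i\<in>D (deg l). A i l * X i)
        = (\<Sum>i\<in>D (deg l). \<Sum>j\<in>D (deg l). A i l * (B i j * A k j))"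
      by (simp add: sum_distrib_left)
    also have "\<dots> = (\<Sum>j\<in>D (deg l). \<Sum>i\<in>D (deg l). A i l * (B i j * A k j))"
      by (rule sum.swap)
    also have "\<dots> = (\<Sum>j\<in>D (deg l). A k j * (\<Sum>i\<in>D (deg l). B i j * A i l))"
      by (simp add: sum_distrib_left mult_ac)
    also have "\<dots> = A k l"
      by (simp add: inverse_left if_distrib[of "\<lambda>x. _ * x"] finite_deg_le cong: if_cong)
    finally show ?thesis .
  qed
  have sum_Y: "(\<Sum>i\<in>D (deg l). A i l * Y i) = 0" for l
  proof -
    have "(\<Sum>i\<in>D (deg l). A i l * (if i = k then 1 else 0)) = A k l"
      using A_upper[of k l] by (simp add: if_distrib[of "\<lambda>x. _ * x"] finite_deg_le cong:
          if_cong) auto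
    then show ?thesis
      by (simp add: Y_def right_diff_distrib sum_subtractf sum_X)
  qed
  have "Y l = 0" for l
  proof (induction "deg l" arbitrary: l rule: less_induct)
    case less
    have "0 = (\<Sum>i\<in>D (deg l). A i l * Y i)" by (simp add: sum_Y)
    also have "\<dots> = (\<Sum>i\<in>{l}. A i l * Y i)"
    proof (rule sum.mono_neutral_right)
      show "\<forall>i\<in>D (deg l) - {l}. A i l * Y i = 0"
        using less A_diag by (metis (mono_tags, lifting) DiffD1 DiffD2 insertI1 le_neq_implies_less
            mem_Collect_eq mult_eq_0_iff)
    qed (auto simp: finite_deg_le)
    finally show ?case by (simp add: A_diag)
  qed
  then show ?thesis by (simp add: Y_def X_def)
qed

lemma inverse_right':
  assumes "finite U" "D (deg i) \<subseteq> U"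
  shows "(\<Sum>j\<in>U. B i j * A k j) = (if i = k then 1 else 0)"
proof -
  have "(\<Sum>j\<in>U. B i j * A k j) = (\<Sum>j\<in>D (deg i). B i j * A k j)"
    by (rule sum.mono_neutral_right) (use assms B_lower in auto)
  then show ?thesis by (simp add: inverse_right)
qed

text \<open>Four coordinate changes. The two for \<open>f\<close> act on finitely supported vectors
  and sum over the support; the two for \<open>G\<close> act on arbitrary vectors, and there
  triangularity bounds the sum by degree.\<close>

definition f_to_s :: "('s \<Rightarrow> int) \<Rightarrow> 's \<Rightarrow> int" where
  "f_to_s c j = (\<Sum>i | c i \<noteq> 0. c i * B i j)"

definition s_to_f :: "('s \<Rightarrow> int) \<Rightarrow> 's \<Rightarrow> int" where
  "s_to_f d i = (\<Sum>j | d j \<noteq> 0. d j * A i j)"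

definition G_to_s :: "('s \<Rightarrow> int) \<Rightarrow> 's \<Rightarrow> int" where
  "G_to_s c k = (\<Sum>i\<in>D (deg k). c i * A i k)"

definition s_to_G :: "('s \<Rightarrow> int) \<Rightarrow> 's \<Rightarrow> int" where
  "s_to_G d i = (\<Sum>j\<in>D (deg i). B i j * d j)"

lemma f_to_s_support:
  "{j. f_to_s c j \<noteq> 0} \<subseteq> (\<Union>i\<in>{i. c i \<noteq> 0}. D (deg i))"
proof
  fix j assume "j \<in> {j. f_to_s c j \<noteq> 0}"
  then have "f_to_s c j \<noteq> 0" by simp
  then obtain i where "c i \<noteq> 0" "c i * B i j \<noteq> 0"
    unfolding f_to_s_def by (rule sum.not_neutral_contains_not_neutral) auto
  then show "j \<in> (\<Union>i\<in>{i. c i \<noteq> 0}. D (deg i))" using B_lower by auto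
qed

lemma s_to_f_support:
  "{i. s_to_f d i \<noteq> 0} \<subseteq> (\<Union>j\<in>{j. d j \<noteq> 0}. D (deg j))"
proof
  fix i assume "i \<in> {i. s_to_f d i \<noteq> 0}"
  then have "s_to_f d i \<noteq> 0" by simp
  then obtain j where "d j \<noteq> 0" "d j * A i j \<noteq> 0"
    unfolding s_to_f_def by (rule sum.not_neutral_contains_not_neutral) auto
  then show "i \<in> (\<Union>j\<in>{j. d j \<noteq> 0}. D (deg j))" using A_upper by auto
qed

lemma finite_D_UN: "finite I \<Longrightarrow> finite (\<Union>i\<in>I. D (deg i))"
  using finite_deg_le by auto

lemma finite_f_to_s: "finite {i. c i \<noteq> 0} \<Longrightarrow> finite {j. f_to_s c j \<noteq> 0}"
  using finite_subset[OF f_to_s_support finite_D_UN] .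

lemma finite_s_to_f: "finite {i. c i \<noteq> 0} \<Longrightarrow> finite {j. s_to_f c j \<noteq> 0}"
  using finite_subset[OF s_to_f_support finite_D_UN] .

lemma f_to_s_to_f:
  assumes "finite {i. c i \<noteq> 0}"
  shows "s_to_f (f_to_s c) = c"
proof
  fix i
  define U where "U = (\<Union>i\<in>{i. c i \<noteq> 0}. D (deg i))"
  have U: "finite U" unfolding U_def by (rule finite_D_UN[OF assms])
  have "s_to_f (f_to_s c) i = (\<Sum>j\<in>U. f_to_s c j * A i j)"
    unfolding s_to_f_def
    by (rule sum.mono_neutral_left) (use U f_to_s_support[of c] in \<open>auto simp: U_def\<close>)
  also have "\<dots> = (\<Sum>j\<in>U. \<Sum>k | c k \<noteq> 0. c k * (B k j * A i j))"
    by (simp add: f_to_s_def sum_distrib_right mult.assoc)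
  also have "\<dots> = (\<Sum>k | c k \<noteq> 0. \<Sum>j\<in>U. c k * (B k j * A i j))"
    by (rule sum.swap)
  also have "\<dots> = (\<Sum>k | c k \<noteq> 0. c k * (\<Sum>j\<in>U. B k j * A i j))"
    by (simp add: sum_distrib_left)
  also have "\<dots> = (\<Sum>k | c k \<noteq> 0. c k * (if k = i then 1 else 0))"
    by (rule sum.cong[OF refl], subst inverse_right') (use U in \<open>auto simp: U_def\<close>)
  also have "\<dots> = c i"
    by (simp add: if_distrib[of "\<lambda>x. _ * x"] assms cong: if_cong)
  finally show "s_to_f (f_to_s c) i = c i" .
qed

lemma s_to_f_to_s:
  assumes "finite {i. d i \<noteq> 0}"
  shows "f_to_s (s_to_f d) = d"
proof
  fix j
  define U where "U = (\<Union>i\<in>{i. d i \<noteq> 0}. D (deg i))"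
  have U: "finite U" unfolding U_def by (rule finite_D_UN[OF assms])
  have "f_to_s (s_to_f d) j = (\<Sum>i\<in>U. s_to_f d i * B i j)"
    unfolding f_to_s_def
    by (rule sum.mono_neutral_left) (use U s_to_f_support[of d] in \<open>auto simp: U_def\<close>)
  also have "\<dots> = (\<Sum>i\<in>U. \<Sum>k | d k \<noteq> 0. d k * (B i j * A i k))"
    by (simp add: s_to_f_def sum_distrib_right sum_distrib_left mult_ac)
  also have "\<dots> = (\<Sum>k | d k \<noteq> 0. \<Sum>i\<in>U. d k * (B i j * A i k))"
    by (rule sum.swap)
  also have "\<dots> = (\<Sum>k | d k \<noteq> 0. d k * (\<Sum>i\<in>U. B i j * A i k))"
    by (simp add: sum_distrib_left)
  also have "\<dots> = (\<Sum>k | d k \<noteq> 0. d k * (if j = k then 1 else 0))"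
    by (rule sum.cong[OF refl], subst inverse_left') (use U in \<open>auto simp: U_def\<close>)
  also have "\<dots> = d j"
    by (simp add: if_distrib[of "\<lambda>x. _ * x"] assms cong: if_cong)
  finally show "f_to_s (s_to_f d) j = d j" .
qed

lemma G_to_s_to_G: "s_to_G (G_to_s c) = c"
proof
  fix i
  have "G_to_s c j = (\<Sum>k\<in>D (deg i). c k * A k j)" if "j \<in> D (deg i)" for j
    unfolding G_to_s_def
    by (rule sum.mono_neutral_left) (use that finite_deg_le A_upper in \<open>auto dest:
        order_trans\<close>)
  then have "s_to_G (G_to_s c) i = (\<Sum>j\<in>D (deg i). \<Sum>k\<in>D (deg i). c k * (B i j * A k j))"
    by (simp add: s_to_G_def sum_distrib_left mult_ac)
  also have "\<dots> = (\<Sum>k\<in>D (deg i). \<Sum>j\<in>D (deg i). c k * (B i j * A k j))"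
    by (rule sum.swap)
  also have "\<dots> = (\<Sum>k\<in>D (deg i). c k * (if i = k then 1 else 0))"
    by (simp only: sum_distrib_left[symmetric] inverse_right)
  also have "\<dots> = c i"
    by (simp add: if_distrib[of "\<lambda>x. _ * x"] finite_deg_le cong: if_cong)
  finally show "s_to_G (G_to_s c) i = c i" .
qed

lemma s_to_G_to_s: "G_to_s (s_to_G d) = d"
proof
  fix k
  have "s_to_G d i = (\<Sum>j\<in>D (deg k). B i j * d j)" if "i \<in> D (deg k)" for i
    unfolding s_to_G_def
    by (rule sum.mono_neutral_left) (use that finite_deg_le B_lower in \<open>auto dest:
        order_trans\<close>)
  then have "G_to_s (s_to_G d) k = (\<Sum>i\<in>D (deg k). \<Sum>j\<in>D (deg k). d j * (B i j * A i k))"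
    by (simp add: G_to_s_def sum_distrib_right sum_distrib_left mult_ac)
  also have "\<dots> = (\<Sum>j\<in>D (deg k). \<Sum>i\<in>D (deg k). d j * (B i j * A i k))"
    by (rule sum.swap)
  also have "\<dots> = (\<Sum>j\<in>D (deg k). d j * (if j = k then 1 else 0))"
    by (simp only: sum_distrib_left[symmetric] inverse_left)
  also have "\<dots> = d k"
    by (simp add: if_distrib[of "\<lambda>x. _ * x"] finite_deg_le cong: if_cong)
  finally show "G_to_s (s_to_G d) k = d k" .
qed

lemma expands_f_iff:
  assumes "finite {i. c i \<noteq> 0}"
  shows "expands f c h \<longleftrightarrow> h = comb s (f_to_s c)"
proof -
  have "summable_comb f c"
    unfolding summable_comb_def
  proof
    fix m
    show "finite {i. c i * f i m \<noteq> 0}" by (rule finite_subset[OF _ assms]) auto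
  qed
  moreover have "comb f c = comb s (f_to_s c)"
  proof
    fix m
    have "comb f c m = (\<Sum>i | c i \<noteq> 0. c i * f i m)"
      by (rule comb_eq_sum) (use assms in auto)
    also have "\<dots> = (\<Sum>i | c i \<noteq> 0. \<Sum>j | s j m \<noteq> 0. c i * B i j * s j m)"
      by (simp add: f_eq comb_sum sum_distrib_left mult_ac)
    also have "\<dots> = (\<Sum>j | s j m \<noteq> 0. \<Sum>i | c i \<noteq> 0. c i * B i j * s j m)"
      by (rule sum.swap)
    also have "\<dots> = comb s (f_to_s c) m"
      by (simp add: comb_sum f_to_s_def sum_distrib_right)
    finally show "comb f c m = comb s (f_to_s c) m" .
  qed
  ultimately show ?thesis by (simp add: expands_def)
qed

text \<open>A monomial occurs in finitely many \<open>s j\<close>, and \<open>G i\<close> involves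
  only those \<open>s j\<close> with \<open>deg i \<le> deg j\<close>. Hence it occurs in finitely
  many \<open>G i\<close>, and every coefficient function is admissible.\<close>

lemma expands_G_iff: "expands G c h \<longleftrightarrow> h = comb s (G_to_s c)"
proof -
  define U where "U = (\<lambda>m. \<Union>j\<in>{j. s j m \<noteq> 0}. D (deg j))"
  have U: "finite (U m)" for m unfolding U_def by (rule finite_D_UN[OF finite_nonzero])
  have G_U: "i \<in> U m" if "G i m \<noteq> 0" for i m
  proof -
    from that obtain j where "s j m \<noteq> 0" "A i j * s j m \<noteq> 0"
      unfolding G_eq comb_sum by (rule sum.not_neutral_contains_not_neutral) auto
    then show ?thesis using A_upper by (auto simp: U_def)
  qed
  have "summable_comb G c"
    unfolding summable_comb_def
  proof
    fix m
    show "finite {i. c i * G i m \<noteq> 0}" by (rule finite_subset[OF _ U[of m]]) (use G_U in auto)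
  qed
  moreover have "comb G c = comb s (G_to_s c)"
  proof
    fix m
    have "comb G c m = (\<Sum>i\<in>U m. c i * G i m)"
      by (rule comb_eq_sum) (use U G_U in auto)
    also have "\<dots> = (\<Sum>i\<in>U m. \<Sum>j | s j m \<noteq> 0. c i * A i j * s j m)"
      by (simp add: G_eq comb_sum sum_distrib_left mult_ac)
    also have "\<dots> = (\<Sum>j | s j m \<noteq> 0. (\<Sum>i\<in>U m. c i * A i j) * s j m)"
      by (subst sum.swap) (simp add: sum_distrib_right)
    also have "\<dots> = (\<Sum>j | s j m \<noteq> 0. G_to_s c j * s j m)"
    proof (rule sum.cong[OF refl])
      fix j assume j: "j \<in> {j. s j m \<noteq> 0}"
      have "(\<Sum>i\<in>U m. c i * A i j) = G_to_s c j"
        unfolding G_to_s_def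
        by (rule sum.mono_neutral_right) (use U A_upper j in \<open>auto simp: U_def\<close>)
      then show "(\<Sum>i\<in>U m. c i * A i j) * s j m = G_to_s c j * s j m" by simp
    qed
    also have "\<dots> = comb s (G_to_s c) m" by (simp add: comb_sum)
    finally show "comb G c m = comb s (G_to_s c) m" .
  qed
  ultimately show ?thesis by (simp add: expands_def)
qed

lemma fin_span_f: "fin_span f = fin_span s"
proof (intro subset_antisym subsetI)
  fix h assume "h \<in> fin_span f"
  then obtain c where "finite {i. c i \<noteq> 0}" "h = comb s (f_to_s c)"
    by (auto simp: fin_span_def expands_f_iff)
  then show "h \<in> fin_span s" using finite_f_to_s by (auto simp: fin_span_eq)
next
  fix h assume "h \<in> fin_span s"
  then obtain d where "finite {i. d i \<noteq> 0}" "h = comb s d" by (auto simp: fin_span_eq)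
  then have "finite {i. s_to_f d i \<noteq> 0} \<and> expands f (s_to_f d) h"
    by (simp add: finite_s_to_f expands_f_iff s_to_f_to_s)
  then show "h \<in> fin_span f" by (auto simp: fin_span_def)
qed

lemma inf_span_G: "inf_span G = inf_span s"
proof -
  have "\<exists>c. comb s d = comb s (G_to_s c)" for d
    by (rule exI[of _ "s_to_G d"]) (simp add: s_to_G_to_s)
  then show ?thesis by (auto simp: inf_span_def expands_G_iff expands_iff)
qed

lemma pairing_f_G: "orthonormal_pairing s (f i) (G k) = (if i = k then 1 else 0)"
proof -
  have "orthonormal_pairing s (f i) (G k) = (\<Sum>j\<in>D (deg i). B i j * A k j)"
    unfolding f_eq G_eq by (rule pairing_comb) (use finite_deg_le B_lower in auto)
  then show ?thesis by (simp add: inverse_right)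
qed

text \<open>The pairing of the finite combination \<open>a\<close> with \<open>G i\<close> is
  \<open>s_to_f a i\<close>, which is zero once \<open>deg i\<close> exceeds all degrees in the
  support of \<open>a\<close>. This bound is what makes the pairing continuous.\<close>

lemma pairing_comb_G_to_s:
  assumes a: "finite {j. a j \<noteq> 0}"
  shows "{i. c i * orthonormal_pairing s (comb s a) (G i) \<noteq> 0} \<subseteq>
      (\<Union>j\<in>{j. a j \<noteq> 0}. D (deg j))"
    and "orthonormal_pairing s (comb s a) (comb s (G_to_s c)) =
      (\<Sum>i | c i * orthonormal_pairing s (comb s a) (G i) \<noteq> 0.
        c i * orthonormal_pairing s (comb s a) (G i))"
proof -
  define U where "U = (\<Union>j\<in>{j. a j \<noteq> 0}. D (deg j))"
  have U: "finite U" unfolding U_def by (rule finite_D_UN[OF a])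
  have P: "orthonormal_pairing s (comb s a) (G i) = (\<Sum>j | a j \<noteq> 0. a j * A i j)" for i
    unfolding G_eq by (rule pairing_comb) (use a in auto)
  have sub: "{i. c i * orthonormal_pairing s (comb s a) (G i) \<noteq> 0} \<subseteq> U"
    using s_to_f_support[of a] unfolding P s_to_f_def U_def by auto
  then show "{i. c i * orthonormal_pairing s (comb s a) (G i) \<noteq> 0} \<subseteq>
      (\<Union>j\<in>{j. a j \<noteq> 0}. D (deg j))"
    by (simp add: U_def)
  have "(\<Sum>i | c i * orthonormal_pairing s (comb s a) (G i) \<noteq> 0.
        c i * orthonormal_pairing s (comb s a) (G i))
      = (\<Sum>i\<in>U. c i * orthonormal_pairing s (comb s a) (G i))"
    by (rule sum.mono_neutral_left) (use U sub in auto)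
  also have "\<dots> = (\<Sum>i\<in>U. \<Sum>j | a j \<noteq> 0. a j * (c i * A i j))"
    by (simp add: P sum_distrib_left mult_ac)
  also have "\<dots> = (\<Sum>j | a j \<noteq> 0. a j * (\<Sum>i\<in>U. c i * A i j))"
    by (subst sum.swap) (simp add: sum_distrib_left)
  also have "\<dots> = (\<Sum>j | a j \<noteq> 0. a j * G_to_s c j)"
  proof (rule sum.cong[OF refl])
    fix j assume j: "j \<in> {j. a j \<noteq> 0}"
    have "(\<Sum>i\<in>U. c i * A i j) = G_to_s c j"
      unfolding G_to_s_def
      by (rule sum.mono_neutral_right) (use U A_upper j in \<open>auto simp: U_def\<close>)
    then show "a j * (\<Sum>i\<in>U. c i * A i j) = a j * G_to_s c j" by simp
  qed
  also have "\<dots> = orthonormal_pairing s (comb s a) (comb s (G_to_s c))"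
    by (rule pairing_comb[symmetric]) (use a in auto)
  finally show "orthonormal_pairing s (comb s a) (comb s (G_to_s c)) =
      (\<Sum>i | c i * orthonormal_pairing s (comb s a) (G i) \<noteq> 0.
        c i * orthonormal_pairing s (comb s a) (G i))" by simp
qed

lemma continuous_pairing:
  assumes "h \<in> fin_span s"
  shows "continuous_functional G (orthonormal_pairing s h)"
proof -
  from assms obtain a where a: "finite {j. a j \<noteq> 0}" and h: "h = comb s a"
    by (auto simp: fin_span_eq)
  show ?thesis
    unfolding continuous_functional_def expands_G_iff h
    using pairing_comb_G_to_s[OF a] finite_subset[OF pairing_comb_G_to_s(1)[OF a] finite_D_UN[OF a]]
    by blast
qed

lemma continuous_functional_eqI:
  assumes "continuous_functional G \<phi>" "continuous_functional G \<psi>"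
    and "\<And>i. \<phi> (G i) = \<psi> (G i)" and "h \<in> inf_span s"
  shows "\<phi> h = \<psi> h"
proof -
  from assms(4) obtain c where "expands G c h"
    unfolding inf_span_G[symmetric] by (auto simp: inf_span_def)
  then show ?thesis using assms(1-3) by (simp add: continuous_functional_def)
qed

lemma representable:
  assumes "continuous_functional G \<phi>"
  shows "\<exists>!h. h \<in> fin_span s \<and> (\<forall>k\<in>inf_span s. orthonormal_pairing s h
      k = \<phi> k)"
proof -
  define a where "a = (\<lambda>i. \<phi> (G i))"
  \<comment> \<open>Continuity is applied to the combination with all coefficients 1: the finiteness
    that it demands says that \<open>\<phi>\<close> is nonzero on only finitely many
    \<open>G i\<close>.\<close>
  have "expands G (\<lambda>i. 1) (comb s (G_to_s (\<lambda>i. 1)))" by (simp add: expands_G_iff)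
  then have "finite {i. 1 * \<phi> (G i) \<noteq> 0}"
    using assms unfolding continuous_functional_def by blast
  then have a: "finite {i. a i \<noteq> 0}" by (simp add: a_def)
  define h where "h = comb s (f_to_s a)"
  have h: "h \<in> fin_span s" using finite_f_to_s[OF a] by (auto simp: h_def fin_span_eq)
  have "orthonormal_pairing s h (G k) = \<phi> (G k)" for k
  proof -
    have "orthonormal_pairing s h (G k) = (\<Sum>j | f_to_s a j \<noteq> 0. f_to_s a j * A k j)"
      unfolding h_def G_eq by (rule pairing_comb) (use finite_f_to_s[OF a] in auto)
    also have "\<dots> = s_to_f (f_to_s a) k" by (simp add: s_to_f_def)
    finally show ?thesis unfolding f_to_s_to_f[OF a] by (simp only: a_def)
  qed
  then have *: "\<forall>k\<in>inf_span s. orthonormal_pairing s h k = \<phi> k"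
    using continuous_functional_eqI[OF continuous_pairing[OF h] assms] by blast
  \<comment> \<open>Uniqueness: pairing with \<open>s i\<close>, itself an element of the
    completion, reads off the coordinate at \<open>i\<close>.\<close>
  have "h' = h" if "h' \<in> fin_span s" "\<forall>k\<in>inf_span s. orthonormal_pairing s h' k =
      \<phi> k" for h'
  proof -
    from that(1) obtain b where b: "h' = comb s b" by (auto simp: fin_span_eq)
    have "b i = f_to_s a i" for i
    proof -
      have P: "orthonormal_pairing s (comb s c) (s i) = c i" for c
        by (subst comb_unit[symmetric], subst pairing_comb[of "{i}"]) auto
      have "s i \<in> inf_span s" by (subst comb_unit[symmetric]) (simp add: inf_span_eq)
      with that(2) * have "orthonormal_pairing s h' (s i) = orthonormal_pairing s h (s i)" by simp
      then show ?thesis by (simp add: b h_def P)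
    qed
    then have "b = f_to_s a" by (rule ext)
    then show ?thesis by (simp add: b h_def)
  qed
  with h * show ?thesis by blast
qed

theorem continuously_dual:
  "continuously_dual (orthonormal_pairing s) (fin_span s) (inf_span s) f G"
  unfolding continuously_dual_def
proof (intro conjI)
  show "is_basis f (fin_span s)"
    unfolding is_basis_def
  proof (intro conjI allI impI ballI)
    fix c :: "'s \<Rightarrow> int" assume c: "finite {s. c s \<noteq> 0}"
    then have "comb s (f_to_s c) \<in> fin_span s" using finite_f_to_s by (auto simp: fin_span_eq)
    then show "\<exists>h\<in>fin_span s. expands f c h" using c by (auto simp: expands_f_iff)
  next
    fix h assume "h \<in> fin_span s"
    then obtain d where d: "finite {i. d i \<noteq> 0}" "h = comb s d" by (auto simp: fin_span_eq)
    show "\<exists>!c. finite {s. c s \<noteq> 0} \<and> expands f c h"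
    proof (rule ex1I[of _ "s_to_f d"])
      show "finite {s. s_to_f d s \<noteq> 0} \<and> expands f (s_to_f d) h"
        using d by (simp add: finite_s_to_f expands_f_iff s_to_f_to_s)
      fix c assume c: "finite {s. c s \<noteq> 0} \<and> expands f c h"
      then have "comb s d = comb s (f_to_s c)" using d expands_f_iff[of c h] by blast
      then show "c = s_to_f d" using f_to_s_to_f[of c] c by (simp add: comb_inject)
    qed
  qed
  show "is_topological_basis G (inf_span s)"
    unfolding is_topological_basis_def
  proof (intro conjI allI ballI)
    fix c show "\<exists>h\<in>inf_span s. expands G c h"
      by (auto simp: expands_G_iff inf_span_eq)
  next
    fix h assume "h \<in> inf_span s"
    then obtain d where d: "h = comb s d" by (auto simp: inf_span_eq)
    show "\<exists>!c. expands G c h"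
      by (rule ex1I[of _ "s_to_G d"])
        (auto simp: d expands_G_iff s_to_G_to_s comb_inject G_to_s_to_G)
  qed
  show "\<forall>f\<in>fin_span s. \<forall>g\<in>fin_span s. \<forall>h\<in>inf_span s.
      orthonormal_pairing s (f + g) h = orthonormal_pairing s f h + orthonormal_pairing s g h"
  proof (intro ballI)
    fix f g h assume "f \<in> fin_span s" "g \<in> fin_span s" "h \<in> inf_span s"
    then obtain c d e where c: "finite {i. c i \<noteq> 0}" "f = comb s c"
      and d: "finite {i. d i \<noteq> 0}" "g = comb s d" and e: "h = comb s e"
      by (auto simp: fin_span_eq inf_span_eq)
    define U where "U = {i. c i \<noteq> 0} \<union> {i. d i \<noteq> 0}"
    have "finite U" using c d by (simp add: U_def)
    then have "orthonormal_pairing s (comb s (\<lambda>i. c i + d i)) h = (\<Sum>i\<in>U. (c i + d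
        i) * e i)"
      "orthonormal_pairing s f h = (\<Sum>i\<in>U. c i * e i)"
      "orthonormal_pairing s g h = (\<Sum>i\<in>U. d i * e i)"
      unfolding c d e by (auto intro!: pairing_comb simp: U_def)
    then show "orthonormal_pairing s (f + g) h =
        orthonormal_pairing s f h + orthonormal_pairing s g h"
      by (simp add: c d comb_plus sum.distrib distrib_right)
  qed
qed (use continuous_pairing representable pairing_f_G in auto)

end

section \<open>Partitions and their rows\<close>

text \<open>Extended by zero, a partition becomes a weakly decreasing sequence, and containment and
  strip conditions become inequalities between sequences without side conditions on lengths.\<close>

definition row :: "partition \<Rightarrow> nat \<Rightarrow> nat" where
  "row lam i = (if i < length (parts lam) then parts lam ! i else 0)"

definition len :: "partition \<Rightarrow> nat" where
  "len lam = length (parts lam)"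

lemma diagram_iff: "(i, j) \<in> diagram lam \<longleftrightarrow> j < row lam i"
  by (auto simp: diagram_def row_def)

lemma parts_props: "sorted_wrt (\<ge>) (parts lam)" "0 \<notin> set (parts lam)"
  using parts[of lam] by auto

lemma row_antimono: "i \<le> j \<Longrightarrow> row lam j \<le> row lam i"
  using parts_props(1)[of lam]
  by (cases "i = j") (auto simp: row_def sorted_wrt_iff_nth_less)

lemma row_pos_iff: "0 < row lam i \<longleftrightarrow> i < len lam"
  using parts_props(2)[of lam] by (auto simp: row_def len_def in_set_conv_nth)

lemma row_eq_0_iff: "row lam i = 0 \<longleftrightarrow> len lam \<le> i"
  using row_pos_iff[of lam i] by auto

lemma row_inject: "row lam = row mu \<longleftrightarrow> lam = mu"
proof
  assume *: "row lam = row mu"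
  have "len lam = len mu"
    using row_eq_0_iff[of lam "len lam"] row_eq_0_iff[of lam "len mu"]
      row_eq_0_iff[of mu "len lam"] row_eq_0_iff[of mu "len mu"] * by simp
  with * have "parts lam = parts mu"
    unfolding len_def
  proof (intro nth_equalityI)
    fix i assume "i < length (parts lam)"
    with \<open>len lam = len mu\<close> show "parts lam ! i = parts mu ! i"
      using fun_cong[OF *, of i] by (simp add: len_def row_def)
  qed
  then show "lam = mu" by (simp add: parts_inject)
qed simp

lemma partition_eqI: "(\<And>i. row lam i = row mu i) \<Longrightarrow> lam = mu"
  using row_inject[of lam mu] by (simp add: fun_eq_iff)

lemma ex_partition:
  assumes "\<And>i. r (Suc i) \<le> r i" "\<And>i. n \<le> i \<Longrightarrow> r i = 0"
  shows "\<exists>lam. row lam = (r :: nat \<Rightarrow> nat)"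
proof -
  define N where "N = (LEAST i. r i = 0)"
  have N: "r N = 0" unfolding N_def by (rule LeastI[of _ n]) (simp add: assms)
  have mono: "r j \<le> r i" if "i \<le> j" for i j
    using lift_Suc_antimono_le[of r i j] assms(1) that by blast
  have pos: "r i \<noteq> 0" if "i < N" for i
    using not_less_Least[of i "\<lambda>i. r i = 0"] that by (simp add: N_def)
  let ?xs = "map r [0..<N]"
  have "sorted_wrt (\<ge>) ?xs \<and> 0 \<notin> set ?xs"
    using mono pos by (auto simp: sorted_wrt_iff_nth_less) (metis less_irrefl)
  then have p: "parts (Partition ?xs) = ?xs" by (intro Partition_inverse) simp
  have "row (Partition ?xs) i = r i" for i
    using mono[of N i] N by (auto simp: row_def p)
  then show ?thesis by blast
qed

definition of_rows :: "(nat \<Rightarrow> nat) \<Rightarrow> partition" where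
  "of_rows r = (THE lam. row lam = r)"

lemma row_of_rows:
  assumes "\<And>i. r (Suc i) \<le> r i" "\<And>i. n \<le> i \<Longrightarrow> r i = 0"
  shows "row (of_rows r) = r"
proof -
  obtain lam where "row lam = r" using ex_partition[of r n] assms by blast
  then show ?thesis unfolding of_rows_def by (metis (mono_tags, lifting) theI row_inject)
qed

lemma diagram_inject: "diagram lam = diagram mu \<longleftrightarrow> lam = mu"
proof
  assume *: "diagram lam = diagram mu"
  show "lam = mu"
  proof (rule partition_eqI)
    fix i
    have "j < row lam i \<longleftrightarrow> j < row mu i" for j using * by (simp add:
        diagram_iff[symmetric])
    then show "row lam i = row mu i" by (metis nat_neq_iff)
  qed
qed simp

lemma diagram_eq_Sigma: "diagram lam = (SIGMA i:{..<len lam}. {..<row lam i})"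
proof -
  have "i < len lam" if "j < row lam i" for i j
    using that row_pos_iff[of lam i] by linarith
  then show ?thesis by (auto simp: diagram_iff)
qed

lemma finite_diagram [simp]: "finite (diagram lam)"
  by (simp add: diagram_eq_Sigma)

lemma psize_eq: "psize lam = (\<Sum>i<len lam. row lam i)"
  by (simp add: psize_def len_def row_def sum_list_sum_nth atLeast0LessThan)

lemma psize_eq_sum: "len lam \<le> n \<Longrightarrow> psize lam = (\<Sum>i<n. row lam i)"
  unfolding psize_eq
  by (rule sum.mono_neutral_left) (auto simp: row_eq_0_iff)

lemma card_diagram: "card (diagram lam) = psize lam"
  by (simp add: diagram_eq_Sigma psize_eq)

lemma diagram_subset_iff: "diagram mu \<subseteq> diagram lam \<longleftrightarrow> (\<forall>i.
    row mu i \<le> row lam i)"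
proof
  assume *: "diagram mu \<subseteq> diagram lam"
  show "\<forall>i. row mu i \<le> row lam i"
  proof (rule allI, rule ccontr)
    fix i assume "\<not> row mu i \<le> row lam i"
    then have "(i, row lam i) \<in> diagram mu" by (simp add: diagram_iff)
    with * have "(i, row lam i) \<in> diagram lam" by blast
    then show False by (simp add: diagram_iff)
  qed
qed (auto simp: diagram_iff, metis less_le_trans)

lemma len_mono: "diagram mu \<subseteq> diagram lam \<Longrightarrow> len mu \<le> len lam"
  using row_eq_0_iff[of mu "len lam"] row_eq_0_iff[of lam "len lam"]
  unfolding diagram_subset_iff by (metis le_zero_eq order_refl)

lemma psize_mono: "diagram mu \<subseteq> diagram lam \<Longrightarrow> psize mu \<le> psize lam"
  unfolding card_diagram[symmetric] by (rule card_mono) auto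

lemma psize_eq_subset_eq: "diagram mu \<subseteq> diagram lam \<Longrightarrow> psize mu = psize
    lam \<Longrightarrow> mu = lam"
  unfolding card_diagram[symmetric] diagram_inject[symmetric] by (rule card_subset_eq[OF finite_diagram])

lemma len_le_psize: "len lam \<le> psize lam"
proof -
  have "(\<Sum>i<len lam. 1) \<le> (\<Sum>i<len lam. row lam i)"
    by (rule sum_mono) (use row_pos_iff[of lam] in \<open>auto simp: Suc_le_eq\<close>)
  then show ?thesis by (simp add: psize_eq)
qed

lemma row_le_psize: "row lam i \<le> psize lam"
proof (cases "i < len lam")
  case True
  then show ?thesis unfolding psize_eq by (intro member_le_sum) auto
next
  case False
  then show ?thesis using row_eq_0_iff[of lam i] by simp
qed

lemma finite_psize_le: "finite {lam. psize lam \<le> n}"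
proof (rule finite_imageD)
  show "inj_on parts {lam. psize lam \<le> n}" by (simp add: inj_on_def parts_inject)
  have "parts lam \<in> {xs. set xs \<subseteq> {..n} \<and> length xs \<le> n}" if "psize lam
      \<le> n" for lam
  proof -
    have "parts lam ! i \<le> n" if "i < length (parts lam)" for i
      using that \<open>psize lam \<le> n\<close> row_le_psize[of lam i] by (simp add: row_def)
    then show ?thesis
      using that len_le_psize[of lam] by (auto simp: in_set_conv_nth len_def)
  qed
  then have "parts ` {lam. psize lam \<le> n} \<subseteq> {xs. set xs \<subseteq> {..n} \<and>
      length xs \<le> n}"
    by blast
  then show "finite (parts ` {lam. psize lam \<le> n})"
    by (rule finite_subset) (rule finite_lists_length_le, simp)
qed

lemma finite_psize_eq [simp]: "finite {lam. psize lam = n}"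
  by (rule finite_subset[OF _ finite_psize_le[of n]]) auto

lemma finite_subdiagrams [simp]: "finite {mu. diagram mu \<subseteq> diagram lam}"
  by (rule finite_subset[OF _ finite_psize_le[of "psize lam"]]) (auto intro: psize_mono)

definition empty_partition :: partition where
  "empty_partition = Partition []"

lemma parts_empty [simp]: "parts empty_partition = []"
  by (simp add: empty_partition_def Partition_inverse)

lemma empty_partition_simps [simp]: "row empty_partition i = 0" "len empty_partition = 0"
    "psize empty_partition = 0" "diagram empty_partition = {}"
  by (auto simp: row_def len_def psize_def diagram_def)

lemma psize_eq_0_iff [simp]: "psize lam = 0 \<longleftrightarrow> lam = empty_partition"
  using psize_eq_subset_eq[of empty_partition lam] by auto

lemma diagram_eq_empty_iff [simp]: "diagram lam = {} \<longleftrightarrow> lam = empty_partition"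
  using diagram_inject[of lam empty_partition] by simp

text \<open>Each row of such a set is an initial segment, so the row lengths \<open>r\<close>
  describe it. This supplies the conjugate partition and the shape formed by the smaller entries of
  a tableau.\<close>

lemma down_closed_diagram:
  assumes "finite S" "\<And>i j. (Suc i, j) \<in> S \<Longrightarrow> (i, j) \<in> S" "\<And>i j.
      (i, Suc j) \<in> S \<Longrightarrow> (i, j) \<in> S"
  shows "\<exists>lam. diagram lam = S"
proof -
  define r where "r = (\<lambda>i. card {j. (i, j) \<in> S})"
  have fin: "finite {j. (i, j) \<in> S}" for i
  proof (rule finite_subset[of _ "snd ` S"])
    show "{j. (i, j) \<in> S} \<subseteq> snd ` S" by force
  qed (use assms(1) in simp)
  have mem: "(i, j) \<in> S \<longleftrightarrow> j < r i" for i j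
  proof -
    have le: "(i, j') \<in> S" if "(i, j) \<in> S" "j' \<le> j" for j j'
      using that(2,1) by (induction rule: inc_induct) (auto intro: assms(3))
    show ?thesis
    proof
      assume "(i, j) \<in> S"
      then have "{..j} \<subseteq> {j. (i, j) \<in> S}" using le by auto
      then have "card {..j} \<le> r i" unfolding r_def by (rule card_mono[OF fin])
      then show "j < r i" by simp
    next
      assume *: "j < r i"
      show "(i, j) \<in> S"
      proof (rule ccontr)
        assume "(i, j) \<notin> S"
        then have "{j. (i, j) \<in> S} \<subseteq> {..<j}" using le by (auto simp: not_le[symmetric])
        then have "r i \<le> card {..<j}" unfolding r_def by (rule card_mono[OF finite_lessThan])
        with * show False by simp
      qed
    qed
  qed
  obtain n where n: "fst ` S \<subseteq> {..<n}"
    using assms(1) finite_nat_set_iff_bounded[of "fst ` S"] by auto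
  have "r (Suc i) \<le> r i" for i
    unfolding r_def by (rule card_mono[OF fin]) (auto intro: assms(2))
  moreover have "r i = 0" if "n \<le> i" for i
  proof -
    have "{j. (i, j) \<in> S} = {}" using n that by force
    then show ?thesis by (simp add: r_def)
  qed
  ultimately obtain lam where "row lam = r" using ex_partition[of r n] by blast
  then have "diagram lam = S" by (auto simp: diagram_iff mem)
  then show ?thesis by blast
qed

lemma diagram_up: "(Suc i, j) \<in> diagram lam \<Longrightarrow> (i, j) \<in> diagram lam"
  using row_antimono[of i "Suc i" lam] by (simp add: diagram_iff)

lemma diagram_left: "(i, Suc j) \<in> diagram lam \<Longrightarrow> (i, j) \<in> diagram lam"
  by (simp add: diagram_iff)

lemma diagram_conjugate: "diagram (conjugate lam) = {(j, i). (i, j) \<in> diagram lam}"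
proof -
  have "finite {(j, i). (i, j) \<in> diagram lam}"
    by (rule finite_subset[of _ "(\<lambda>(i, j). (j, i)) ` diagram lam"]) auto
  then have "\<exists>mu. diagram mu = {(j, i). (i, j) \<in> diagram lam}"
    by (rule down_closed_diagram) (auto intro: diagram_up diagram_left)
  then show ?thesis unfolding conjugate_def
    by (metis (mono_tags, lifting) theI diagram_inject)
qed

lemma conjugate_conjugate [simp]: "conjugate (conjugate lam) = lam"
  by (subst diagram_inject[symmetric]) (simp add: diagram_conjugate)

lemma psize_conjugate [simp]: "psize (conjugate lam) = psize lam"
proof -
  have "diagram (conjugate lam) = prod.swap ` diagram lam" by (force simp: diagram_conjugate)
  then show ?thesis unfolding card_diagram[symmetric] by (simp add: card_image)
qed

lemma conjugate_subset_iff: "diagram (conjugate mu) \<subseteq> diagram (conjugate lam)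
    \<longleftrightarrow> diagram mu \<subseteq> diagram lam"
  by (auto simp: diagram_conjugate)

lemma conjugate_empty [simp]: "conjugate empty_partition = empty_partition"
  by (subst diagram_inject[symmetric]) (simp add: diagram_conjugate)

section \<open>Strips and the commutation relation\<close>

text \<open>The exponent of a new largest variable in \<open>dual_groth\<close>, because an entry of
  a reverse plane partition counts once per column.\<close>

definition columns :: "partition \<Rightarrow> partition \<Rightarrow> nat" where
  "columns lam mu = card (snd ` (diagram lam - diagram mu))"

definition horizontal_strip :: "partition \<Rightarrow> partition \<Rightarrow> bool" where
  "horizontal_strip lam mu \<longleftrightarrow> diagram mu \<subseteq> diagram lam \<and>
     (\<forall>i j. (Suc i, j) \<in> diagram lam \<longrightarrow> (i, j) \<in> diagram mu)"

text \<open>The corners of \<open>mu\<close> with no box of \<open>lam\<close> below them. In a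
  set-valued tableau these are the boxes with smaller entries that may hold the largest entry as
  well.\<close>

definition free_corners :: "partition \<Rightarrow> partition \<Rightarrow> (nat \<times> nat) set" where
  "free_corners lam mu =
     {(i, j). (i, j) \<in> diagram mu \<and> (i, Suc j) \<notin> diagram mu \<and> (Suc i, j)
         \<notin> diagram lam}"

lemma horizontal_strip_iff:
  "horizontal_strip lam mu \<longleftrightarrow> (\<forall>i. row mu i \<le> row lam i \<and> row
      lam (Suc i) \<le> row mu i)"
proof -
  have "(\<forall>j. j < row lam (Suc i) \<longrightarrow> j < row mu i) \<longleftrightarrow> row
      lam (Suc i) \<le> row mu i" for i
    by (metis less_irrefl less_le_trans not_le)
  then show ?thesis
    unfolding horizontal_strip_def diagram_subset_iff diagram_iff by blast
qed

text \<open>Only the last box of a row of \<open>mu\<close> can be a free corner, and it is one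
  exactly when that row reaches beyond the next row of \<open>lam\<close>. The count becomes a sum
  over rows.\<close>

lemma card_free_corners:
  assumes "len mu \<le> n"
  shows "card (free_corners lam mu) = (\<Sum>i<n. if row lam (Suc i) < row mu i then 1 else 0)"
proof -
  have "free_corners lam mu = (\<lambda>i. (i, row mu i - 1)) ` {i. row lam (Suc i) < row mu i}"
    by (auto simp: free_corners_def diagram_iff image_iff)
  moreover have "inj_on (\<lambda>i. (i, row mu i - 1)) {i. row lam (Suc i) < row mu i}"
    by (auto simp: inj_on_def)
  ultimately have "card (free_corners lam mu) = card {i. row lam (Suc i) < row mu i}"
    by (simp add: card_image)
  also have "{i. row lam (Suc i) < row mu i} = {i \<in> {..<n}. row lam (Suc i) < row mu i}"
  proof -
    have "i < n" if "row lam (Suc i) < row mu i" for i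
      using that assms row_pos_iff[of mu i] by linarith
    then show ?thesis by auto
  qed
  also have "card \<dots> = (\<Sum>i<n. if row lam (Suc i) < row mu i then 1 else 0)"
    by (subst sum.If_cases) (auto simp: Int_def)
  finally show ?thesis .
qed

text \<open>Each column is counted at its topmost box in the skew shape. The term of row
  \<open>i + 1\<close> then depends on no other row of \<open>lam\<close>, which is what a sum over
  varying outer partitions needs.\<close>

lemma columns_top:
  assumes "len lam \<le> Suc n"
  shows "columns lam mu =
    (row lam 0 - row mu 0) + (\<Sum>i<n. min (row lam (Suc i)) (row mu i) - row mu (Suc i))"
proof -
  define I where "I = (\<lambda>i. case i of 0 \<Rightarrow> {row mu 0..<row lam 0}
    | Suc i \<Rightarrow> {row mu (Suc i)..<min (row lam (Suc i)) (row mu i)})"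
  have I: "j \<in> I i \<longleftrightarrow> row mu i \<le> j \<and> j < row lam i \<and> (i = 0
      \<or> j < row mu (i - 1))" for i j
    by (cases i) (auto simp: I_def)
  have "snd ` (diagram lam - diagram mu) = (\<Union>i\<in>{..n}. I i)"
  proof (intro equalityI subsetI)
    fix j assume "j \<in> snd ` (diagram lam - diagram mu)"
    then have ex: "\<exists>i. row mu i \<le> j \<and> j < row lam i" by (force simp: diagram_iff)
    define i where "i = (LEAST i. row mu i \<le> j \<and> j < row lam i)"
    have i: "row mu i \<le> j" "j < row lam i" using LeastI_ex[OF ex] by (auto simp: i_def)
    have "j < row mu (i - 1)" if "i \<noteq> 0"
    proof -
      have "\<not> (row mu (i - 1) \<le> j \<and> j < row lam (i - 1))"
        using not_less_Least[of "i - 1" "\<lambda>i. row mu i \<le> j \<and> j < row lam i"] that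
        unfolding i_def[symmetric] by linarith
      then show ?thesis using row_antimono[of "i - 1" i lam] i by linarith
    qed
    then have "j \<in> I i" using i I by auto
    moreover have "i \<le> n" using i row_pos_iff[of lam i] assms by linarith
    ultimately show "j \<in> (\<Union>i\<in>{..n}. I i)" by auto
  next
    fix j assume "j \<in> (\<Union>i\<in>{..n}. I i)"
    then have "\<exists>i. row mu i \<le> j \<and> j < row lam i" using I by auto
    then obtain i where "(i, j) \<in> diagram lam - diagram mu" by (metis DiffI diagram_iff not_le)
    then show "j \<in> snd ` (diagram lam - diagram mu)" by force
  qed
  moreover have "I i \<inter> I i' = {}" if "i < i'" for i i'
    using that row_antimono[of i "i' - 1" mu] by (fastforce simp: I)
  then have "\<forall>i\<in>{..n}. \<forall>i'\<in>{..n}. i \<noteq> i' \<longrightarrow> I i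
      \<inter> I i' = {}"
    by (metis Int_commute linorder_neqE_nat)
  then have "card (\<Union>i\<in>{..n}. I i) = (\<Sum>i\<in>{..n}. card (I i))"
    by (intro card_UN_disjoint) (auto simp: I_def split: nat.split)
  ultimately have "columns lam mu = (\<Sum>i<Suc n. card (I i))"
    by (simp add: columns_def lessThan_Suc_atMost)
  then show ?thesis by (simp add: I_def sum.lessThan_Suc_shift del: sum.lessThan_Suc)
qed

text \<open>Each column is counted at its bottommost box instead. Now the term of row
  \<open>i\<close> depends on no other row of \<open>mu\<close>, the form needed when the inner
  partition varies.\<close>

lemma columns_bottom:
  assumes "len lam \<le> n"
  shows "columns lam mu = (\<Sum>i<n. row lam i - max (row mu i) (row lam (Suc i)))"
proof -
  define I where "I = (\<lambda>i. {max (row mu i) (row lam (Suc i))..<row lam i})"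
  have "snd ` (diagram lam - diagram mu) = (\<Union>i\<in>{..<n}. I i)"
  proof (intro equalityI subsetI)
    fix j assume "j \<in> snd ` (diagram lam - diagram mu)"
    then obtain i0 where i0: "row mu i0 \<le> j" "j < row lam i0" by (force simp: diagram_iff)
    define i where "i = (GREATEST i. j < row lam i)"
    have bound: "i \<le> n" if "j < row lam i" for i
      using that row_pos_iff[of lam i] assms by linarith
    have i: "j < row lam i" unfolding i_def using GreatestI_nat[of "\<lambda>i. j < row lam i" i0
        n] i0(2) bound by blast
    have "i0 \<le> i" unfolding i_def using Greatest_le_nat[of "\<lambda>i. j < row lam i" i0 n]
        i0(2) bound by blast
    then have "row mu i \<le> j" using i0(1) row_antimono[of i0 i mu] by linarith
    moreover have "row lam (Suc i) \<le> j"
    proof (rule ccontr)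
      assume "\<not> row lam (Suc i) \<le> j"
      then have "Suc i \<le> i" unfolding i_def[symmetric]
        using Greatest_le_nat[of "\<lambda>i. j < row lam i" "Suc i" n] bound i_def by auto
      then show False by simp
    qed
    ultimately have "j \<in> I i" using i by (simp add: I_def)
    moreover have "i < n" using i row_pos_iff[of lam i] assms by linarith
    ultimately show "j \<in> (\<Union>i\<in>{..<n}. I i)" by auto
  next
    fix j assume "j \<in> (\<Union>i\<in>{..<n}. I i)"
    then have "\<exists>i. row mu i \<le> j \<and> j < row lam i" by (auto simp: I_def)
    then obtain i where "(i, j) \<in> diagram lam - diagram mu" by (metis DiffI diagram_iff not_le)
    then show "j \<in> snd ` (diagram lam - diagram mu)" by force
  qed
  moreover have "I i \<inter> I i' = {}" if "i < i'" for i i'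
    using that row_antimono[of "Suc i" "i'" lam] by (fastforce simp: I_def)
  then have "\<forall>i\<in>{..<n}. \<forall>i'\<in>{..<n}. i \<noteq> i' \<longrightarrow> I i
      \<inter> I i' = {}"
    by (metis Int_commute linorder_neqE_nat)
  then have "card (\<Union>i\<in>{..<n}. I i) = (\<Sum>i\<in>{..<n}. card (I i))"
    by (intro card_UN_disjoint) (auto simp: I_def)
  ultimately show ?thesis by (simp add: columns_def I_def)
qed

text \<open>Every term with the factor \<open>1 - y\<close> is a difference of consecutive powers,
  and the last term has no such factor, so only the first power survives.\<close>

lemma telescope_up:
  fixes y :: "'a::comm_ring_1"
  assumes "p \<le> q" "c \<le> p"
  shows "(\<Sum>v\<in>{p..q}. y ^ (v - c) * (if v < q then 1 - y else 1)) = y ^ (p - c)"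
  using assms
proof (induction q rule: dec_induct)
  case (step q)
  have eq: "{p..Suc q} = insert (Suc q) (insert q {p..<q})" "{p..q} = insert q {p..<q}"
    using step by auto
  have "(\<Sum>v\<in>{p..<q}. y ^ (v - c) * (if v < Suc q then 1 - y else 1))
      = (\<Sum>v\<in>{p..<q}. y ^ (v - c) * (if v < q then 1 - y else 1))"
    by (rule sum.cong) auto
  moreover have "Suc q - c = Suc (q - c)" using step by simp
  ultimately show ?case using step.IH[OF step.prems] unfolding eq by (simp add: algebra_simps)
qed simp

lemma telescope_down:
  fixes y :: "'a::comm_ring_1"
  assumes "p \<le> q" "q \<le> b"
  shows "(\<Sum>k\<in>{p..q}. y ^ (b - k) * (if p < k then 1 - y else 1)) = y ^ (b - q)"
  using assms
proof (induction q rule: dec_induct)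
  case (step q)
  have "b - q = Suc (b - Suc q)" using step.prems by simp
  then show ?case using step by (simp add: algebra_simps)
qed simp

text \<open>The contributions of a single row to the sums over the strips above and below
    \<open>\<lambda>\<close> and \<open>\<mu>\<close>. Here
  \<open>a = \<lambda>\<^sub>i\<close>, \<open>a' = \<lambda>\<^sub>i\<^sub>+\<^sub>1\<close>,
      \<open>b = \<mu>\<^sub>i\<close>, \<open>b' = \<mu>\<^sub>i\<^sub>+\<^sub>1\<close>; the
      summation variable is the length of row \<open>i + 1\<close> of the
  partition above and of row \<open>i\<close> of the partition below.\<close>

definition row_above :: "'a::comm_ring_1 \<Rightarrow> 'a \<Rightarrow> nat \<Rightarrow> nat
    \<Rightarrow> nat \<Rightarrow> nat \<Rightarrow> 'a" where
  "row_above x y a a' b b' = (\<Sum>v\<in>{max a' b'..a}.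
     x ^ (min v b - b') * (y ^ (v - a') * (if v < a then 1 - y else 1)))"

definition row_below :: "'a::comm_ring_1 \<Rightarrow> 'a \<Rightarrow> nat \<Rightarrow> nat
    \<Rightarrow> nat \<Rightarrow> nat \<Rightarrow> 'a" where
  "row_below x y a a' b b' = (\<Sum>k\<in>{b'..min a b}.
     x ^ (a - max k a') * (y ^ (b - k) * (if b' < k then 1 - y else 1)))"

text \<open>The powers needed to extend both rows to the length \<open>max a b\<close>. At row 0
  this is the contribution of the shortest possible first row of a partition above; at later rows it
  is the discrepancy passed on from row to row.\<close>

definition row_factor :: "'a::comm_ring_1 \<Rightarrow> 'a \<Rightarrow> nat \<Rightarrow> nat
    \<Rightarrow> 'a" where
  "row_factor x y a b = x ^ (max a b - b) * y ^ (max a b - a)"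

lemma mult_exchange:
  fixes a b c d e f g h z :: "'a::comm_ring_1"
  assumes "a * b = c * d" "e * f = g * h"
  shows "a * (e * z) * (b * f) = c * (g * z) * (d * h)"
proof -
  have "a * (e * z) * (b * f) = (a * b) * (e * f) * z" by (simp only: mult_ac)
  also have "\<dots> = c * (g * z) * (d * h)" unfolding assms by (simp only: mult_ac)
  finally show ?thesis .
qed

text \<open>In the main case both ranges contain the stretch between \<open>m\<close> and
  \<open>e\<close>. There the terms correspond under the reflection of \<open>v\<close> to
  \<open>m + e - v\<close>; what is left of either sum telescopes to a single monomial.\<close>

lemma row_exchange:
  fixes x y :: "'a::comm_ring_1"
  assumes "a' \<le> a" "b' \<le> b"
  shows "row_above x y a a' b b' * row_factor x y a b
       = row_below x y a a' b b' * row_factor x y a' b'"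
proof -
  define m where "m = max a' b'"
  define e where "e = min a b"
  consider "a < b'" | "b' \<le> a" "m \<le> e" | "b' \<le> a" "e < m" by linarith
  then show ?thesis
  proof cases
    \<comment> \<open>Both ranges of summation are empty.\<close>
    case 1
    then show ?thesis by (simp add: row_above_def row_below_def)
  next
    case 2
    note le = assms 2 m_def e_def
    have me: "m \<le> a" "m \<le> b" "a' \<le> m" "b' \<le> m" "e \<le> a" "e \<le> b" using le by auto
    have "row_above x y a a' b b' =
        (\<Sum>v\<in>{m..<e}. x ^ (min v b - b') * (y ^ (v - a') * (if v < a then 1 - y else 1))) +
        (\<Sum>v\<in>{e..a}. x ^ (min v b - b') * (y ^ (v - a') * (if v < a then 1 - y else 1)))"
    proof -
      have "{max a' b'..a} = {m..<e} \<union> {e..a}" using me 2 by (auto simp: m_def)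
      then show ?thesis unfolding row_above_def
        by (simp only:) (rule sum.union_disjoint, auto)
    qed
    also have "(\<Sum>v\<in>{m..<e}. x ^ (min v b - b') * (y ^ (v - a') * (if v < a then 1 - y else 1)))
        = (\<Sum>v\<in>{m..<e}. x ^ (v - b') * (y ^ (v - a') * (1 - y)))"
      by (rule sum.cong) (use me in auto)
    also have "(\<Sum>v\<in>{e..a}. x ^ (min v b - b') * (y ^ (v - a') * (if v < a then 1 - y else 1)))
        = (\<Sum>v\<in>{e..a}. x ^ (e - b') * (y ^ (v - a') * (if v < a then 1 - y else 1)))"
    proof (rule sum.cong[OF refl])
      fix v assume "v \<in> {e..a}"
      then have "min v b = e" by (auto simp: e_def)
      then show "x ^ (min v b - b') * (y ^ (v - a') * (if v < a then 1 - y else 1))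
          = x ^ (e - b') * (y ^ (v - a') * (if v < a then 1 - y else 1))" by simp
    qed
    also have "\<dots> = x ^ (e - b') * y ^ (e - a')"
      unfolding sum_distrib_left[symmetric]
      by (subst telescope_up) (use me 2 in auto)
    finally have above: "row_above x y a a' b b' =
      (\<Sum>v\<in>{m..<e}. x ^ (v - b') * (y ^ (v - a') * (1 - y))) + x ^ (e - b') * y ^ (e - a')" .
    have "row_below x y a a' b b' =
        (\<Sum>k\<in>{b'..m}. x ^ (a - max k a') * (y ^ (b - k) * (if b' < k then 1 - y else 1))) +
        (\<Sum>k\<in>{m<..e}. x ^ (a - max k a') * (y ^ (b - k) * (if b' < k then 1 - y else 1)))"
    proof -
      have "{b'..min a b} = {b'..m} \<union> {m<..e}" using me 2 by (auto simp: e_def)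
      then show ?thesis unfolding row_below_def
        by (simp only:) (rule sum.union_disjoint, auto)
    qed
    also have "(\<Sum>k\<in>{m<..e}. x ^ (a - max k a') * (y ^ (b - k) * (if b' < k then 1 - y else 1)))
        = (\<Sum>k\<in>{m<..e}. x ^ (a - k) * (y ^ (b - k) * (1 - y)))"
    proof (rule sum.cong[OF refl])
      fix k assume "k \<in> {m<..e}"
      then have "max k a' = k" "b' < k" using me by auto
      then show "x ^ (a - max k a') * (y ^ (b - k) * (if b' < k then 1 - y else 1))
        = x ^ (a - k) * (y ^ (b - k) * (1 - y))" by simp
    qed
    also have "(\<Sum>k\<in>{b'..m}. x ^ (a - max k a') * (y ^ (b - k) * (if b' < k then 1 - y else 1)))
        = (\<Sum>k\<in>{b'..m}. x ^ (a - m) * (y ^ (b - k) * (if b' < k then 1 - y else 1)))"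
    proof (rule sum.cong[OF refl])
      fix k assume "k \<in> {b'..m}"
      then have "max k a' = m" by (auto simp: m_def)
      then show "x ^ (a - max k a') * (y ^ (b - k) * (if b' < k then 1 - y else 1))
        = x ^ (a - m) * (y ^ (b - k) * (if b' < k then 1 - y else 1))" by simp
    qed
    also have "\<dots> = x ^ (a - m) * y ^ (b - m)"
      unfolding sum_distrib_left[symmetric]
      by (subst telescope_down) (use me 2 in auto)
    finally have below: "row_below x y a a' b b' =
      x ^ (a - m) * y ^ (b - m) + (\<Sum>k\<in>{m<..e}. x ^ (a - k) * (y ^ (b - k) * (1 - y)))" .
    have fac: "row_factor x y a b = x ^ (a - e) * y ^ (b - e)"
      "row_factor x y a' b' = x ^ (m - b') * y ^ (m - a')"
      by (auto simp: row_factor_def e_def m_def max_def min_def)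
    have "(\<Sum>v\<in>{m..<e}. x ^ (v - b') * (y ^ (v - a') * (1 - y)) * (x ^ (a - e) * y ^ (b - e)))
        = (\<Sum>k\<in>{m<..e}. x ^ (a - k) * (y ^ (b - k) * (1 - y)) * (x ^ (m - b') * y ^ (m - a')))"
    proof (rule sum.reindex_bij_witness[of _ "\<lambda>k. m + e - k" "\<lambda>v. m + e - v"])
      fix v assume v: "v \<in> {m..<e}"
      have "x ^ (a - (m + e - v)) * x ^ (m - b') = x ^ (v - b') * x ^ (a - e)"
        "y ^ (b - (m + e - v)) * y ^ (m - a') = y ^ (v - a') * y ^ (b - e)"
        unfolding power_add[symmetric] using v me by (auto intro!: arg_cong[where f = "power _"])
      then show "x ^ (a - (m + e - v)) * (y ^ (b - (m + e - v)) * (1 - y)) * (x ^ (m - b') * y ^ (m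
          - a'))
          = x ^ (v - b') * (y ^ (v - a') * (1 - y)) * (x ^ (a - e) * y ^ (b - e))"
        by (rule mult_exchange)
    qed auto
    moreover have "x ^ (e - b') * y ^ (e - a') * (x ^ (a - e) * y ^ (b - e))
        = x ^ (a - m) * y ^ (b - m) * (x ^ (m - b') * y ^ (m - a'))"
    proof -
      have "x ^ (e - b') * x ^ (a - e) = x ^ (a - m) * x ^ (m - b')"
        "y ^ (e - a') * y ^ (b - e) = y ^ (b - m) * y ^ (m - a')"
        unfolding power_add[symmetric] using me 2 by (auto intro!: arg_cong[where f = "power _"])
      then show ?thesis using mult_exchange[of "x ^ (e - b')" "x ^ (a - e)" "x ^ (a - m)" "x ^ (m - b')"
          "y ^ (e - a')" "y ^ (b - e)" "y ^ (b - m)" "y ^ (m - a')" 1] by (simp only: mult_1_right)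
    qed
    ultimately show ?thesis
      unfolding above below fac distrib_right sum_distrib_right by (simp only: add.commute)
  next
    \<comment> \<open>Here \<open>b < a'\<close>, so the exponent of \<open>x\<close> is constant in
      both sums and each telescopes as a whole.\<close>
    case 3
    then have *: "m = a'" "e = b" "b < a'" using assms by (auto simp: m_def e_def)
    have "row_above x y a a' b b' = (\<Sum>v\<in>{a'..a}. x ^ (b - b') * (y ^ (v - a') * (if v < a
        then 1 - y else 1)))"
      unfolding row_above_def by (rule sum.cong) (use * m_def in auto)
    also have "\<dots> = x ^ (b - b')"
      unfolding sum_distrib_left[symmetric] by (subst telescope_up) (use assms in auto)
    finally have above: "row_above x y a a' b b' = x ^ (b - b')" .
    have "row_below x y a a' b b' = (\<Sum>k\<in>{b'..b}. x ^ (a - a') * (y ^ (b - k) * (if b' < k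
        then 1 - y else 1)))"
      unfolding row_below_def by (rule sum.cong) (use * e_def in auto)
    also have "\<dots> = x ^ (a - a')"
      unfolding sum_distrib_left[symmetric] by (subst telescope_down) (use assms in auto)
    finally have below: "row_below x y a a' b b' = x ^ (a - a')" .
    have "row_factor x y a b = x ^ (a - b)" "row_factor x y a' b' = x ^ (a' - b')"
      using * assms by (auto simp: row_factor_def)
    moreover have "b - b' + (a - b) = a - a' + (a' - b')" using * assms by auto
    ultimately show ?thesis unfolding above below by (simp add: power_add[symmetric])
  qed
qed

text \<open>\<open>row_exchange\<close> trades the factor of row \<open>i\<close> for that of row
  \<open>i + 1\<close>, so only the factors of row 0 and row \<open>n\<close> remain.\<close>

lemma row_exchange_prod:
  fixes x y :: "'a::comm_ring_1"
  shows "row_factor x y (row lam 0) (row mu 0) *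
      (\<Prod>i<n. row_above x y (row lam i) (row lam (Suc i)) (row mu i) (row mu (Suc i))) =
      (\<Prod>i<n. row_below x y (row lam i) (row lam (Suc i)) (row mu i) (row mu (Suc i))) *
      row_factor x y (row lam n) (row mu n)"
proof (induction n)
  case (Suc n)
  have "row_above x y (row lam n) (row lam (Suc n)) (row mu n) (row mu (Suc n)) *
      row_factor x y (row lam n) (row mu n) =
      row_below x y (row lam n) (row lam (Suc n)) (row mu n) (row mu (Suc n)) *
      row_factor x y (row lam (Suc n)) (row mu (Suc n))"
    by (rule row_exchange) (auto intro: row_antimono)
  note exchange = this
  let ?A = "\<lambda>i. row_above x y (row lam i) (row lam (Suc i)) (row mu i) (row mu (Suc i))"
  let ?B = "\<lambda>i. row_below x y (row lam i) (row lam (Suc i)) (row mu i) (row mu (Suc i))"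
  let ?f = "\<lambda>i. row_factor x y (row lam i) (row mu i)"
  have "?f 0 * (\<Prod>i<Suc n. ?A i) = (?f 0 * (\<Prod>i<n. ?A i)) * ?A n"
    by (simp add: mult.assoc)
  also have "\<dots> = (\<Prod>i<n. ?B i) * (?A n * ?f n)"
    unfolding Suc.IH by (simp only: mult_ac)
  also have "\<dots> = (\<Prod>i<Suc n. ?B i) * ?f (Suc n)"
    unfolding exchange by (simp add: mult.assoc)
  finally show ?case .
qed simp

text \<open>The weight of one variable in \<open>groth\<close>: each box of the strip holds the new
  entry, and each free corner either holds it as an extra element, with a sign, or does not.\<close>

definition strip_weight :: "'a::comm_ring_1 \<Rightarrow> partition \<Rightarrow> partition
    \<Rightarrow> 'a" where
  "strip_weight y lam mu = y ^ (psize lam - psize mu) * (1 - y) ^ card (free_corners lam mu)"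

text \<open>Two factorizations are needed, as for the columns: here the factor with index
  \<open>i\<close> involves only row \<open>i + 1\<close> of the outer partition, in
  \<open>strip_weight_prod'\<close> only row \<open>i\<close> of the inner one.\<close>

lemma strip_weight_prod:
  assumes "horizontal_strip lam mu" "len lam \<le> Suc n" "len mu \<le> n"
  shows "strip_weight y lam mu = y ^ (row lam 0 - row mu 0) *
    (\<Prod>i<n. y ^ (row lam (Suc i) - row mu (Suc i)) * (if row lam (Suc i) < row mu i then 1 - y
        else 1))"
proof -
  have "psize lam - psize mu = (\<Sum>i<Suc n. row lam i - row mu i)"
    using assms by (subst sum_subtractf_nat) (auto simp: psize_eq_sum[of _ "Suc n"] horizontal_strip_iff)
  also have "\<dots> = (row lam 0 - row mu 0) + (\<Sum>i<n. row lam (Suc i) - row mu (Suc i))"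
    by (rule sum.lessThan_Suc_shift)
  finally have "psize lam - psize mu =
    (row lam 0 - row mu 0) + (\<Sum>i<n. row lam (Suc i) - row mu (Suc i))" .
  moreover have "(1 - y) ^ card (free_corners lam mu) =
      (\<Prod>i<n. if row lam (Suc i) < row mu i then 1 - y else 1)"
    unfolding card_free_corners[OF assms(3)] power_sum by (rule prod.cong) auto
  ultimately show ?thesis
    by (simp add: strip_weight_def power_add power_sum prod.distrib)
qed

lemma strip_weight_prod':
  assumes "horizontal_strip lam mu" "len lam \<le> n"
  shows "strip_weight y lam mu =
    (\<Prod>i<n. y ^ (row lam i - row mu i) * (if row lam (Suc i) < row mu i then 1 - y else 1))"
proof -
  have mu: "len mu \<le> n" using assms len_mono[of mu lam] by (auto simp: horizontal_strip_def)
  have "psize lam - psize mu = (\<Sum>i<n. row lam i - row mu i)"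
    using assms mu by (subst sum_subtractf_nat) (auto simp: psize_eq_sum[of _ n] horizontal_strip_iff)
  moreover have "(1 - y) ^ card (free_corners lam mu) =
      (\<Prod>i<n. if row lam (Suc i) < row mu i then 1 - y else 1)"
    unfolding card_free_corners[OF mu] power_sum by (rule prod.cong) auto
  ultimately show ?thesis
    by (simp add: strip_weight_def power_sum prod.distrib)
qed

text \<open>The length of the first row is prescribed because no condition bounds it from
  above.\<close>

definition strips_above :: "partition \<Rightarrow> partition \<Rightarrow> nat \<Rightarrow>
    partition set" where
  "strips_above lam mu v =
     {nu. horizontal_strip nu lam \<and> diagram mu \<subseteq> diagram nu \<and> row nu 0 = v}"

definition strips_below :: "partition \<Rightarrow> partition \<Rightarrow> partition set" where
  "strips_below lam mu = {ka. horizontal_strip mu ka \<and> diagram ka \<subseteq> diagram lam}"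

text \<open>The conditions confine row \<open>i + 1\<close> of \<open>nu\<close> to an interval that
  does not depend on the other rows of \<open>nu\<close>, and interlacing with \<open>lam\<close>
  makes every choice weakly decreasing. A sum over a product of intervals of a product of one-row
  weights factors.\<close>

lemma sum_strips_above:
  fixes x y :: "'a::comm_ring_1"
  assumes n: "len lam \<le> n" "len mu \<le> n" and v: "max (row lam 0) (row mu 0) \<le> v"
  shows "(\<Sum>nu\<in>strips_above lam mu v. x ^ columns nu mu * strip_weight y nu lam) =
    x ^ (v - row mu 0) * y ^ (v - row lam 0) *
    (\<Prod>i<n. row_above x y (row lam i) (row lam (Suc i)) (row mu i) (row mu (Suc i)))"
proof -
  define w where "w = (\<lambda>i u. x ^ (min u (row mu i) - row mu (Suc i)) *
    (y ^ (u - row lam (Suc i)) * (if u < row lam i then 1 - y else 1)))"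
  define B where "B = (\<lambda>i. {max (row lam (Suc i)) (row mu (Suc i))..row lam i})"
  define P where "P = (\<lambda>g i. case i of 0 \<Rightarrow> v | Suc j \<Rightarrow> if j < n
      then g j else (0::nat))"
  have P_row: "row (of_rows (P g)) = P g" if g: "g \<in> PiE {..<n} B" for g
  proof (rule row_of_rows[of _ "Suc n"])
    fix i
    have mem: "j < n \<Longrightarrow> max (row lam (Suc j)) (row mu (Suc j)) \<le> g j \<and> g j
        \<le> row lam j" for j
      using PiE_mem[OF g, of j] by (simp add: B_def)
    show "P g (Suc i) \<le> P g i"
    proof (cases i)
      case 0
      then show ?thesis using mem[of 0] v by (auto simp: P_def)
    next
      case (Suc j)
      then show ?thesis using mem[of i] mem[of j] by (auto simp: P_def)
    qed
  next
    fix i assume "Suc n \<le> i"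
    then show "P g i = 0" by (auto simp: P_def split: nat.split)
  qed
  have above: "of_rows (P g) \<in> strips_above lam mu v" if g: "g \<in> PiE {..<n} B" for g
  proof -
    have mem: "j < n \<Longrightarrow> max (row lam (Suc j)) (row mu (Suc j)) \<le> g j \<and> g j
        \<le> row lam j" for j
      using PiE_mem[OF g, of j] by (simp add: B_def)
    have "row lam i \<le> P g i \<and> P g (Suc i) \<le> row lam i \<and> row mu i \<le> P g i" for i
    proof (cases i)
      case 0
      then show ?thesis using mem[of 0] v by (auto simp: P_def)
    next
      case (Suc j)
      have "row lam i = 0" "row mu i = 0" if "\<not> j < n" using that n Suc by (auto simp: row_eq_0_iff)
      then show ?thesis using mem[of i] mem[of j] Suc by (auto simp: P_def)
    qed
    moreover have "P g 0 = v" by (simp add: P_def)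
    ultimately show ?thesis
      by (simp add: strips_above_def horizontal_strip_iff diagram_subset_iff P_row[OF g])
  qed
  have zero: "row nu (Suc i) = 0" if "nu \<in> strips_above lam mu v" "n \<le> i" for nu i
    using that n row_eq_0_iff[of lam i]
    by (auto simp: strips_above_def horizontal_strip_iff) (metis le_zero_eq order_trans)
  have "(\<Sum>nu\<in>strips_above lam mu v. x ^ columns nu mu * strip_weight y nu lam) =
    (\<Sum>g\<in>PiE {..<n} B. x ^ (v - row mu 0) * y ^ (v - row lam 0) * (\<Prod>i<n. w i (g i)))"
  proof (rule sum.reindex_bij_witness[of _ "\<lambda>g. of_rows (P g)" "\<lambda>nu. restrict
      (\<lambda>i. row nu (Suc i)) {..<n}"])
    fix nu assume nu: "nu \<in> strips_above lam mu v"
    have g: "restrict (\<lambda>i. row nu (Suc i)) {..<n} \<in> PiE {..<n} B"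
      using nu by (auto simp: B_def strips_above_def horizontal_strip_iff diagram_subset_iff)
    then show "restrict (\<lambda>i. row nu (Suc i)) {..<n} \<in> PiE {..<n} B" .
    have "row (of_rows (P (restrict (\<lambda>i. row nu (Suc i)) {..<n}))) i = row nu i" for i
      unfolding P_row[OF g]
      using nu zero[OF nu] by (auto simp: P_def strips_above_def split: nat.split)
    then show "of_rows (P (restrict (\<lambda>i. row nu (Suc i)) {..<n})) = nu" by (rule partition_eqI)
    have nu': "horizontal_strip nu lam" "row nu 0 = v" using nu by (auto simp: strips_above_def)
    have "len nu \<le> Suc n" using zero[OF nu, of n] by (simp add: row_eq_0_iff)
    then show "x ^ (v - row mu 0) * y ^ (v - row lam 0) *
        (\<Prod>i<n. w i (restrict (\<lambda>i. row nu (Suc i)) {..<n} i)) =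
        x ^ columns nu mu * strip_weight y nu lam"
      using nu' n
      by (simp add: columns_top strip_weight_prod w_def power_add power_sum prod.distrib mult_ac)
  next
    fix g assume g: "g \<in> PiE {..<n} B"
    then show "of_rows (P g) \<in> strips_above lam mu v" by (rule above)
    show "restrict (\<lambda>i. row (of_rows (P g)) (Suc i)) {..<n} = g"
      unfolding P_row[OF g] using g by (auto simp: P_def fun_eq_iff PiE_def extensional_def)
  qed
  also have "\<dots> = x ^ (v - row mu 0) * y ^ (v - row lam 0) * (\<Prod>i<n. \<Sum>u\<in>B i. w i u)"
    by (subst prod_sum_PiE) (auto simp: B_def sum_distrib_left)
  finally show ?thesis by (simp add: row_above_def w_def B_def)
qed

text \<open>Interlacing with \<open>mu\<close> again makes the rows independent. No row has to be
  set apart, since all rows of \<open>ka\<close> are bounded by those of \<open>mu\<close>.\<close>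

lemma sum_strips_below:
  fixes x y :: "'a::comm_ring_1"
  assumes n: "len lam \<le> n" "len mu \<le> n"
  shows "(\<Sum>ka\<in>strips_below lam mu. x ^ columns lam ka * strip_weight y mu ka) =
    (\<Prod>i<n. row_below x y (row lam i) (row lam (Suc i)) (row mu i) (row mu (Suc i)))"
proof -
  define w where "w = (\<lambda>i k. x ^ (row lam i - max k (row lam (Suc i))) *
    (y ^ (row mu i - k) * (if row mu (Suc i) < k then 1 - y else 1)))"
  define B where "B = (\<lambda>i. {row mu (Suc i)..min (row lam i) (row mu i)})"
  define P where "P = (\<lambda>g i. if i < n then g i else (0::nat))"
  have P_row: "row (of_rows (P g)) = P g" if g: "g \<in> PiE {..<n} B" for g
  proof (rule row_of_rows[of _ n])
    fix i
    have mem: "j < n \<Longrightarrow> row mu (Suc j) \<le> g j \<and> g j \<le> row mu j" for j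
      using PiE_mem[OF g, of j] by (simp add: B_def)
    show "P g (Suc i) \<le> P g i"
      using mem[of i] mem[of "Suc i"] by (auto simp: P_def)
  qed (simp add: P_def)
  have below: "of_rows (P g) \<in> strips_below lam mu" if g: "g \<in> PiE {..<n} B" for g
  proof -
    have mem: "j < n \<Longrightarrow> row mu (Suc j) \<le> g j \<and> g j \<le> row lam j \<and> g
        j \<le> row mu j" for j
      using PiE_mem[OF g, of j] by (simp add: B_def)
    have "P g i \<le> row mu i \<and> row mu (Suc i) \<le> P g i \<and> P g i \<le> row lam i" for i
    proof (cases "i < n")
      case True
      then show ?thesis using mem[of i] by (simp add: P_def)
    next
      case False
      then have "row mu (Suc i) = 0" using n by (simp add: row_eq_0_iff)
      then show ?thesis using False by (simp add: P_def)
    qed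
    then show ?thesis
      by (simp add: strips_below_def horizontal_strip_iff diagram_subset_iff P_row[OF g])
  qed
  have zero: "row ka i = 0" if "ka \<in> strips_below lam mu" "n \<le> i" for ka i
    using that n row_eq_0_iff[of mu i]
    by (auto simp: strips_below_def horizontal_strip_iff) (metis le_zero_eq order_trans)
  have "(\<Sum>ka\<in>strips_below lam mu. x ^ columns lam ka * strip_weight y mu ka) =
    (\<Sum>g\<in>PiE {..<n} B. \<Prod>i<n. w i (g i))"
  proof (rule sum.reindex_bij_witness[of _ "\<lambda>g. of_rows (P g)" "\<lambda>ka. restrict (row
      ka) {..<n}"])
    fix ka assume ka: "ka \<in> strips_below lam mu"
    have g: "restrict (row ka) {..<n} \<in> PiE {..<n} B"
      using ka by (auto simp: B_def strips_below_def horizontal_strip_iff diagram_subset_iff)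
    then show "restrict (row ka) {..<n} \<in> PiE {..<n} B" .
    have "row (of_rows (P (restrict (row ka) {..<n}))) i = row ka i" for i
      unfolding P_row[OF g] using zero[OF ka] by (auto simp: P_def)
    then show "of_rows (P (restrict (row ka) {..<n})) = ka" by (rule partition_eqI)
    have ka': "horizontal_strip mu ka" using ka by (auto simp: strips_below_def)
    then show "(\<Prod>i<n. w i (restrict (row ka) {..<n} i)) = x ^ columns lam ka * strip_weight y
        mu ka"
      using n by (simp add: columns_bottom strip_weight_prod' w_def power_sum prod.distrib mult_ac)
  next
    fix g assume g: "g \<in> PiE {..<n} B"
    then show "of_rows (P g) \<in> strips_below lam mu" by (rule below)
    show "restrict (row (of_rows (P g))) {..<n} = g"
      unfolding P_row[OF g] using g by (auto simp: P_def fun_eq_iff PiE_def extensional_def)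
  qed
  also have "\<dots> = (\<Prod>i<n. \<Sum>u\<in>B i. w i u)"
    by (subst prod_sum_PiE) (auto simp: B_def)
  finally show ?thesis by (simp add: row_below_def w_def B_def)
qed

text \<open>The \<open>t\<close> boxes beyond the longer first row contribute
  \<open>(x * y) ^ t\<close>. Summed over \<open>t\<close> this is the geometric series for 1 / (1 -
  x y).\<close>

lemma strips_commute:
  fixes x y :: "'a::comm_ring_1"
  assumes v: "v = max (row lam 0) (row mu 0) + t"
  shows "(\<Sum>nu\<in>strips_above lam mu v. x ^ columns nu mu * strip_weight y nu lam) =
    (x * y) ^ t * (\<Sum>ka\<in>strips_below lam mu. x ^ columns lam ka * strip_weight y mu ka)"
proof -
  define n where "n = max (len lam) (len mu)"
  have n: "len lam \<le> n" "len mu \<le> n" by (auto simp: n_def)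
  have f: "x ^ (v - row mu 0) * y ^ (v - row lam 0) = (x * y) ^ t * row_factor x y (row lam 0) (row
      mu 0)"
  proof -
    have "v - row mu 0 = t + (max (row lam 0) (row mu 0) - row mu 0)"
      "v - row lam 0 = t + (max (row lam 0) (row mu 0) - row lam 0)" using v by auto
    then show ?thesis by (simp only: row_factor_def power_add power_mult_distrib mult_ac)
  qed
  have "row lam n = 0" "row mu n = 0" using n by (auto simp: row_eq_0_iff)
  then have "row_factor x y (row lam n) (row mu n) = 1" by (simp add: row_factor_def)
  note 1 = this
  have "(\<Sum>nu\<in>strips_above lam mu v. x ^ columns nu mu * strip_weight y nu lam) =
      x ^ (v - row mu 0) * y ^ (v - row lam 0) *
      (\<Prod>i<n. row_above x y (row lam i) (row lam (Suc i)) (row mu i) (row mu (Suc i)))"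
    by (rule sum_strips_above[OF n]) (use v in simp)
  also have "\<dots> = (x * y) ^ t * (\<Prod>i<n. row_below x y (row lam i) (row lam (Suc i)) (row
      mu i) (row mu (Suc i)))"
    using row_exchange_prod[of x y lam mu n] 1 by (simp add: f mult.assoc)
  finally show ?thesis by (simp only: sum_strips_below[OF n])
qed

text \<open>The coefficient of \<open>y ^ l\<close> in \<open>strip_weight\<close>, extended by 0 so
  that sums may run over more than the horizontal strips.\<close>

definition groth_coeff :: "nat \<Rightarrow> partition \<Rightarrow> partition \<Rightarrow> int" where
  "groth_coeff l lam mu =
     (if horizontal_strip lam mu \<and> psize lam - psize mu \<le> l
      then (- 1) ^ (l - (psize lam - psize mu)) *
        int (card (free_corners lam mu) choose (l - (psize lam - psize mu)))
      else 0)"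

lemma coeff_strip_weight:
  assumes "horizontal_strip lam mu"
  shows "coeff (strip_weight [:0, 1:] lam mu) l = groth_coeff l lam mu"
proof -
  let ?r = "card (free_corners lam mu)"
  have *: "coeff ((1 - [:0, 1:]) ^ ?r) i = (- 1) ^ i * int (?r choose i)" for i
  proof -
    have "1 - [:0, 1:] = [:1, - 1 :: int:]" by (simp add: one_pCons)
    then show ?thesis
      by (cases "i \<le> ?r")
        (auto simp: coeff_linear_poly_power coeff_eq_0 degree_linear_power binomial_eq_0)
  qed
  have "[:0, 1 :: int:] ^ n = monom 1 n" for n by (simp add: monom_altdef)
  then show ?thesis
    using assms by (simp add: strip_weight_def coeff_monom_mult * groth_coeff_def not_le)
qed

lemma finite_strips_above [simp]: "finite (strips_above lam mu v)"
proof (rule finite_subset[OF _ finite_psize_le])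
  show "strips_above lam mu v \<subseteq> {nu. psize nu \<le> v + psize lam}"
  proof
    fix nu assume nu: "nu \<in> strips_above lam mu v"
    define n where "n = max (len nu) (len lam)"
    have "psize nu = (\<Sum>i<Suc n. row nu i)" by (rule psize_eq_sum) (simp add: n_def)
    also have "\<dots> = v + (\<Sum>i<n. row nu (Suc i))"
      using nu by (simp add: sum.lessThan_Suc_shift strips_above_def del: sum.lessThan_Suc)
    also have "(\<Sum>i<n. row nu (Suc i)) \<le> (\<Sum>i<n. row lam i)"
      by (rule sum_mono) (use nu in \<open>simp add: strips_above_def horizontal_strip_iff\<close>)
    also have "\<dots> = psize lam" by (rule psize_eq_sum[symmetric]) (simp add: n_def)
    finally show "nu \<in> {nu. psize nu \<le> v + psize lam}" by simp
  qed
qed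

lemma strips_commute_coeff:
  assumes "v = max (row lam 0) (row mu 0) + t"
  shows "(\<Sum>nu\<in>strips_above lam mu v. if columns nu mu = k then groth_coeff l nu lam else 0) =
    (if t \<le> k \<and> t \<le> l
     then (\<Sum>ka\<in>strips_below lam mu. if columns lam ka = k - t then groth_coeff (l - t) mu
         ka else 0)
     else 0)"
proof -
  \<comment> \<open>With \<open>x\<close> as outer and \<open>y\<close> as inner variable, the
    coefficient of \<open>x ^ k * y ^ l\<close> is \<open>coeff (coeff p k) l\<close>.\<close>
  define x :: "int poly poly" where "x = monom 1 1"
  define y :: "int poly poly" where "y = [:[:0, 1:]:]"
  have const_power: "[:q:] ^ n = [:q ^ n:]" for q :: "int poly" and n
    by (induction n) (auto simp: one_pCons mult.commute)
  have w: "strip_weight y lam mu = [:strip_weight [:0, 1:] lam mu:]" for lam mu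
    by (simp add: strip_weight_def y_def const_power one_pCons)
  have x_power: "x ^ n = monom 1 n" for n by (simp add: x_def monom_power)
  have mon: "x ^ a * [:q:] = monom q a" for q :: "int poly" and a
    by (simp add: x_power mult.commute[of "monom _ _"] smult_monom)
  have Y: "[:0, 1 :: int:] ^ n = monom 1 n" for n by (simp add: monom_altdef)
  have xy: "(x * y) ^ t = monom (monom 1 t) t"
    unfolding power_mult_distrib y_def const_power mon Y ..
  have "coeff (coeff (\<Sum>nu\<in>strips_above lam mu v. x ^ columns nu mu * strip_weight y nu
      lam) k) l =
    (\<Sum>nu\<in>strips_above lam mu v. if columns nu mu = k then groth_coeff l nu lam else 0)"
    unfolding w mon coeff_sum
    by (rule sum.cong) (auto simp: strips_above_def coeff_strip_weight)
  moreover have "coeff (coeff (\<Sum>ka\<in>strips_below lam mu. x ^ columns lam ka * strip_weight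
      y mu ka) k) l =
    (\<Sum>ka\<in>strips_below lam mu. if columns lam ka = k then groth_coeff l mu ka else 0)" for k l
    unfolding w mon coeff_sum
    by (rule sum.cong) (auto simp: strips_below_def coeff_strip_weight)
  ultimately show ?thesis
    using arg_cong[OF strips_commute[OF assms, of x y], of "\<lambda>p. coeff (coeff p k) l"]
    unfolding xy by (cases "t \<le> k"; cases "t \<le> l") (simp_all add: coeff_monom_mult not_le)
qed

lemma groth_coeff_nonzeroD:
  assumes "groth_coeff l lam mu \<noteq> 0"
  shows "horizontal_strip lam mu" "diagram mu \<subseteq> diagram lam" "psize mu \<le> psize lam"
    "psize lam \<le> psize mu + l"
  using assms psize_mono[of mu lam] by (auto simp: groth_coeff_def horizontal_strip_def split: if_splits)

text \<open>The commutation relation with all first rows summed. The partitions above are grouped by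
  the excess of their first row over \<open>M\<close>; this excess becomes the index
  \<open>j\<close>, the power of x y taken from 1 / (1 - x y).\<close>

lemma groth_coeff_commute:
  assumes F: "finite F" "{nu. psize nu \<le> psize lam + l} \<subseteq> F"
  shows "(\<Sum>nu\<in>F. if diagram mu \<subseteq> diagram nu \<and> columns nu mu = k then
      groth_coeff l nu lam else 0) =
    (\<Sum>j\<le>min k l. \<Sum>ka | diagram ka \<subseteq> diagram lam.
      if columns lam ka = k - j then groth_coeff (l - j) mu ka else 0)"
proof -
  define M where "M = max (row lam 0) (row mu 0)"
  \<comment> \<open>Large enough to bound every excess that occurs and to contain the final range up
    to \<open>min k l\<close>.\<close>
  define T where "T = psize lam + l + min k l"
  define h where "h = (\<lambda>nu. if columns nu mu = k then groth_coeff l nu lam else 0)"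
  define F' where "F' = {nu. h nu \<noteq> 0 \<and> diagram mu \<subseteq> diagram nu}"
  have F': "horizontal_strip nu lam" "psize nu \<le> psize lam + l" "diagram mu \<subseteq> diagram nu"
    "row nu 0 = M + (row nu 0 - M)" "row nu 0 - M \<le> T" if "nu \<in> F'" for nu
  proof -
    show *: "horizontal_strip nu lam" "psize nu \<le> psize lam + l" "diagram mu \<subseteq> diagram nu"
      using that groth_coeff_nonzeroD[of l nu lam] by (auto simp: F'_def h_def split: if_splits)
    then show "row nu 0 = M + (row nu 0 - M)"
      by (auto simp: M_def horizontal_strip_iff diagram_subset_iff)
    show "row nu 0 - M \<le> T" using * row_le_psize[of nu 0] by (simp add: T_def)
  qed
  have F'_fin: "finite F'" by (rule finite_subset[OF _ finite_psize_le[of "psize lam + l"]]) (use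
      F'(2) in auto)
  have "(\<Sum>nu\<in>F. if diagram mu \<subseteq> diagram nu \<and> columns nu mu = k then
      groth_coeff l nu lam else 0)
      = (\<Sum>nu\<in>F'. h nu)"
    by (rule sum.mono_neutral_cong_right) (use F F'(2) in \<open>auto simp: F'_def h_def\<close>)
  also have "\<dots> = (\<Sum>t\<le>T. \<Sum>nu\<in>{nu \<in> F'. row nu 0 - M = t}. h nu)"
    by (rule sum.group[symmetric]) (use F'_fin F'(5) in auto)
  also have "\<dots> = (\<Sum>t\<le>T. \<Sum>nu\<in>strips_above lam mu (M + t). h nu)"
  proof (rule sum.cong[OF refl], rule sum.mono_neutral_left)
    fix t
    show "{nu \<in> F'. row nu 0 - M = t} \<subseteq> strips_above lam mu (M + t)"
    proof
      fix nu assume "nu \<in> {nu \<in> F'. row nu 0 - M = t}"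
      then show "nu \<in> strips_above lam mu (M + t)"
        using F'(1,3)[of nu] F'(4)[of nu] unfolding strips_above_def by force
    qed
    show "\<forall>nu\<in>strips_above lam mu (M + t) - {nu \<in> F'. row nu 0 - M = t}. h nu = 0"
      by (auto simp: strips_above_def F'_def)
  qed simp
  also have "\<dots> = (\<Sum>t\<le>T. if t \<le> k \<and> t \<le> l
     then (\<Sum>ka\<in>strips_below lam mu. if columns lam ka = k - t then groth_coeff (l - t) mu
         ka else 0)
     else 0)"
    unfolding h_def by (rule sum.cong[OF refl], rule strips_commute_coeff) (simp add: M_def)
  also have "\<dots> = (\<Sum>t\<le>min k l.
      \<Sum>ka\<in>strips_below lam mu. if columns lam ka = k - t then groth_coeff (l - t) mu ka else 0)"
    by (rule sum.mono_neutral_cong_right) (auto simp: T_def)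
  also have "\<dots> = (\<Sum>j\<le>min k l. \<Sum>ka | diagram ka \<subseteq> diagram lam.
      if columns lam ka = k - j then groth_coeff (l - j) mu ka else 0)"
    by (rule sum.cong[OF refl], rule sum.mono_neutral_left)
      (auto simp: strips_below_def dest: groth_coeff_nonzeroD)
  finally show ?thesis .
qed

section \<open>Removing the largest entry of a tableau\<close>

text \<open>Induction on the number of variables: all copies of the largest variable are removed at
  once, in step with the removal of the largest entry from a tableau.\<close>

lemma mset_max_induct [case_names empty add]:
  fixes m :: "nat multiset"
  assumes "P {#}"
    and "\<And>m N l. (\<And>x. x \<in># m \<Longrightarrow> x < N) \<Longrightarrow> P m
        \<Longrightarrow> P (m + replicate_mset l N)"
  shows "P m"
proof (induction "size m" arbitrary: m rule: less_induct)
  case less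
  show ?case
  proof (cases "m = {#}")
    case False
    define N where "N = Max_mset m"
    have N: "N \<in># m" "\<And>x. x \<in># m \<Longrightarrow> x \<le> N" using False by (auto
        simp: N_def)
    have eq: "filter_mset (\<lambda>x. x < N) m + replicate_mset (count m N) N = m"
    proof (rule multiset_eqI)
      fix x
      have "count m x = 0" if "N < x" using that N(2)[of x] by (meson count_inI not_le)
      then show "count (filter_mset (\<lambda>x. x < N) m + replicate_mset (count m N) N) x = count m x"
        by (cases x N rule: linorder_cases) auto
    qed
    have "size (filter_mset (\<lambda>x. x < N) m) < size m"
      using N(1) by (intro mset_subset_size) (auto simp: subset_mset.less_le filter_mset_eq_conv)
    then have "P (filter_mset (\<lambda>x. x < N) m)" by (rule less)
    then have "P (filter_mset (\<lambda>x. x < N) m + replicate_mset (count m N) N)"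
      by (rule assms(2)[rotated]) simp
    then show ?thesis by (simp only: eq)
  qed (use assms(1) in simp)
qed

section \<open>Set-valued tableaux\<close>

lemma svts_iff:
  "T \<in> svts lam \<longleftrightarrow> T \<in> diagram lam \<rightarrow>\<^sub>E {B. finite B
      \<and> B \<noteq> {}} \<and>
     (\<forall>i j. (i, Suc j) \<in> diagram lam \<longrightarrow> (\<forall>a\<in>T (i, j).
         \<forall>b\<in>T (i, Suc j). a \<le> b)) \<and>
     (\<forall>i j. (Suc i, j) \<in> diagram lam \<longrightarrow> (\<forall>a\<in>T (i, j).
         \<forall>b\<in>T (Suc i, j). a < b))"
proof (cases "T \<in> diagram lam \<rightarrow>\<^sub>E {B. finite B \<and> B \<noteq> {}}")
  case True
  have 1: "Max (T (i, j)) \<le> Min (T (i, Suc j)) \<longleftrightarrow> (\<forall>a\<in>T (i, j).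
      \<forall>b\<in>T (i, Suc j). a \<le> b)"
    if "(i, Suc j) \<in> diagram lam" for i j
  proof -
    have "finite (T (i, j))" "T (i, j) \<noteq> {}" "finite (T (i, Suc j))" "T (i, Suc j) \<noteq> {}"
      using PiE_mem[OF True that] PiE_mem[OF True diagram_left[OF that]] by auto
    then show ?thesis by (simp; blast)
  qed
  have 2: "Max (T (i, j)) < Min (T (Suc i, j)) \<longleftrightarrow> (\<forall>a\<in>T (i, j).
      \<forall>b\<in>T (Suc i, j). a < b)"
    if "(Suc i, j) \<in> diagram lam" for i j
  proof -
    have "finite (T (i, j))" "T (i, j) \<noteq> {}" "finite (T (Suc i, j))" "T (Suc i, j) \<noteq> {}"
      using PiE_mem[OF True that] PiE_mem[OF True diagram_up[OF that]] by auto
    then show ?thesis by (simp; blast)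
  qed
  show ?thesis by (simp only: svts_def mem_Collect_eq 1 2 cong: imp_cong)
next
  case False
  then show ?thesis by (simp add: svts_def)
qed

lemma count_svt_monomial:
  assumes "T \<in> svts lam"
  shows "count (svt_monomial lam T) e = card {x \<in> diagram lam. e \<in> T x}"
proof -
  have "finite (T x)" if "x \<in> diagram lam" for x
    using assms that by (auto simp: svts_def dest: PiE_mem)
  then have "count (svt_monomial lam T) e = (\<Sum>x\<in>diagram lam. if e \<in> T x then 1 else 0)"
    unfolding svt_monomial_def count_sum by (intro sum.cong) (simp_all add: count_mset_set')
  then show ?thesis by (simp add: sum.If_cases Int_def)
qed

lemma svt_monomial_eq_iff:
  assumes "T \<in> svts lam"
  shows "svt_monomial lam T = m \<longleftrightarrow> (\<forall>e. card {x \<in> diagram lam. e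
      \<in> T x} = count m e)"
  using assms by (simp add: multiset_eq_iff count_svt_monomial)

lemma svt_entry_in_monomial:
  assumes "T \<in> svts lam" "x \<in> diagram lam" "e \<in> T x"
  shows "e \<in># svt_monomial lam T"
proof -
  have "card {x \<in> diagram lam. e \<in> T x} > 0"
  proof (subst card_gt_0_iff, intro conjI)
    show "{x \<in> diagram lam. e \<in> T x} \<noteq> {}" using assms by blast
  qed simp
  then show ?thesis using assms(1) by (simp add: count_svt_monomial flip: count_greater_zero_iff)
qed

lemma finite_svts: "finite {T \<in> svts lam. svt_monomial lam T = m}"
proof (rule finite_subset)
  show "{T \<in> svts lam. svt_monomial lam T = m} \<subseteq> diagram lam \<rightarrow>\<^sub>E
      Pow (set_mset m)"
  proof
    fix T assume T: "T \<in> {T \<in> svts lam. svt_monomial lam T = m}"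
    have "T x \<subseteq> set_mset m" if "x \<in> diagram lam" for x
      using svt_entry_in_monomial[of T lam x] that T by blast
    with T show "T \<in> diagram lam \<rightarrow>\<^sub>E Pow (set_mset m)" by (simp add: svts_iff
        PiE_iff)
  qed
qed (auto intro: finite_PiE)

definition K_count :: "nat \<Rightarrow> partition \<Rightarrow> partition \<Rightarrow> nat" where
  "K_count l lam mu =
     (if horizontal_strip lam mu \<and> psize lam - psize mu \<le> l
      then card (free_corners lam mu) choose (l - (psize lam - psize mu)) else 0)"

text \<open>The entries less than \<open>N\<close> form a tableau of shape \<open>\<mu>\<close>;
    the boxes of \<open>\<mu>\<close> that contain \<open>N\<close>
  besides form a set of free corners.\<close>

lemma card_svts_step:
  fixes m :: monomial
  assumes m: "\<And>x. x \<in># m \<Longrightarrow> x < N" and sub: "diagram mu \<subseteq> diagram lam"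
  shows "card {T \<in> svts lam. svt_monomial lam T = m + replicate_mset l N \<and>
      {x \<in> diagram lam. \<exists>e\<in>T x. e < N} = diagram mu} =
    K_count l lam mu * card {T \<in> svts mu. svt_monomial mu T = m}" (is "card ?S = _")
proof -
  define A where "A = {T \<in> svts mu. svt_monomial mu T = m}"
  define B where "B = {R. R \<subseteq> free_corners lam mu \<and> card R + (psize lam - psize mu) = l}"
  define down where "down = (\<lambda>T :: nat \<times> nat \<Rightarrow> nat set.
    (restrict (\<lambda>x. T x \<inter> {..<N}) (diagram mu), {x \<in> diagram mu. N \<in> T x}))"
  define up where "up = (\<lambda>(T', R). \<lambda>x.
    if x \<in> diagram mu then T' x \<union> (if x \<in> R then {N} else {})
    else if x \<in> diagram lam then {N} else undefined)"
  have card_minus: "card (diagram lam - diagram mu) = psize lam - psize mu"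
    using sub by (simp add: card_Diff_subset card_diagram)
  have corners_sub: "free_corners lam mu \<subseteq> diagram mu" by (auto simp: free_corners_def)
  have entries: "\<exists>e\<in>T x. True" "e \<in> T x \<Longrightarrow> e \<le> N" "x \<notin>
      diagram mu \<Longrightarrow> T x = {N}"
    if T: "T \<in> ?S" and x: "x \<in> diagram lam" for T x e
  proof -
    have T': "T \<in> svts lam" "svt_monomial lam T = m + replicate_mset l N" using T by auto
    then show ne: "\<exists>e\<in>T x. True" using x by (auto simp: svts_def dest: PiE_mem)
    show le: "e \<le> N" if "e \<in> T x" for e
      using svt_entry_in_monomial[OF T'(1) x that] T'(2) m by (auto simp: less_imp_le split: if_splits)
    assume nmu: "x \<notin> diagram mu"
    then have "\<not> (\<exists>e\<in>T x. e < N)" using x T by blast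
    then have "e = N" if "e \<in> T x" for e using le[OF that] that by (meson le_neq_implies_less)
    then show "T x = {N}" using ne by blast
  qed
  \<comment> \<open>A box with another box of \<open>lam\<close> below it holds entries strictly
    smaller than some entry that is at most \<open>N\<close>, so it belongs to
    \<open>mu\<close>.\<close>
  have horizontal: "horizontal_strip lam mu" if T: "T \<in> ?S" for T
    unfolding horizontal_strip_def
  proof (intro conjI allI impI sub)
    fix i j assume ij: "(Suc i, j) \<in> diagram lam"
    then have ij': "(i, j) \<in> diagram lam" by (rule diagram_up)
    obtain b where b: "b \<in> T (Suc i, j)" using entries(1)[OF T ij] by blast
    obtain a where a: "a \<in> T (i, j)" using entries(1)[OF T ij'] by blast
    have "a < b" using T ij a b by (auto simp: svts_iff)
    then have "a < N" using entries(2)[OF T ij b] by simp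
    then show "(i, j) \<in> diagram mu" using T a ij' by blast
  qed
  show ?thesis
  proof (cases "horizontal_strip lam mu")
    case False
    then have "?S = {}" using horizontal by blast
    then have "card ?S = 0" by (simp only: card.empty)
    with False show ?thesis by (simp add: K_count_def)
  next
    case hor: True
    have "bij_betw down ?S (A \<times> B)"
    proof (rule bij_betw_byWitness[where f' = up])
      show "\<forall>T\<in>?S. up (down T) = T"
      proof
        fix T assume T: "T \<in> ?S"
        show "up (down T) = T"
        proof
          fix x
          show "up (down T) x = T x"
          proof (cases "x \<in> diagram lam")
            case True
            then show ?thesis
              using entries(2,3)[OF T True] sub
              by (cases "x \<in> diagram mu") (auto simp: up_def down_def le_less)
          next
            case False
            then have "T x = undefined" using T by (auto simp: svts_iff)
            then show ?thesis using False sub by (auto simp: up_def down_def)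
          qed
        qed
      qed
      have lessN: "e < N" if "(T', R) \<in> A \<times> B" "x \<in> diagram mu" "e \<in> T' x" for
          T' R x e
        using that svt_entry_in_monomial[of T' mu x e] m by (auto simp: A_def)
      show "\<forall>p\<in>A \<times> B. down (up p) = p"
      proof
        fix p assume p: "p \<in> A \<times> B"
        obtain T' R where [simp]: "p = (T', R)" by fastforce
        have ext: "T' \<in> extensional (diagram mu)" using p by (auto simp: A_def svts_iff PiE_def)
        have R: "R \<subseteq> diagram mu" using p corners_sub by (auto simp: B_def)
        have less: "\<And>x e. x \<in> diagram mu \<Longrightarrow> e \<in> T' x \<Longrightarrow>
            e < N" using lessN[of T' R] p by simp
        have "restrict (\<lambda>x. up p x \<inter> {..<N}) (diagram mu) = T'"
        proof
          fix x
          show "restrict (\<lambda>x. up p x \<inter> {..<N}) (diagram mu) x = T' x"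
          proof (cases "x \<in> diagram mu")
            case True
            then show ?thesis using less[OF True] by (auto simp: up_def)
          next
            case False
            then show ?thesis by (simp only: restrict_apply if_False extensional_arb[OF ext False])
          qed
        qed
        moreover have "{x \<in> diagram mu. N \<in> up p x} = R"
        proof (intro equalityI subsetI)
          fix x assume x: "x \<in> {x \<in> diagram mu. N \<in> up p x}"
          then have "N \<notin> T' x" using less[of x N] by blast
          then show "x \<in> R" using x by (auto simp: up_def split: if_splits)
        qed (use R in \<open>auto simp: up_def\<close>)
        ultimately show "down (up p) = p" by (simp add: down_def)
      qed
      show "down ` ?S \<subseteq> A \<times> B"
      proof
        fix p assume "p \<in> down ` ?S"
        then obtain T where T: "T \<in> ?S" and p: "p = down T" by blast
        define T' where "T' = restrict (\<lambda>x. T x \<inter> {..<N}) (diagram mu)"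
        define R where "R = {x \<in> diagram mu. N \<in> T x}"
        have Tl: "T \<in> svts lam" "svt_monomial lam T = m + replicate_mset l N"
          "{x \<in> diagram lam. \<exists>e\<in>T x. e < N} = diagram mu" using T by auto
        have T': "T' \<in> svts mu"
          unfolding svts_iff
        proof (intro conjI allI impI)
          show "T' \<in> diagram mu \<rightarrow>\<^sub>E {B. finite B \<and> B \<noteq> {}}"
            using Tl by (auto simp: T'_def)
          fix i j
          show "\<forall>a\<in>T' (i, j). \<forall>b\<in>T' (i, Suc j). a \<le> b" if "(i, Suc j)
              \<in> diagram mu"
            using that sub Tl(1) diagram_left[OF that] by (auto simp: T'_def svts_iff)
          show "\<forall>a\<in>T' (i, j). \<forall>b\<in>T' (Suc i, j). a < b" if "(Suc i, j) \<in>
              diagram mu"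
            using that sub Tl(1) diagram_up[OF that] by (auto simp: T'_def svts_iff)
        qed
        have cnt: "card {x \<in> diagram lam. e \<in> T x} = count m e + (if e = N then l else 0)" for e
          unfolding count_svt_monomial[OF Tl(1), symmetric] Tl(2) by simp
        have "svt_monomial mu T' = m"
          unfolding svt_monomial_eq_iff[OF T']
        proof
          fix e
          show "card {x \<in> diagram mu. e \<in> T' x} = count m e"
          proof (cases "e < N")
            case True
            then have "{x \<in> diagram mu. e \<in> T' x} = {x \<in> diagram lam. e \<in> T x}"
              using Tl(3) by (auto simp: T'_def)
            then show ?thesis using cnt[of e] True by simp
          next
            case False
            then have "{x \<in> diagram mu. e \<in> T' x} = {}" by (auto simp: T'_def)
            moreover have "count m e = 0" using False m by (meson count_inI)
            ultimately show ?thesis by simp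
          qed
        qed
        then have 1: "T' \<in> A" using T' by (simp add: A_def)
        have "R \<subseteq> free_corners lam mu"
        proof
          fix x assume "x \<in> R"
          moreover obtain i j where x: "x = (i, j)" by fastforce
          ultimately have ij: "(i, j) \<in> diagram mu" "N \<in> T (i, j)" by (auto simp: R_def)
          have "(i, Suc j) \<notin> diagram mu"
          proof
            assume *: "(i, Suc j) \<in> diagram mu"
            then obtain b where "b \<in> T (i, Suc j)" "b < N" using Tl(3) by blast
            moreover have "\<forall>a\<in>T (i, j). \<forall>b\<in>T (i, Suc j). a \<le> b"
              using Tl(1) * sub by (auto simp: svts_iff)
            ultimately show False using ij(2) by (meson not_le)
          qed
          moreover have "(Suc i, j) \<notin> diagram lam"
          proof
            assume *: "(Suc i, j) \<in> diagram lam"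
            then obtain b where "b \<in> T (Suc i, j)" "b \<le> N" using entries(1,2)[OF T *] by blast
            moreover have "\<forall>a\<in>T (i, j). \<forall>b\<in>T (Suc i, j). a < b"
              using Tl(1) * by (auto simp: svts_iff)
            ultimately show False using ij(2) by (meson not_le)
          qed
          ultimately show "x \<in> free_corners lam mu" using ij by (simp add: free_corners_def x)
        qed
        moreover have "card R + (psize lam - psize mu) = l"
        proof -
          have "{x \<in> diagram lam. N \<in> T x} = R \<union> (diagram lam - diagram mu)"
            using entries(3)[OF T] sub by (auto simp: R_def)
          then have "card {x \<in> diagram lam. N \<in> T x} = card R + card (diagram lam - diagram mu)"
            by (simp only:) (rule card_Un_disjoint, auto simp: R_def)
          moreover have "count m N = 0" using m by (meson count_inI less_irrefl)
          ultimately show ?thesis using cnt[of N] by (simp add: card_minus)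
        qed
        ultimately have "R \<in> B" by (simp add: B_def)
        with 1 show "p \<in> A \<times> B" by (simp add: p down_def T'_def R_def)
      qed
      show "up ` (A \<times> B) \<subseteq> ?S"
      proof
        fix T assume "T \<in> up ` (A \<times> B)"
        then obtain T' R where TR: "(T', R) \<in> A \<times> B" and T: "T = up (T', R)" by auto
        have T': "T' \<in> svts mu" "svt_monomial mu T' = m"
          and R: "R \<subseteq> free_corners lam mu" "card R + (psize lam - psize mu) = l"
          using TR by (auto simp: A_def B_def)
        have R_mu: "R \<subseteq> diagram mu" using R corners_sub by blast
        have val: "T x = T' x \<union> (if x \<in> R then {N} else {})" if "x \<in> diagram mu" for x
          using that by (simp add: T up_def)
        have val': "T x = {N}" if "x \<in> diagram lam" "x \<notin> diagram mu" for x
          using that by (simp add: T up_def)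
        have Tl: "T \<in> svts lam"
          unfolding svts_iff
        proof (intro conjI allI impI)
          show "T \<in> diagram lam \<rightarrow>\<^sub>E {B. finite B \<and> B \<noteq> {}}"
          proof (rule PiE_I)
            fix x assume "x \<in> diagram lam"
            then show "T x \<in> {B. finite B \<and> B \<noteq> {}}"
              using T'(1) val val' by (cases "x \<in> diagram mu") (auto simp: svts_iff PiE_iff)
          next
            fix x assume "x \<notin> diagram lam"
            then show "T x = undefined" using sub by (auto simp: T up_def)
          qed
          fix i j
          show "\<forall>a\<in>T (i, j). \<forall>b\<in>T (i, Suc j). a \<le> b" if ij: "(i, Suc j)
              \<in> diagram lam"
          proof (cases "(i, Suc j) \<in> diagram mu")
            case True
            then have mu: "(i, j) \<in> diagram mu" by (rule diagram_left)
            have "(i, j) \<notin> R" using R True by (auto simp: free_corners_def)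
            then show ?thesis
              using val[OF True] val[OF mu] lessN[OF TR mu] T'(1) True by (auto simp: svts_iff
                  less_imp_le)
          next
            case False
            have "a \<le> N" if "a \<in> T (i, j)" for a
              using that val[of "(i, j)"] val'[OF diagram_left[OF ij]] lessN[OF TR, of "(i, j)" a]
              by (cases "(i, j) \<in> diagram mu") (auto simp: less_imp_le split: if_splits)
            then show ?thesis using val'[OF ij False] by simp
          qed
          show "\<forall>a\<in>T (i, j). \<forall>b\<in>T (Suc i, j). a < b" if ij: "(Suc i, j)
              \<in> diagram lam"
          proof -
            have mu: "(i, j) \<in> diagram mu" using hor ij by (simp add: horizontal_strip_def)
            have "(i, j) \<notin> R" using R ij by (auto simp: free_corners_def)
            then show ?thesis
              using val[OF mu] lessN[OF TR mu] T'(1) val[of "(Suc i, j)"] val'[OF ij]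
              by (cases "(Suc i, j) \<in> diagram mu") (auto simp: svts_iff split: if_splits)
          qed
        qed
        have "svt_monomial lam T = m + replicate_mset l N"
          unfolding svt_monomial_eq_iff[OF Tl]
        proof
          fix e
          have cnt: "card {x \<in> diagram mu. e \<in> T' x} = count m e"
            unfolding count_svt_monomial[OF T'(1), symmetric] T'(2) ..
          show "card {x \<in> diagram lam. e \<in> T x} = count (m + replicate_mset l N) e"
          proof (cases "e = N")
            case True
            have "{x \<in> diagram lam. N \<in> T x} = R \<union> (diagram lam - diagram mu)"
              using sub val val' R_mu lessN[OF TR, of _ N] by (auto split: if_splits)
            then have "card {x \<in> diagram lam. N \<in> T x} = card R + card (diagram lam -
                diagram mu)"
              using R_mu by (simp only:) (rule card_Un_disjoint, auto intro: finite_subset)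
            moreover have "count m N = 0" using m by (meson count_inI less_irrefl)
            ultimately show ?thesis using True R by (simp add: card_minus)
          next
            case False
            have "e \<in> T x \<longleftrightarrow> x \<in> diagram mu \<and> e \<in> T' x" if "x
                \<in> diagram lam" for x
              using that False val[of x] val'[of x] by (cases "x \<in> diagram mu") auto
            then have "{x \<in> diagram lam. e \<in> T x} = {x \<in> diagram mu. e \<in> T' x}"
              using sub by blast
            then show ?thesis using False cnt by simp
          qed
        qed
        moreover have "{x \<in> diagram lam. \<exists>e\<in>T x. e < N} = diagram mu"
        proof (intro equalityI subsetI)
          fix x assume "x \<in> diagram mu"
          moreover from this obtain e where "e \<in> T' x" using T'(1) by (fastforce simp: svts_iff
              PiE_iff)
          ultimately show "x \<in> {x \<in> diagram lam. \<exists>e\<in>T x. e < N}"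
            using lessN[OF TR] sub val by blast
        next
          fix x assume "x \<in> {x \<in> diagram lam. \<exists>e\<in>T x. e < N}"
          then show "x \<in> diagram mu" using val'[of x] by (cases "x \<in> diagram mu") auto
        qed
        ultimately show "T \<in> ?S" using Tl by simp
      qed
    qed
    then have "card ?S = card A * card B" by (simp only: bij_betw_same_card card_cartesian_product)
    moreover have "card B = K_count l lam mu"
    proof (cases "psize lam - psize mu \<le> l")
      case True
      then have "B = {R. R \<subseteq> free_corners lam mu \<and> card R = l - (psize lam - psize mu)}"
        by (auto simp: B_def)
      moreover have "finite (free_corners lam mu)" using corners_sub by (rule finite_subset) simp
      ultimately show ?thesis using True hor by (simp add: n_subsets K_count_def)
    next
      case False
      then have "B = {}" by (auto simp: B_def)
      then show ?thesis using False by (simp add: K_count_def)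
    qed
    ultimately show ?thesis by (simp add: A_def)
  qed
qed

lemma ex_shape_below:
  assumes "\<And>i j. (Suc i, j) \<in> diagram lam \<Longrightarrow> Q (Suc i, j) \<Longrightarrow>
      Q (i, j)"
    "\<And>i j. (i, Suc j) \<in> diagram lam \<Longrightarrow> Q (i, Suc j) \<Longrightarrow> Q (i, j)"
  shows "\<exists>mu. diagram mu \<subseteq> diagram lam \<and> {x \<in> diagram lam. Q x} = diagram mu"
proof -
  have "\<exists>mu. diagram mu = {x \<in> diagram lam. Q x}"
    by (rule down_closed_diagram) (use assms in \<open>auto intro: diagram_up diagram_left\<close>)
  then show ?thesis by blast
qed

lemma card_by_shape:
  assumes fin: "finite S"
    and shape: "\<And>T. T \<in> S \<Longrightarrow> \<exists>mu. diagram mu \<subseteq> diagram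
        lam \<and> sh T = diagram mu"
  shows "card S = (\<Sum>mu | diagram mu \<subseteq> diagram lam. card {T \<in> S. sh T = diagram mu})"
proof -
  have "S = (\<Union>mu\<in>{mu. diagram mu \<subseteq> diagram lam}. {T \<in> S. sh T = diagram mu})"
    using shape by blast
  then have "card S = card (\<Union>mu\<in>{mu. diagram mu \<subseteq> diagram lam}. {T \<in> S. sh
      T = diagram mu})"
    by (rule arg_cong)
  also have "\<dots> = (\<Sum>mu | diagram mu \<subseteq> diagram lam. card {T \<in> S. sh T =
      diagram mu})"
    by (rule card_UN_disjoint) (use fin diagram_inject in auto)
  finally show ?thesis .
qed

text \<open>Tableaux are sorted by the set of boxes that contain an entry smaller than
  \<open>N\<close>. Increase along rows and columns makes this set closed under moving left and up,
  hence a diagram.\<close>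

lemma K_tilde_step:
  assumes m: "\<And>x. x \<in># m \<Longrightarrow> x < N"
  shows "K_tilde lam (m + replicate_mset l N) =
    (\<Sum>mu | diagram mu \<subseteq> diagram lam. int (K_count l lam mu) * K_tilde mu m)"
proof -
  let ?S = "{T \<in> svts lam. svt_monomial lam T = m + replicate_mset l N}"
  have "\<exists>mu. diagram mu \<subseteq> diagram lam \<and> {x \<in> diagram lam.
      \<exists>e\<in>T x. e < N} = diagram mu" if T: "T \<in> ?S" for T
  proof (rule ex_shape_below)
    fix i j
    show "\<exists>e\<in>T (i, j). e < N" if "(Suc i, j) \<in> diagram lam" "\<exists>e\<in>T (Suc
        i, j). e < N"
    proof -
      have "T (i, j) \<noteq> {}" using T diagram_up[OF that(1)] by (auto simp: svts_iff PiE_iff)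
      with that T show ?thesis by (fastforce simp: svts_iff)
    qed
    show "\<exists>e\<in>T (i, j). e < N" if "(i, Suc j) \<in> diagram lam" "\<exists>e\<in>T (i,
        Suc j). e < N"
    proof -
      have "T (i, j) \<noteq> {}" using T diagram_left[OF that(1)] by (auto simp: svts_iff PiE_iff)
      with that T show ?thesis by (fastforce simp: svts_iff)
    qed
  qed
  then have "card ?S = (\<Sum>mu | diagram mu \<subseteq> diagram lam.
      card {T \<in> ?S. {x \<in> diagram lam. \<exists>e\<in>T x. e < N} = diagram mu})"
    by (rule card_by_shape[OF finite_svts])
  also have "\<dots> = (\<Sum>mu | diagram mu \<subseteq> diagram lam.
      K_count l lam mu * card {T \<in> svts mu. svt_monomial mu T = m})"
  proof (rule sum.cong[OF refl])
    fix mu assume "mu \<in> {mu. diagram mu \<subseteq> diagram lam}"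
    then show "card {T \<in> ?S. {x \<in> diagram lam. \<exists>e\<in>T x. e < N} = diagram mu} =
        K_count l lam mu * card {T \<in> svts mu. svt_monomial mu T = m}"
      using card_svts_step[of m N mu lam l] m by (simp add: conj_assoc)
  qed
  finally show ?thesis by (simp add: K_tilde_def)
qed

section \<open>Reverse plane partitions\<close>

lemma count_rpp_monomial:
  "count (rpp_monomial lam T) e = card (snd ` {x \<in> diagram lam. T x = e})"
proof -
  have fin: "finite {T (i, j) | i. (i, j) \<in> diagram lam}" for j
  proof (rule finite_subset)
    show "{T (i, j) | i. (i, j) \<in> diagram lam} \<subseteq> T ` diagram lam" by blast
  qed simp
  have "count (rpp_monomial lam T) e =
      (\<Sum>j\<in>snd ` diagram lam. if \<exists>i. (i, j) \<in> diagram lam \<and> T (i, j) = e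
          then 1 else 0)"
    unfolding rpp_monomial_def count_sum
    by (intro sum.cong refl, subst count_mset_set', use fin in auto)
  also have "\<dots> = card {j \<in> snd ` diagram lam. \<exists>i. (i, j) \<in> diagram lam \<and>
      T (i, j) = e}"
    by (simp add: sum.If_cases Int_def)
  also have "{j \<in> snd ` diagram lam. \<exists>i. (i, j) \<in> diagram lam \<and> T (i, j) = e} =
      snd ` {x \<in> diagram lam. T x = e}"
    by force
  finally show ?thesis .
qed

lemma rpp_entry_in_monomial:
  assumes "x \<in> diagram lam"
  shows "T x \<in># rpp_monomial lam T"
proof -
  have "card (snd ` {y \<in> diagram lam. T y = T x}) > 0"
  proof (subst card_gt_0_iff, intro conjI)
    show "snd ` {y \<in> diagram lam. T y = T x} \<noteq> {}" using assms by blast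
  qed simp
  then show ?thesis by (simp add: count_rpp_monomial flip: count_greater_zero_iff)
qed

lemma finite_rpps: "finite {T \<in> rpps lam. rpp_monomial lam T = m}"
proof (rule finite_subset)
  show "{T \<in> rpps lam. rpp_monomial lam T = m} \<subseteq> diagram lam \<rightarrow>\<^sub>E
      set_mset m"
  proof
    fix T assume T: "T \<in> {T \<in> rpps lam. rpp_monomial lam T = m}"
    then have "T x \<in># m" if "x \<in> diagram lam" for x
      using rpp_entry_in_monomial[OF that, of T] by auto
    then show "T \<in> diagram lam \<rightarrow>\<^sub>E set_mset m" using T by (auto simp only:
        rpps_def PiE_iff mem_Collect_eq)
  qed
qed (auto intro: finite_PiE)

text \<open>The entries \<open>N\<close> fill precisely the boxes of \<open>lam\<close> outside
  \<open>mu\<close>, whatever that skew shape is, so a tableau is determined by its smaller entries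
  and the exponent of \<open>N\<close> is forced.\<close>

lemma card_rpps_step:
  fixes m :: monomial
  assumes m: "\<And>x. x \<in># m \<Longrightarrow> x < N" and sub: "diagram mu \<subseteq> diagram lam"
  shows "card {T \<in> rpps lam. rpp_monomial lam T = m + replicate_mset k N \<and>
      {x \<in> diagram lam. T x < N} = diagram mu} =
    (if columns lam mu = k then card {T \<in> rpps mu. rpp_monomial mu T = m} else 0)" (is "card ?S = _")
proof -
  define A where "A = {T \<in> rpps mu. rpp_monomial mu T = m}"
  define up where "up = (\<lambda>T' x.
    if x \<in> diagram mu then T' x else if x \<in> diagram lam then N else (undefined :: nat))"
  have m0: "count m e = 0" if "N \<le> e" for e using that m by (meson count_inI not_le)
  have entries: "T x = N" if T: "T \<in> ?S" and x: "x \<in> diagram lam" "x \<notin> diagram mu" for T x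
  proof -
    have "\<not> T x < N" using x T by blast
    moreover have "T x \<in># m + replicate_mset k N" using rpp_entry_in_monomial[OF x(1), of T] T
        by simp
    ultimately show ?thesis using m[of "T x"] by (auto split: if_splits)
  qed
  have lessN: "T' x < N" if "T' \<in> A" "x \<in> diagram mu" for T' x
    using rpp_entry_in_monomial[OF that(2), of T'] that(1) m by (auto simp: A_def)
  have col: "columns lam mu = k" and down_A: "restrict T (diagram mu) \<in> A" if T: "T \<in> ?S" for T
  proof -
    have Tl: "T \<in> rpps lam" "rpp_monomial lam T = m + replicate_mset k N"
      "{x \<in> diagram lam. T x < N} = diagram mu" using T by auto
    have mu_iff: "x \<in> diagram mu \<longleftrightarrow> x \<in> diagram lam \<and> T x < N" for x
      using Tl(3) by blast
    have cnt: "card (snd ` {x \<in> diagram lam. T x = e}) = count m e + (if e = N then k else 0)" for e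
      unfolding count_rpp_monomial[symmetric] Tl(2) by simp
    have "{x \<in> diagram lam. T x = N} = diagram lam - diagram mu"
    proof -
      have "T x = N \<longleftrightarrow> x \<notin> diagram mu" if "x \<in> diagram lam" for x
        using entries[OF T that] that by (auto simp: mu_iff)
      then show ?thesis by blast
    qed
    then show "columns lam mu = k" using cnt[of N] m0[of N] by (simp add: columns_def)
    have "restrict T (diagram mu) \<in> rpps mu"
      unfolding rpps_def
    proof (intro CollectI conjI allI impI)
      show "restrict T (diagram mu) (i, j) \<le> restrict T (diagram mu) (i, Suc j)"
        if "(i, Suc j) \<in> diagram mu" for i j
      proof -
        have "T (i, j) \<le> T (i, Suc j)" using Tl(1) sub that by (auto simp: rpps_def)
        then show ?thesis using that diagram_left[OF that] by simp
      qed
      show "restrict T (diagram mu) (i, j) \<le> restrict T (diagram mu) (Suc i, j)"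
        if "(Suc i, j) \<in> diagram mu" for i j
      proof -
        have "T (i, j) \<le> T (Suc i, j)" using Tl(1) sub that by (auto simp: rpps_def)
        then show ?thesis using that diagram_up[OF that] by simp
      qed
    qed simp
    moreover have "rpp_monomial mu (restrict T (diagram mu)) = m"
    proof (rule multiset_eqI)
      fix e
      show "count (rpp_monomial mu (restrict T (diagram mu))) e = count m e"
      proof (cases "e < N")
        case True
        then have "{x \<in> diagram mu. restrict T (diagram mu) x = e} = {x \<in> diagram lam. T x = e}"
          by (intro Collect_cong) (auto simp: mu_iff)
        then show ?thesis using cnt[of e] True by (simp add: count_rpp_monomial)
      next
        case False
        then have "{x \<in> diagram mu. restrict T (diagram mu) x = e} = {}"
          by (simp add: mu_iff)
        then show ?thesis using m0[of e] False by (simp add: count_rpp_monomial)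
      qed
    qed
    ultimately show "restrict T (diagram mu) \<in> A" by (simp add: A_def)
  qed
  show ?thesis
  proof (cases "columns lam mu = k")
    case False
    then have "?S = {}" using col by blast
    then have "card ?S = 0" by (simp only: card.empty)
    then show ?thesis using False by simp
  next
    case col: True
    have "bij_betw (\<lambda>T. restrict T (diagram mu)) ?S A"
    proof (rule bij_betw_byWitness[where f' = up])
      show "\<forall>T\<in>?S. up (restrict T (diagram mu)) = T"
      proof
        fix T assume T: "T \<in> ?S"
        show "up (restrict T (diagram mu)) = T"
        proof
          fix x
          have "T x = undefined" if "x \<notin> diagram lam" using extensional_arb[of T "diagram
              lam" x] T that by (simp add: rpps_def PiE_def)
          then show "up (restrict T (diagram mu)) x = T x"
            using entries[OF T, of x] sub by (auto simp: up_def)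
        qed
      qed
      show "\<forall>T'\<in>A. restrict (up T') (diagram mu) = T'"
      proof
        fix T' assume "T' \<in> A"
        then have ext: "T' \<in> extensional (diagram mu)" by (auto simp: A_def rpps_def PiE_iff)
        show "restrict (up T') (diagram mu) = T'"
        proof
          fix x
          show "restrict (up T') (diagram mu) x = T' x"
            using extensional_arb[OF ext, of x] by (simp add: up_def)
        qed
      qed
      show "(\<lambda>T. restrict T (diagram mu)) ` ?S \<subseteq> A" using down_A by blast
      show "up ` A \<subseteq> ?S"
      proof
        fix T assume "T \<in> up ` A"
        then obtain T' where T': "T' \<in> A" and T: "T = up T'" by auto
        have R: "T' \<in> rpps mu" "rpp_monomial mu T' = m" using T' by (auto simp: A_def)
        have val: "T x = T' x" "T x < N" if "x \<in> diagram mu" for x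
          using that lessN[OF T' that] by (simp_all add: T up_def)
        have val': "T x = N" if "x \<in> diagram lam" "x \<notin> diagram mu" for x
          using that by (simp add: T up_def)
        have leN: "T x \<le> N" if "x \<in> diagram lam" for x
          using val[of x] val'[of x] that by (cases "x \<in> diagram mu") auto
        have Tl: "T \<in> rpps lam"
          unfolding rpps_def
        proof (intro CollectI conjI allI impI)
          show "T \<in> diagram lam \<rightarrow>\<^sub>E UNIV"
            using sub by (auto simp: PiE_iff extensional_def T up_def)
          fix i j
          show "T (i, j) \<le> T (i, Suc j)" if ij: "(i, Suc j) \<in> diagram lam"
          proof (cases "(i, Suc j) \<in> diagram mu")
            case True
            then show ?thesis using R(1) val(1)[OF True] val(1)[OF diagram_left[OF True]] by (auto
                simp: rpps_def)
          next
            case False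
            then show ?thesis using val'[OF ij False] leN[OF diagram_left[OF ij]] by simp
          qed
          show "T (i, j) \<le> T (Suc i, j)" if ij: "(Suc i, j) \<in> diagram lam"
          proof (cases "(Suc i, j) \<in> diagram mu")
            case True
            then show ?thesis using R(1) val(1)[OF True] val(1)[OF diagram_up[OF True]] by (auto
                simp: rpps_def)
          next
            case False
            then show ?thesis using val'[OF ij False] leN[OF diagram_up[OF ij]] by simp
          qed
        qed
        have "rpp_monomial lam T = m + replicate_mset k N"
        proof (rule multiset_eqI)
          fix e
          show "count (rpp_monomial lam T) e = count (m + replicate_mset k N) e"
          proof (cases "e = N")
            case True
            have "T x = N \<longleftrightarrow> x \<notin> diagram mu" if "x \<in> diagram lam" for x
              using that val[of x] val'[of x] by (cases "x \<in> diagram mu") auto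
            then have "{x \<in> diagram lam. T x = N} = diagram lam - diagram mu" by blast
            then show ?thesis using True m0[of N] col by (simp add: count_rpp_monomial columns_def)
          next
            case False
            have "T x = e \<longleftrightarrow> x \<in> diagram mu \<and> T' x = e" if "x \<in>
                diagram lam" for x
              using that False val[of x] val'[of x] by (cases "x \<in> diagram mu") auto
            then have "{x \<in> diagram lam. T x = e} = {x \<in> diagram mu. T' x = e}" using sub
                by blast
            then show ?thesis using False by (simp add: count_rpp_monomial flip: R(2))
          qed
        qed
        moreover have "{x \<in> diagram lam. T x < N} = diagram mu"
        proof -
          have "T x < N \<longleftrightarrow> x \<in> diagram mu" if "x \<in> diagram lam" for x
            using that val[of x] val'[of x] by (cases "x \<in> diagram mu") auto
          then show ?thesis using sub by blast
        qed
        ultimately show "T \<in> ?S" using Tl by simp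
      qed
    qed
    then have "card ?S = card A" by (rule bij_betw_same_card)
    then show ?thesis using col by (simp add: A_def)
  qed
qed

lemma dual_groth_step:
  assumes m: "\<And>x. x \<in># m \<Longrightarrow> x < N"
  shows "dual_groth lam (m + replicate_mset k N) =
    (\<Sum>mu | diagram mu \<subseteq> diagram lam. if columns lam mu = k then dual_groth mu m else 0)"
proof -
  let ?S = "{T \<in> rpps lam. rpp_monomial lam T = m + replicate_mset k N}"
  have "\<exists>mu. diagram mu \<subseteq> diagram lam \<and> {x \<in> diagram lam. T x < N} =
      diagram mu" if T: "T \<in> ?S" for T
  proof (rule ex_shape_below)
    fix i j
    show "T (i, j) < N" if "(Suc i, j) \<in> diagram lam" "T (Suc i, j) < N"
    proof -
      have "T (i, j) \<le> T (Suc i, j)" using T that(1) by (simp add: rpps_def)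
      with that(2) show ?thesis by simp
    qed
    show "T (i, j) < N" if "(i, Suc j) \<in> diagram lam" "T (i, Suc j) < N"
    proof -
      have "T (i, j) \<le> T (i, Suc j)" using T that(1) by (simp add: rpps_def)
      with that(2) show ?thesis by simp
    qed
  qed
  then have "card ?S = (\<Sum>mu | diagram mu \<subseteq> diagram lam.
      card {T \<in> ?S. {x \<in> diagram lam. T x < N} = diagram mu})"
    by (rule card_by_shape[OF finite_rpps])
  also have "\<dots> = (\<Sum>mu | diagram mu \<subseteq> diagram lam.
      if columns lam mu = k then card {T \<in> rpps mu. rpp_monomial mu T = m} else 0)"
  proof (rule sum.cong[OF refl])
    fix mu assume "mu \<in> {mu. diagram mu \<subseteq> diagram lam}"
    then show "card {T \<in> ?S. {x \<in> diagram lam. T x < N} = diagram mu} =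
        (if columns lam mu = k then card {T \<in> rpps mu. rpp_monomial mu T = m} else 0)"
      using card_rpps_step[of m N mu lam k] m by (simp add: conj_assoc)
  qed
  finally show ?thesis by (simp add: dual_groth_def if_distrib[of int] cong: if_cong)
qed

section \<open>Degree bounds and comparison with Schur functions\<close>

lemma K_tilde_empty: "K_tilde lam {#} = (if lam = empty_partition then 1 else 0)"
proof (cases "lam = empty_partition")
  case True
  have "{T \<in> svts empty_partition. svt_monomial empty_partition T = {#}} = {\<lambda>x. undefined}"
    by (auto simp: svts_def svt_monomial_def)
  then show ?thesis using True by (simp add: K_tilde_def)
next
  case False
  then obtain x where x: "x \<in> diagram lam" by (metis diagram_eq_empty_iff ex_in_conv)
  have "svt_monomial lam T \<noteq> {#}" if T: "T \<in> svts lam" for T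
  proof -
    obtain e where "e \<in> T x" using T x by (fastforce simp: svts_iff PiE_iff)
    from svt_entry_in_monomial[OF T x this] show ?thesis by auto
  qed
  then have "{T \<in> svts lam. svt_monomial lam T = {#}} = {}" by auto
  then show ?thesis using False by (simp only: K_tilde_def) simp
qed

lemma dual_groth_empty: "dual_groth lam {#} = (if lam = empty_partition then 1 else 0)"
proof (cases "lam = empty_partition")
  case True
  have "{T \<in> rpps empty_partition. rpp_monomial empty_partition T = {#}} = {\<lambda>x. undefined}"
    by (auto simp: rpps_def rpp_monomial_def)
  then show ?thesis using True by (simp add: dual_groth_def)
next
  case False
  then obtain x where x: "x \<in> diagram lam" by (metis diagram_eq_empty_iff ex_in_conv)
  then have "rpp_monomial lam T \<noteq> {#}" for T using rpp_entry_in_monomial[OF x, of T] by auto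
  then have "{T \<in> rpps lam. rpp_monomial lam T = {#}} = {}" by auto
  then show ?thesis using False by (simp only: dual_groth_def) simp
qed

lemma columns_le: "diagram mu \<subseteq> diagram lam \<Longrightarrow> columns lam mu \<le> psize
    lam - psize mu"
  unfolding columns_def card_diagram[symmetric]
  by (subst card_Diff_subset[symmetric]) (auto intro: card_image_le)

text \<open>Equality says that no column of the skew shape contains two boxes. It singles out the
  terms of top degree in the recursion for \<open>dual_groth\<close>.\<close>

lemma columns_eq_iff:
  assumes sub: "diagram mu \<subseteq> diagram lam"
  shows "columns lam mu = psize lam - psize mu \<longleftrightarrow> horizontal_strip lam mu"
proof -
  have fin: "finite (diagram lam - diagram mu)" by simp
  have "card (diagram lam - diagram mu) = psize lam - psize mu"
    using sub by (simp add: card_Diff_subset card_diagram)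
  then have "columns lam mu = psize lam - psize mu \<longleftrightarrow> inj_on snd (diagram lam -
      diagram mu)"
    unfolding columns_def using inj_on_iff_eq_card[OF fin, of snd] by simp
  also have "\<dots> \<longleftrightarrow> horizontal_strip lam mu"
  proof
    assume inj: "inj_on snd (diagram lam - diagram mu)"
    show "horizontal_strip lam mu"
      unfolding horizontal_strip_def
    proof (intro conjI allI impI sub, rule ccontr)
      fix i j assume *: "(Suc i, j) \<in> diagram lam" "(i, j) \<notin> diagram mu"
      then have "(Suc i, j) \<in> diagram lam - diagram mu" "(i, j) \<in> diagram lam - diagram mu"
        using diagram_up[of i j] by auto
      from inj_onD[OF inj _ this] show False by simp
    qed
  next
    assume hor: "horizontal_strip lam mu"
    have "i = i'" if "(i, j) \<in> diagram lam - diagram mu" "(i', j) \<in> diagram lam - diagram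
        mu" for i i' j
    proof -
      have "\<not> i < i'" if *: "j < row lam i'" "row mu i \<le> j" for i i'
        using * hor row_antimono[of "Suc i" i' lam] by (auto simp: horizontal_strip_iff) (meson
            Suc_leI le_trans not_le)
      from this[of i' i] this[of i i'] that show ?thesis by (auto simp: diagram_iff)
    qed
    then show "inj_on snd (diagram lam - diagram mu)" by (auto simp: inj_on_def)
  qed
  finally show ?thesis .
qed

lemma K_count_nonzeroD:
  assumes "K_count l lam mu \<noteq> 0"
  shows "horizontal_strip lam mu" "psize lam - psize mu \<le> l"
  using assms by (auto simp: K_count_def split: if_splits)

text \<open>Every box of a set-valued tableau contributes at least one factor, whereas equal entries
  in a column of a reverse plane partition merge. So \<open>K_tilde\<close> starts, and
  \<open>dual_groth\<close> ends, in degree \<open>psize lam\<close>.\<close>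

lemma K_tilde_nonzero: "K_tilde lam m \<noteq> 0 \<Longrightarrow> psize lam \<le> size m"
proof (induction m arbitrary: lam rule: mset_max_induct)
  case empty
  then show ?case by (simp add: K_tilde_empty split: if_splits)
next
  case (add m N l)
  have "(\<Sum>mu | diagram mu \<subseteq> diagram lam. int (K_count l lam mu) * K_tilde mu m)
      \<noteq> 0"
    using add.prems add.hyps by (simp add: K_tilde_step)
  then obtain mu where "int (K_count l lam mu) * K_tilde mu m \<noteq> 0"
    by (rule sum.not_neutral_contains_not_neutral)
  then have "psize lam - psize mu \<le> l" "psize mu \<le> size m"
    using K_count_nonzeroD[of l lam mu] add.IH[of mu] by auto
  then show ?case by simp
qed

lemma dual_groth_nonzero: "dual_groth lam m \<noteq> 0 \<Longrightarrow> size m \<le> psize lam"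
proof (induction m arbitrary: lam rule: mset_max_induct)
  case empty
  then show ?case by simp
next
  case (add m N k)
  have "(\<Sum>mu | diagram mu \<subseteq> diagram lam. if columns lam mu = k then dual_groth mu m
      else 0) \<noteq> 0"
    using add.prems add.hyps by (simp add: dual_groth_step)
  then obtain mu where "diagram mu \<subseteq> diagram lam" "columns lam mu = k" "dual_groth mu m
      \<noteq> 0"
    by (rule sum.not_neutral_contains_not_neutral) (auto split: if_splits)
  then have "k \<le> psize lam - psize mu" "psize mu \<le> psize lam" "size m \<le> psize mu"
    using columns_le[of mu lam] psize_mono[of mu lam] add.IH[of mu] by auto
  then show ?case by simp
qed

lemma size_sum_multiset:
  fixes f :: "'a \<Rightarrow> 'b multiset"
  shows "size (\<Sum>x\<in>A. f x) = (\<Sum>x\<in>A. size (f x))"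
  by (induction A rule: infinite_finite_induct) auto

lemma size_ssyt_monomial: "size (ssyt_monomial lam T) = psize lam"
  by (simp add: ssyt_monomial_def size_sum_multiset card_diagram)

lemma schur_nonzero: "schur lam m \<noteq> 0 \<Longrightarrow> size m = psize lam"
proof -
  assume "schur lam m \<noteq> 0"
  then have "{T \<in> ssyts lam. ssyt_monomial lam T = m} \<noteq> {}" unfolding schur_def by
      (metis card.empty of_nat_0)
  then show ?thesis using size_ssyt_monomial by blast
qed

text \<open>In the lowest degree the sizes of the nonempty sets add up to the number of boxes, so
  all of them are singletons.\<close>

lemma schur_eq_K_tilde:
  assumes "size m = psize lam"
  shows "schur lam m = K_tilde lam m"
proof -
  have "bij_betw (\<lambda>T. restrict (\<lambda>x. {T x}) (diagram lam))
    {T \<in> ssyts lam. ssyt_monomial lam T = m} {T \<in> svts lam. svt_monomial lam T = m}"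
  proof (rule bij_betw_byWitness[where f' = "\<lambda>T. restrict (\<lambda>x. the_elem (T x))
      (diagram lam)"])
    have single: "T x = {the_elem (T x)}"
      if T: "T \<in> svts lam" "svt_monomial lam T = m" and x: "x \<in> diagram lam" for T x
    proof -
      have fin: "finite (T y) \<and> T y \<noteq> {}" if "y \<in> diagram lam" for y
        using T(1) that by (auto simp: svts_iff PiE_iff)
      have "(\<Sum>y\<in>diagram lam. card (T y)) = (\<Sum>y\<in>diagram lam. 1)"
        using T(2) assms by (auto simp: svt_monomial_def size_sum_multiset card_diagram)
      then have "card (T x) = 1"
        using sum_mono_inv[of "\<lambda>_. 1" "diagram lam" "\<lambda>y. card (T y)" x] fin x
        by (metis One_nat_def Suc_leI card_gt_0_iff finite_diagram)
      then show ?thesis by (metis card_1_singletonE the_elem_eq)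
    qed
    show "\<forall>T\<in>{T \<in> ssyts lam. ssyt_monomial lam T = m}.
        restrict (\<lambda>x. the_elem (restrict (\<lambda>x. {T x}) (diagram lam) x)) (diagram lam) = T"
      by (auto simp: ssyts_def fun_eq_iff PiE_iff extensional_def)
    show "\<forall>T\<in>{T \<in> svts lam. svt_monomial lam T = m}.
        restrict (\<lambda>x. {restrict (\<lambda>x. the_elem (T x)) (diagram lam) x}) (diagram lam) = T"
    proof
      fix T assume T: "T \<in> {T \<in> svts lam. svt_monomial lam T = m}"
      then have ext: "T \<in> extensional (diagram lam)" by (auto simp: svts_iff PiE_iff)
      show "restrict (\<lambda>x. {restrict (\<lambda>x. the_elem (T x)) (diagram lam) x}) (diagram
          lam) = T"
      proof
        fix x
        show "restrict (\<lambda>x. {restrict (\<lambda>x. the_elem (T x)) (diagram lam) x})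
            (diagram lam) x = T x"
          using single[of T x] T extensional_arb[OF ext, of x] by (cases "x \<in> diagram lam") auto
      qed
    qed
    show "(\<lambda>T. restrict (\<lambda>x. {T x}) (diagram lam)) ` {T \<in> ssyts lam.
        ssyt_monomial lam T = m}
        \<subseteq> {T \<in> svts lam. svt_monomial lam T = m}"
    proof
      fix S assume "S \<in> (\<lambda>T. restrict (\<lambda>x. {T x}) (diagram lam)) ` {T \<in>
          ssyts lam. ssyt_monomial lam T = m}"
      then obtain T where T: "T \<in> ssyts lam" "ssyt_monomial lam T = m"
        and S: "S = restrict (\<lambda>x. {T x}) (diagram lam)" by auto
      have "S \<in> svts lam"
        unfolding svts_iff
      proof (intro conjI allI impI)
        show "S \<in> diagram lam \<rightarrow>\<^sub>E {B. finite B \<and> B \<noteq> {}}" by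
            (simp add: S)
        fix i j
        show "\<forall>a\<in>S (i, j). \<forall>b\<in>S (i, Suc j). a \<le> b" if "(i, Suc j) \<in>
            diagram lam"
          using that diagram_left[OF that] T(1) by (simp add: S ssyts_def)
        show "\<forall>a\<in>S (i, j). \<forall>b\<in>S (Suc i, j). a < b" if "(Suc i, j) \<in>
            diagram lam"
          using that diagram_up[OF that] T(1) by (simp add: S ssyts_def)
      qed
      moreover have "svt_monomial lam S = m"
        unfolding T(2)[symmetric] svt_monomial_def ssyt_monomial_def
        by (rule sum.cong) (auto simp: S)
      ultimately show "S \<in> {T \<in> svts lam. svt_monomial lam T = m}" by simp
    qed
    show "(\<lambda>T. restrict (\<lambda>x. the_elem (T x)) (diagram lam)) ` {T \<in> svts lam.
        svt_monomial lam T = m}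
        \<subseteq> {T \<in> ssyts lam. ssyt_monomial lam T = m}"
    proof
      fix S assume "S \<in> (\<lambda>T. restrict (\<lambda>x. the_elem (T x)) (diagram lam)) ` {T
          \<in> svts lam. svt_monomial lam T = m}"
      then obtain T where T: "T \<in> svts lam" "svt_monomial lam T = m"
        and S: "S = restrict (\<lambda>x. the_elem (T x)) (diagram lam)" by auto
      have S_in: "S x \<in> T x" if "x \<in> diagram lam" for x
        using single[OF T that] that by (metis S insertI1 restrict_apply)
      have "S \<in> ssyts lam"
        unfolding ssyts_def
      proof (intro CollectI conjI allI impI)
        show "S \<in> diagram lam \<rightarrow>\<^sub>E UNIV" by (simp add: S)
        fix i j
        show "S (i, j) \<le> S (i, Suc j)" if "(i, Suc j) \<in> diagram lam"
          using that S_in[OF that] S_in[OF diagram_left[OF that]] T(1) by (auto simp: svts_iff)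
        show "S (i, j) < S (Suc i, j)" if "(Suc i, j) \<in> diagram lam"
          using that S_in[OF that] S_in[OF diagram_up[OF that]] T(1) by (auto simp: svts_iff)
      qed
      moreover have "ssyt_monomial lam S = m"
        unfolding T(2)[symmetric] svt_monomial_def ssyt_monomial_def
      proof (rule sum.cong[OF refl])
        fix x assume x: "x \<in> diagram lam"
        then have "T x = {S x}" using single[OF T x] by (simp add: S)
        then show "{#S x#} = mset_set (T x)" by simp
      qed
      ultimately show "S \<in> {T \<in> ssyts lam. ssyt_monomial lam T = m}" by simp
    qed
  qed
  then show ?thesis by (simp add: schur_def K_tilde_def bij_betw_same_card)
qed

lemma schur_empty: "schur lam {#} = (if lam = empty_partition then 1 else 0)"
proof (cases "lam = empty_partition")
  case True
  then show ?thesis by (simp add: schur_eq_K_tilde K_tilde_empty)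
next
  case False
  then show ?thesis using schur_nonzero[of lam "{#}"] by auto
qed

text \<open>Inherited from \<open>K_tilde_step\<close>: in the lowest degree only shapes
  \<open>mu\<close> with exactly \<open>l\<close> boxes fewer contribute, and for these
  \<open>K_count\<close> is 1 on horizontal strips and 0 otherwise.\<close>

lemma schur_step:
  assumes m: "\<And>x. x \<in># m \<Longrightarrow> x < N"
  shows "schur lam (m + replicate_mset l N) =
    (\<Sum>mu | diagram mu \<subseteq> diagram lam.
      if horizontal_strip lam mu \<and> psize lam = psize mu + l then schur mu m else 0)"
proof (cases "size m + l = psize lam")
  case True
  have "schur lam (m + replicate_mset l N) = K_tilde lam (m + replicate_mset l N)"
    by (rule schur_eq_K_tilde) (simp add: True)
  also have "\<dots> = (\<Sum>mu | diagram mu \<subseteq> diagram lam. int (K_count l lam mu) *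
      K_tilde mu m)"
    by (rule K_tilde_step[OF m])
  also have "\<dots> = (\<Sum>mu | diagram mu \<subseteq> diagram lam.
      if horizontal_strip lam mu \<and> psize lam = psize mu + l then schur mu m else 0)"
  proof (rule sum.cong[OF refl])
    fix mu assume "mu \<in> {mu. diagram mu \<subseteq> diagram lam}"
    then have le: "psize mu \<le> psize lam" by (simp add: psize_mono)
    show "int (K_count l lam mu) * K_tilde mu m =
        (if horizontal_strip lam mu \<and> psize lam = psize mu + l then schur mu m else 0)"
    proof (cases "psize lam = psize mu + l")
      case eq: True
      then have "K_tilde mu m = schur mu m" using True by (intro schur_eq_K_tilde[symmetric]) simp
      then show ?thesis using eq by (simp add: K_count_def)
    next
      case False
      have "int (K_count l lam mu) * K_tilde mu m = 0"
        using K_count_nonzeroD(2)[of l lam mu] K_tilde_nonzero[of mu m] False True le by force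
      then show ?thesis using False by simp
    qed
  qed
  finally show ?thesis .
next
  case False
  have "schur lam (m + replicate_mset l N) = 0"
    using schur_nonzero[of lam "m + replicate_mset l N"] False by auto
  moreover have "(if horizontal_strip lam mu \<and> psize lam = psize mu + l then schur mu m else
      0) = 0" for mu
    using schur_nonzero[of mu m] False by (cases "schur mu m = 0") auto
  ultimately show ?thesis by simp
qed

text \<open>In top degree each removed variable must account for as many columns as boxes, so the
  recursion for \<open>dual_groth\<close> sees horizontal strips only and agrees with
  \<open>schur_step\<close>.\<close>

lemma dual_groth_top: "size m = psize lam \<Longrightarrow> dual_groth lam m = schur lam m"
proof (induction m arbitrary: lam rule: mset_max_induct)
  case empty
  then show ?case by (simp add: dual_groth_empty schur_empty)
next
  case (add m N k)
  have "dual_groth lam (m + replicate_mset k N) =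
      (\<Sum>mu | diagram mu \<subseteq> diagram lam. if columns lam mu = k then dual_groth mu m else 0)"
    by (rule dual_groth_step) (rule add.hyps)
  also have "\<dots> = (\<Sum>mu | diagram mu \<subseteq> diagram lam.
      if horizontal_strip lam mu \<and> psize lam = psize mu + k then schur mu m else 0)"
  proof (rule sum.cong[OF refl])
    fix mu assume "mu \<in> {mu. diagram mu \<subseteq> diagram lam}"
    then have sub: "diagram mu \<subseteq> diagram lam" and le: "psize mu \<le> psize lam"
      by (simp_all add: psize_mono)
    show "(if columns lam mu = k then dual_groth mu m else 0) =
        (if horizontal_strip lam mu \<and> psize lam = psize mu + k then schur mu m else 0)"
    proof (cases "psize lam = psize mu + k")
      case True
      then have "columns lam mu = k \<longleftrightarrow> horizontal_strip lam mu" using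
          columns_eq_iff[OF sub] by simp
      moreover have "dual_groth mu m = schur mu m" using True add.prems by (intro add.IH) simp
      ultimately show ?thesis using True by simp
    next
      case False
      have "dual_groth mu m = 0" if "columns lam mu = k"
        using that columns_le[OF sub] dual_groth_nonzero[of mu m] False add.prems le by force
      then show ?thesis using False by auto
    qed
  qed
  also have "\<dots> = schur lam (m + replicate_mset k N)"
    by (rule schur_step[symmetric]) (rule add.hyps)
  finally show ?case .
qed

section \<open>Sums over submultisets\<close>

lemma finite_submultisets [simp]: "finite {a. a \<subseteq># m}"
proof (rule finite_subset)
  show "{a. a \<subseteq># m} \<subseteq> (\<Union>k\<le>size m. multisets_of_size (set_mset m) k)"
    by (auto simp: multisets_of_size_def size_mset_mono dest: mset_subset_eqD)
qed auto

lemma finite_submultisets' [simp]: "finite {a. a \<subseteq># m \<and> P a}"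
  by (rule finite_subset[OF _ finite_submultisets[of m]]) auto

lemma filter_mset_empty_conv: "filter_mset P M = {#} \<longleftrightarrow> (\<forall>x\<in>#M.
    \<not> P x)"
  by (induction M) auto

lemma complement_complement: "a \<subseteq># m \<Longrightarrow> m - (m - a) = a"
  by (simp add: multiset_eq_iff subseteq_mset_def)

lemma sum_submultisets_complement:
  "(\<Sum>a | a \<subseteq># m. f a (m - a)) = (\<Sum>a | a \<subseteq># m. f (m - a) a)"
  by (rule sum.reindex_bij_witness[of _ "\<lambda>a. m - a" "\<lambda>a. m - a"])
    (auto simp: complement_complement)

text \<open>When the variables are disjoint, a divisor of a product of two monomials is in a unique
  way a product of divisors.\<close>

lemma sum_submultisets_union:
  assumes disj: "set_mset m1 \<inter> set_mset m2 = {}"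
  shows "(\<Sum>a | a \<subseteq># m1 + m2. f a) = (\<Sum>a | a \<subseteq># m1. \<Sum>b | b
      \<subseteq># m2. f (a + b))"
proof -
  have in1: "filter_mset (\<lambda>x. x \<in># m1) a = a" "filter_mset (\<lambda>x. x \<notin># m1)
      a = {#}" if "a \<subseteq># m1" for a
    using set_mset_mono[OF that] by (auto simp: filter_mset_eq_conv filter_mset_empty_conv)
  have in2: "filter_mset (\<lambda>x. x \<in># m1) b = {#}" "filter_mset (\<lambda>x. x \<notin>#
      m1) b = b" if "b \<subseteq># m2" for b
    using set_mset_mono[OF that] disj by (auto simp: filter_mset_eq_conv filter_mset_empty_conv)
  have "(\<Sum>a | a \<subseteq># m1 + m2. f a) = (\<Sum>(a, b)\<in>{a. a \<subseteq># m1} \<times>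
      {b. b \<subseteq># m2}. f (a + b))"
  proof (rule sum.reindex_bij_witness[of _ "\<lambda>(a, b). a + b"
        "\<lambda>c. (filter_mset (\<lambda>x. x \<in># m1) c, filter_mset (\<lambda>x. x \<notin>#
            m1) c)"])
    fix c assume "c \<in> {c. c \<subseteq># m1 + m2}"
    then have c: "c \<subseteq># m1 + m2" by simp
    show "(case (filter_mset (\<lambda>x. x \<in># m1) c, filter_mset (\<lambda>x. x \<notin># m1)
        c) of (a, b) \<Rightarrow> a + b) = c"
      using multiset_partition[of c "\<lambda>x. x \<in># m1"] by simp
    then show "(case (filter_mset (\<lambda>x. x \<in># m1) c, filter_mset (\<lambda>x. x \<notin>#
        m1) c) of (a, b) \<Rightarrow> f (a + b)) = f c"
      by simp
    show "(filter_mset (\<lambda>x. x \<in># m1) c, filter_mset (\<lambda>x. x \<notin># m1) c)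
        \<in> {a. a \<subseteq># m1} \<times> {b. b \<subseteq># m2}"
      using multiset_filter_mono[OF c, of "\<lambda>x. x \<in># m1"] multiset_filter_mono[OF c, of
          "\<lambda>x. x \<notin># m1"]
      by (simp add: in1 in2)
  next
    fix p assume p: "p \<in> {a. a \<subseteq># m1} \<times> {b. b \<subseteq># m2}"
    then show "(filter_mset (\<lambda>x. x \<in># m1) (case p of (a, b) \<Rightarrow> a + b),
        filter_mset (\<lambda>x. x \<notin># m1) (case p of (a, b) \<Rightarrow> a + b)) = p"
      by (auto simp: in1 in2)
    show "(case p of (a, b) \<Rightarrow> a + b) \<in> {c. c \<subseteq># m1 + m2}"
      using p by (auto intro: subset_mset.add_mono)
  qed
  then show ?thesis by (simp add: sum.cartesian_product)
qed

lemma sum_submultisets_replicate: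
  "(\<Sum>a | a \<subseteq># replicate_mset l N. f a) = (\<Sum>j\<le>l. f (replicate_mset j N))"
proof (rule sum.reindex_bij_witness[of _ "\<lambda>j. replicate_mset j N" size])
  fix a assume "a \<in> {a. a \<subseteq># replicate_mset l N}"
  then have "a \<subseteq># replicate_mset l N" by simp
  then obtain j where "j \<le> l" "a = replicate_mset j N" by (rule msubseteq_replicate_msetE)
  then show "replicate_mset (size a) N = a" "size a \<in> {..l}" "f (replicate_mset (size a) N) = f a"
    by simp_all
next
  fix j assume "j \<in> {..l}"
  then show "replicate_mset j N \<in> {a. a \<subseteq># replicate_mset l N}"
    by (auto intro!: mset_subset_eqI)
qed simp

lemma inv_image_mset:
  assumes "inj_on \<sigma> (set_mset m)" "a \<subseteq># m"
  shows "image_mset (inv_into (set_mset m) \<sigma>) (image_mset \<sigma> a) = a"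
proof -
  have "image_mset (inv_into (set_mset m) \<sigma>) (image_mset \<sigma> a) = image_mset
      (\<lambda>x. x) a"
    unfolding multiset.map_comp
    by (rule image_mset_cong) (use assms set_mset_mono[OF assms(2)] in auto)
  then show ?thesis by simp
qed

lemma sum_submultisets_image:
  assumes inj: "inj_on \<sigma> (set_mset m)"
  shows "(\<Sum>a | a \<subseteq># image_mset \<sigma> m. f a) = (\<Sum>b | b \<subseteq># m. f
      (image_mset \<sigma> b))"
proof (rule sum.reindex_bij_witness[of _ "image_mset \<sigma>" "image_mset (inv_into (set_mset m)
    \<sigma>)"])
  fix a assume "a \<in> {a. a \<subseteq># image_mset \<sigma> m}"
  then have a: "a \<subseteq># image_mset \<sigma> m" by simp
  have "image_mset (inv_into (set_mset m) \<sigma>) a \<subseteq># image_mset (inv_into (set_mset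
      m) \<sigma>) (image_mset \<sigma> m)"
    using a by (rule image_mset_subseteq_mono)
  then show "image_mset (inv_into (set_mset m) \<sigma>) a \<in> {b. b \<subseteq># m}"
    using inv_image_mset[OF inj, of m] by simp
  have "image_mset \<sigma> (image_mset (inv_into (set_mset m) \<sigma>) a) = image_mset
      (\<lambda>x. x) a"
    unfolding multiset.map_comp
    by (rule image_mset_cong) (use set_mset_mono[OF a] in \<open>auto simp: f_inv_into_f\<close>)
  then show *: "image_mset \<sigma> (image_mset (inv_into (set_mset m) \<sigma>) a) = a" by simp
  then show "f (image_mset \<sigma> (image_mset (inv_into (set_mset m) \<sigma>) a)) = f a" by simp
qed (use inv_image_mset[OF inj] in \<open>auto intro: image_mset_subseteq_mono\<close>)

section \<open>The Cauchy kernel\<close>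

text \<open>The coefficient of \<open>x\<^sup>n y\<^sup>m\<close> in the product of all \<open>1 /
    (1 - x\<^sub>i y\<^sub>j)\<close>.\<close>

definition contingency :: "monomial \<Rightarrow> monomial \<Rightarrow> (nat \<times> nat)
    multiset set" where
  "contingency n m = {M. image_mset fst M = n \<and> image_mset snd M = m}"

definition kernel :: "monomial \<Rightarrow> monomial \<Rightarrow> int" where
  "kernel n m = int (card (contingency n m))"

lemma finite_contingency [simp]: "finite (contingency n m)"
proof (rule finite_subset)
  show "contingency n m \<subseteq> multisets_of_size (set_mset n \<times> set_mset m) (size n)"
    by (force simp: contingency_def multisets_of_size_def)
qed auto

lemma kernel_size: "size n \<noteq> size m \<Longrightarrow> kernel n m = 0"
proof -
  assume "size n \<noteq> size m"
  then have "contingency n m = {}" by (auto simp: contingency_def)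
  then show ?thesis by (simp add: kernel_def)
qed

lemma kernel_empty: "kernel {#} m = (if m = {#} then 1 else 0)"
proof -
  have "contingency {#} m = (if m = {#} then {{#}} else {})" by (auto simp: contingency_def)
  then show ?thesis by (simp add: kernel_def)
qed

text \<open>For a single variable x the kernel is the generating function of the complete symmetric
  functions, in which every monomial has coefficient 1.\<close>

lemma kernel_replicate: "kernel (replicate_mset k N) a = (if size a = k then 1 else 0)"
proof (cases "size a = k")
  case True
  have "M = image_mset (Pair N) (image_mset snd M)" if "image_mset fst M = replicate_mset k N" for
      M :: "(nat \<times> nat) multiset"
  proof -
    have "fst p = N" if "p \<in># M" for p
    proof -
      have "fst p \<in># image_mset fst M" using that by auto
      then show ?thesis using \<open>image_mset fst M = replicate_mset k N\<close> by (auto split: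
          if_splits)
    qed
    then have "image_mset (\<lambda>p. (N, snd p)) M = image_mset (\<lambda>p. p) M"
      by (intro image_mset_cong) (auto simp: prod_eq_iff)
    then show ?thesis by (simp add: multiset.map_comp comp_def)
  qed
  then have "contingency (replicate_mset k N) a = {image_mset (Pair N) a}"
    using True by (auto simp: contingency_def multiset.map_comp comp_def image_mset_const_eq)
  then show ?thesis using True by (simp add: kernel_def)
next
  case False
  then show ?thesis using kernel_size[of "replicate_mset k N" a] by simp
qed

text \<open>Renaming the second components of the pairs is a bijection of tables. This is the source
  of all symmetry statements below.\<close>

lemma kernel_image:
  assumes inj: "inj_on \<sigma> (set_mset m)"
  shows "kernel n (image_mset \<sigma> m) = kernel n m"
proof -
  let ?g = "inv_into (set_mset m) \<sigma>"
  have "bij_betw (image_mset (map_prod id \<sigma>)) (contingency n m) (contingency n (image_mset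
      \<sigma> m))"
  proof (rule bij_betw_byWitness[where f' = "image_mset (map_prod id ?g)"])
    show "\<forall>M\<in>contingency n m. image_mset (map_prod id ?g) (image_mset (map_prod id
        \<sigma>) M) = M"
    proof
      fix M assume "M \<in> contingency n m"
      then have M: "image_mset snd M = m" by (simp add: contingency_def)
      have "image_mset (map_prod id ?g \<circ> map_prod id \<sigma>) M = image_mset (\<lambda>p. p) M"
      proof (rule image_mset_cong)
        fix p assume "p \<in># M"
        then have "snd p \<in># m" using M by auto
        then show "(map_prod id ?g \<circ> map_prod id \<sigma>) p = p"
          using inj by (cases p) simp
      qed
      then show "image_mset (map_prod id ?g) (image_mset (map_prod id \<sigma>) M) = M"
        by (simp add: multiset.map_comp)
    qed
    show "\<forall>M\<in>contingency n (image_mset \<sigma> m). image_mset (map_prod id \<sigma>)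
        (image_mset (map_prod id ?g) M) = M"
    proof
      fix M assume "M \<in> contingency n (image_mset \<sigma> m)"
      then have M: "image_mset snd M = image_mset \<sigma> m" by (simp add: contingency_def)
      have "image_mset (map_prod id \<sigma> \<circ> map_prod id ?g) M = image_mset (\<lambda>p. p) M"
      proof (rule image_mset_cong)
        fix p assume "p \<in># M"
        then have "snd p \<in># image_mset snd M" by auto
        then have "snd p \<in> \<sigma> ` set_mset m" using M by auto
        then show "(map_prod id \<sigma> \<circ> map_prod id ?g) p = p"
          by (cases p) (simp add: f_inv_into_f)
      qed
      then show "image_mset (map_prod id \<sigma>) (image_mset (map_prod id ?g) M) = M"
        by (simp add: multiset.map_comp)
    qed
    show "image_mset (map_prod id \<sigma>) ` contingency n m \<subseteq> contingency n (image_mset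
        \<sigma> m)"
      by (auto simp: contingency_def multiset.map_comp comp_def)
    show "image_mset (map_prod id ?g) ` contingency n (image_mset \<sigma> m) \<subseteq>
        contingency n m"
    proof
      fix M' assume "M' \<in> image_mset (map_prod id ?g) ` contingency n (image_mset \<sigma> m)"
      then obtain M where M: "image_mset fst M = n" "image_mset snd M = image_mset \<sigma> m"
        and M': "M' = image_mset (map_prod id ?g) M" by (auto simp: contingency_def)
      have "image_mset snd M' = image_mset ?g (image_mset snd M)"
        by (simp add: M' multiset.map_comp comp_def)
      also have "\<dots> = m" unfolding M(2) by (rule inv_image_mset[OF inj]) simp
      finally show "M' \<in> contingency n m"
        using M(1) by (simp add: contingency_def M' multiset.map_comp comp_def)
    qed
  qed
  then show ?thesis by (simp add: kernel_def bij_betw_same_card)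
qed

lemma kernel_commute: "kernel n m = kernel m n"
proof -
  have "bij_betw (image_mset prod.swap) (contingency n m) (contingency m n)"
    by (rule bij_betw_byWitness[where f' = "image_mset prod.swap"])
      (auto simp: contingency_def multiset.map_comp comp_def)
  then show ?thesis by (simp add: kernel_def bij_betw_same_card)
qed

text \<open>A table splits by whether the first component of a pair lies in \<open>n1\<close> or in
  \<open>n2\<close>: over two disjoint sets of x variables the kernel is the product of two
  kernels.\<close>

lemma kernel_add:
  assumes disj: "set_mset n1 \<inter> set_mset n2 = {}"
  shows "kernel (n1 + n2) m = (\<Sum>a | a \<subseteq># m. kernel n1 a * kernel n2 (m - a))"
proof -
  let ?in1 = "\<lambda>p :: nat \<times> nat. fst p \<in># n1"
  have in1: "filter_mset ?in1 M = M" "filter_mset (\<lambda>p. \<not> ?in1 p) M = {#}" if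
      "image_mset fst M = n1" for M :: "(nat \<times> nat) multiset"
  proof -
    have "\<forall>p\<in>#M. fst p \<in># n1" unfolding that[symmetric] by simp
    then show "filter_mset ?in1 M = M" "filter_mset (\<lambda>p. \<not> ?in1 p) M = {#}"
      by (simp_all add: filter_mset_eq_conv filter_mset_empty_conv)
  qed
  have in2: "filter_mset ?in1 M = {#}" "filter_mset (\<lambda>p. \<not> ?in1 p) M = M" if
      "image_mset fst M = n2" for M :: "(nat \<times> nat) multiset"
  proof -
    have "\<forall>p\<in>#M. fst p \<in># n2" unfolding that[symmetric] by simp
    then have "\<forall>p\<in>#M. fst p \<notin># n1" using disj by blast
    then show "filter_mset ?in1 M = {#}" "filter_mset (\<lambda>p. \<not> ?in1 p) M = M"
      by (simp_all add: filter_mset_eq_conv filter_mset_empty_conv)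
  qed
  let ?S = "SIGMA a:{a. a \<subseteq># m}. contingency n1 a \<times> contingency n2 (m - a)"
  have "bij_betw (\<lambda>M. (image_mset snd (filter_mset ?in1 M), filter_mset ?in1 M, filter_mset
      (\<lambda>p. \<not> ?in1 p) M))
    (contingency (n1 + n2) m) ?S"
  proof (rule bij_betw_byWitness[where f' = "\<lambda>(a, M1, M2). M1 + M2"])
    show "\<forall>M\<in>contingency (n1 + n2) m. (\<lambda>(a, M1, M2). M1 + M2)
        (image_mset snd (filter_mset ?in1 M), filter_mset ?in1 M, filter_mset (\<lambda>p. \<not>
            ?in1 p) M) = M"
      using multiset_partition[where P = ?in1] by simp
    show "\<forall>t\<in>?S. (\<lambda>M. (image_mset snd (filter_mset ?in1 M), filter_mset ?in1 M,
        filter_mset (\<lambda>p. \<not> ?in1 p) M))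
        ((\<lambda>(a, M1, M2). M1 + M2) t) = t"
      by (auto simp: contingency_def in1 in2)
    show "(\<lambda>M. (image_mset snd (filter_mset ?in1 M), filter_mset ?in1 M, filter_mset
        (\<lambda>p. \<not> ?in1 p) M)) `
        contingency (n1 + n2) m \<subseteq> ?S"
    proof
      fix t assume "t \<in> (\<lambda>M. (image_mset snd (filter_mset ?in1 M), filter_mset ?in1 M,
          filter_mset (\<lambda>p. \<not> ?in1 p) M)) `
        contingency (n1 + n2) m"
      then obtain M where M: "image_mset fst M = n1 + n2" "image_mset snd M = m"
        and t: "t = (image_mset snd (filter_mset ?in1 M), filter_mset ?in1 M, filter_mset
            (\<lambda>p. \<not> ?in1 p) M)"
        by (auto simp: contingency_def)
      have split: "m = image_mset snd (filter_mset ?in1 M) + image_mset snd (filter_mset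
          (\<lambda>p. \<not> ?in1 p) M)"
        unfolding M(2)[symmetric] image_mset_union[symmetric] multiset_partition[of M ?in1, symmetric] ..
      have "image_mset fst (filter_mset ?in1 M) = filter_mset (\<lambda>x. x \<in># n1) (n1 + n2)"
        unfolding M(1)[symmetric] by (simp add: filter_mset_image_mset)
      moreover have "\<dots> = n1 + {#}" unfolding filter_union_mset
        by (rule arg_cong2[where f = "(+)"]) (use disj in \<open>auto simp: filter_mset_eq_conv
            filter_mset_empty_conv\<close>)
      moreover have "image_mset fst (filter_mset (\<lambda>p. \<not> ?in1 p) M) = filter_mset
          (\<lambda>x. x \<notin># n1) (n1 + n2)"
        unfolding M(1)[symmetric] by (simp add: filter_mset_image_mset)
      moreover have "\<dots> = {#} + n2" unfolding filter_union_mset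
        by (rule arg_cong2[where f = "(+)"]) (use disj in \<open>auto simp: filter_mset_eq_conv
            filter_mset_empty_conv\<close>)
      ultimately show "t \<in> ?S" using split by (simp add: t contingency_def)
    qed
    show "(\<lambda>(a, M1, M2). M1 + M2) ` ?S \<subseteq> contingency (n1 + n2) m"
      by (auto simp: contingency_def subset_mset.add_diff_inverse)
  qed
  then have "card (contingency (n1 + n2) m) = card ?S" by (rule bij_betw_same_card)
  also have "\<dots> = (\<Sum>a | a \<subseteq># m. card (contingency n1 a \<times> contingency n2
      (m - a)))"
    by (rule card_SigmaI) auto
  finally show ?thesis by (simp add: kernel_def card_cartesian_product)
qed

section \<open>Pieri rule and Cauchy identity\<close>

lemma groth_eq: "groth lam m = (- 1) ^ (size m - psize lam) * K_tilde lam m"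
proof -
  have "groth lam m = (\<Sum>T | T \<in> svts lam \<and> svt_monomial lam T = m. (- 1) ^ (size m -
      psize lam))"
    unfolding groth_def by (rule sum.cong) auto
  then show ?thesis by (simp add: K_tilde_def)
qed

lemma groth_nonzero: "groth lam m \<noteq> 0 \<Longrightarrow> psize lam \<le> size m"
  using K_tilde_nonzero[of lam m] by (simp add: groth_eq)

lemma groth_bottom: "size m = psize lam \<Longrightarrow> groth lam m = schur lam m"
  by (simp add: groth_eq schur_eq_K_tilde)

text \<open>The sign of a tableau is the sign of the smaller tableau times -1 for every free corner
  that also holds the largest entry.\<close>

lemma groth_step:
  assumes "\<And>x. x \<in># m \<Longrightarrow> x < N"
  shows "groth lam (m + replicate_mset l N) =
    (\<Sum>mu | diagram mu \<subseteq> diagram lam. groth_coeff l lam mu * groth mu m)"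
proof -
  have "groth lam (m + replicate_mset l N) = (\<Sum>mu | diagram mu \<subseteq> diagram lam.
      (- 1) ^ (size m + l - psize lam) * (int (K_count l lam mu) * K_tilde mu m))"
    unfolding groth_eq by (subst K_tilde_step) (use assms in \<open>auto simp: sum_distrib_left\<close>)
  also have "\<dots> = (\<Sum>mu | diagram mu \<subseteq> diagram lam. groth_coeff l lam mu * groth
      mu m)"
  proof (rule sum.cong[OF refl])
    fix mu assume "mu \<in> {mu. diagram mu \<subseteq> diagram lam}"
    then have le: "psize mu \<le> psize lam" by (simp add: psize_mono)
    show "(- 1) ^ (size m + l - psize lam) * (int (K_count l lam mu) * K_tilde mu m) =
        groth_coeff l lam mu * groth mu m"
    proof (cases "K_count l lam mu = 0 \<or> K_tilde mu m = 0")
      case True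
      then show ?thesis by (auto simp: groth_eq groth_coeff_def K_count_def split: if_splits)
    next
      case False
      then have *: "horizontal_strip lam mu" "psize lam - psize mu \<le> l" "psize mu \<le> size m"
        using K_count_nonzeroD[of l lam mu] K_tilde_nonzero[of mu m] by auto
      then have "size m + l - psize lam = (l - (psize lam - psize mu)) + (size m - psize mu)"
        using le by simp
      then have pow: "(- 1 :: int) ^ (size m + l - psize lam) =
          (- 1) ^ (l - (psize lam - psize mu)) * (- 1) ^ (size m - psize mu)"
        by (simp only: power_add)
      have "groth_coeff l lam mu = (- 1) ^ (l - (psize lam - psize mu)) * int (K_count l lam mu)"
        using * by (simp add: groth_coeff_def K_count_def)
      then show ?thesis unfolding pow groth_eq by (simp only: mult_ac)
    qed
  qed
  finally show ?thesis .
qed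

lemma groth_empty_partition: "groth empty_partition m = (if m = {#} then 1 else 0)"
proof (cases "m = {#}")
  case True
  then show ?thesis by (simp add: groth_eq K_tilde_empty)
next
  case False
  then have "{T \<in> svts empty_partition. svt_monomial empty_partition T = m} = {}"
    by (auto simp: svt_monomial_def)
  then have "K_tilde empty_partition m = 0" unfolding K_tilde_def by (simp only: card.empty of_nat_0)
  then show ?thesis using False by (simp add: groth_eq)
qed

text \<open>The right-hand side is the coefficient of \<open>m\<close> in h_k times
  \<open>groth mu\<close>, with h_k the complete symmetric function. Splitting off the largest
  variable of \<open>m\<close> and commuting leaves the same statement for fewer variables; the
  index \<open>j\<close> is the number of copies of that variable taken by h_k. \<open>F\<close>
  only has to be finite and to contain all shapes that contribute.\<close>

lemma groth_Pieri:
  assumes "finite F" "{nu. psize nu \<le> size m} \<subseteq> F"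
  shows "(\<Sum>nu\<in>F. if diagram mu \<subseteq> diagram nu \<and> columns nu mu = k then groth
      nu m else 0) =
    (\<Sum>a | a \<subseteq># m. if size a = k then groth mu (m - a) else 0)"
  using assms
proof (induction m arbitrary: k mu F rule: mset_max_induct)
  case empty
  have "(\<Sum>nu\<in>F. if diagram mu \<subseteq> diagram nu \<and> columns nu mu = k then groth
      nu {#} else 0) =
      (\<Sum>nu\<in>{empty_partition}. if diagram mu \<subseteq> diagram nu \<and> columns nu mu =
          k then groth nu {#} else 0)"
    by (rule sum.mono_neutral_right) (use empty in \<open>auto simp: groth_eq K_tilde_empty\<close>)
  moreover have "{a. a \<subseteq># {#}} = {{#} :: monomial}" by auto
  then have "(\<Sum>a | a \<subseteq># {#}. if size a = k then groth mu ({#} - a) else 0) = (if k =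
      0 then groth mu {#} else 0)"
    by (simp only:) simp
  ultimately show ?case by (auto simp: groth_eq K_tilde_empty columns_def)
next
  case (add m N l)
  \<comment> \<open>An index set independent of \<open>nu\<close>, so that the sums over
    \<open>nu\<close> and \<open>lam\<close> can be interchanged.\<close>
  define F0 where "F0 = {lam. psize lam \<le> size m}"
  have F0: "finite F0" by (simp add: F0_def finite_psize_le)
  have N: "N \<notin># m" using add.hyps by blast
  define P where "P = (\<lambda>nu. diagram mu \<subseteq> diagram nu \<and> columns nu mu = k)"
  have step: "groth nu (m + replicate_mset l N) = (\<Sum>lam\<in>F0. groth_coeff l nu lam * groth
      lam m)" for nu
  proof -
    have "groth nu (m + replicate_mset l N) =
        (\<Sum>lam | diagram lam \<subseteq> diagram nu. groth_coeff l nu lam * groth lam m)"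
      by (rule groth_step) (rule add.hyps)
    also have "\<dots> = (\<Sum>lam\<in>{lam. diagram lam \<subseteq> diagram nu} \<union> F0.
        groth_coeff l nu lam * groth lam m)"
      by (rule sum.mono_neutral_left) (use F0 groth_coeff_nonzeroD(2)[of l nu] in auto)
    also have "\<dots> = (\<Sum>lam\<in>F0. groth_coeff l nu lam * groth lam m)"
      by (rule sum.mono_neutral_right) (use F0 groth_nonzero[of _ m] in \<open>auto simp: F0_def\<close>)
    finally show ?thesis .
  qed
  have "(\<Sum>nu\<in>F. if P nu then groth nu (m + replicate_mset l N) else 0) =
      (\<Sum>nu\<in>F. \<Sum>lam\<in>F0. groth lam m * (if P nu then groth_coeff l nu lam else 0))"
    unfolding step by (rule sum.cong) (auto simp: mult.commute)
  also have "\<dots> = (\<Sum>lam\<in>F0. groth lam m * (\<Sum>nu\<in>F. if P nu then groth_coeff l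
      nu lam else 0))"
    by (subst sum.swap) (simp add: sum_distrib_left)
  also have "\<dots> = (\<Sum>lam\<in>F0. groth lam m * (\<Sum>j\<le>l. \<Sum>ka | diagram ka
      \<subseteq> diagram mu.
      if j \<le> k \<and> diagram ka \<subseteq> diagram lam \<and> columns lam ka = k - j then
          groth_coeff (l - j) mu ka else 0))"
  proof (rule sum.cong[OF refl])
    fix lam assume lam: "lam \<in> F0"
    have "(\<Sum>nu\<in>F. if P nu then groth_coeff l nu lam else 0) =
      (\<Sum>j\<le>min k l. \<Sum>ka | diagram ka \<subseteq> diagram lam.
        if columns lam ka = k - j then groth_coeff (l - j) mu ka else 0)"
      unfolding P_def
      by (rule groth_coeff_commute) (use add.prems lam in \<open>auto simp: F0_def\<close>)
    also have "\<dots> = (\<Sum>j\<le>min k l. \<Sum>ka | diagram ka \<subseteq> diagram mu.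
        if j \<le> k \<and> diagram ka \<subseteq> diagram lam \<and> columns lam ka = k - j then
            groth_coeff (l - j) mu ka else 0)"
    proof (rule sum.cong[OF refl])
      fix j assume j: "j \<in> {..min k l}"
      show "(\<Sum>ka | diagram ka \<subseteq> diagram lam. if columns lam ka = k - j then
          groth_coeff (l - j) mu ka else 0) =
        (\<Sum>ka | diagram ka \<subseteq> diagram mu.
          if j \<le> k \<and> diagram ka \<subseteq> diagram lam \<and> columns lam ka = k - j then
              groth_coeff (l - j) mu ka else 0)"
        using j groth_coeff_nonzeroD(2)[of "l - j" mu]
        by (intro sum.mono_neutral_cong) auto
    qed
    also have "\<dots> = (\<Sum>j\<le>l. \<Sum>ka | diagram ka \<subseteq> diagram mu.
        if j \<le> k \<and> diagram ka \<subseteq> diagram lam \<and> columns lam ka = k - j then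
            groth_coeff (l - j) mu ka else 0)"
      by (rule sum.mono_neutral_left) (auto intro!: sum.neutral)
    finally show "groth lam m * (\<Sum>nu\<in>F. if P nu then groth_coeff l nu lam else 0) =
      groth lam m * (\<Sum>j\<le>l. \<Sum>ka | diagram ka \<subseteq> diagram mu.
        if j \<le> k \<and> diagram ka \<subseteq> diagram lam \<and> columns lam ka = k - j then
            groth_coeff (l - j) mu ka else 0)"
      by simp
  qed
  also have "\<dots> = (\<Sum>lam\<in>F0. \<Sum>j\<le>l. \<Sum>ka | diagram ka \<subseteq> diagram mu.
      (if j \<le> k then groth_coeff (l - j) mu ka else 0) *
      (if diagram ka \<subseteq> diagram lam \<and> columns lam ka = k - j then groth lam m else 0))"
    by (simp add: sum_distrib_left mult.commute if_distrib[of "\<lambda>x. _ * x"] cong: if_cong)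
        (intro sum.cong refl, auto)
  also have "\<dots> = (\<Sum>j\<le>l. \<Sum>lam\<in>F0. \<Sum>ka | diagram ka \<subseteq> diagram mu.
      (if j \<le> k then groth_coeff (l - j) mu ka else 0) *
      (if diagram ka \<subseteq> diagram lam \<and> columns lam ka = k - j then groth lam m else 0))"
    by (rule sum.swap)
  also have "\<dots> = (\<Sum>j\<le>l. \<Sum>ka | diagram ka \<subseteq> diagram mu.
      (if j \<le> k then groth_coeff (l - j) mu ka else 0) *
      (\<Sum>lam\<in>F0. if diagram ka \<subseteq> diagram lam \<and> columns lam ka = k - j then
          groth lam m else 0))"
    by (rule sum.cong[OF refl], subst sum.swap) (simp add: sum_distrib_left)
  also have "\<dots> = (\<Sum>j\<le>l. \<Sum>ka | diagram ka \<subseteq> diagram mu.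
      (if j \<le> k then groth_coeff (l - j) mu ka else 0) *
      (\<Sum>a | a \<subseteq># m. if size a = k - j then groth ka (m - a) else 0))"
    by (intro sum.cong refl arg_cong2[where f = times] add.IH) (use F0 in \<open>auto simp:
        F0_def\<close>)
  also have "\<dots> = (\<Sum>j\<le>l. \<Sum>a | a \<subseteq># m. \<Sum>ka | diagram ka
      \<subseteq> diagram mu.
      if size a + j = k then groth_coeff (l - j) mu ka * groth ka (m - a) else 0)"
    by (subst (2) sum.swap) (simp add: sum_distrib_left, intro sum.cong refl, auto)
  also have "\<dots> = (\<Sum>j\<le>l. \<Sum>a | a \<subseteq># m.
      if size a + j = k then groth mu (m - a + replicate_mset (l - j) N) else 0)"
  proof (intro sum.cong refl)
    fix a assume "a \<in> {a. a \<subseteq># m}"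
    have "x < N" if "x \<in># m - a" for x using that add.hyps in_diffD by fast
    then show "(\<Sum>ka | diagram ka \<subseteq> diagram mu.
        if size a + j = k then groth_coeff (l - j) mu ka * groth ka (m - a) else 0) =
      (if size a + j = k then groth mu (m - a + replicate_mset (l - j) N) else 0)" for j
      by (simp add: groth_step)
  qed
  also have "\<dots> = (\<Sum>a | a \<subseteq># m. \<Sum>j\<le>l.
      if size a + j = k then groth mu (m - a + replicate_mset (l - j) N) else 0)"
    by (rule sum.swap)
  also have "\<dots> = (\<Sum>a | a \<subseteq># m. \<Sum>j\<le>l.
      if size (a + replicate_mset j N) = k then groth mu (m + replicate_mset l N - (a +
          replicate_mset j N)) else 0)"
  proof (intro sum.cong refl)
    fix a j assume a: "a \<in> {a. a \<subseteq># m}" and j: "j \<in> {..l}"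
    have "m - a + replicate_mset (l - j) N = m + replicate_mset l N - (a + replicate_mset j N)"
      using a j N by (auto simp: multiset_eq_iff not_in_iff subseteq_mset_def)
    then show "(if size a + j = k then groth mu (m - a + replicate_mset (l - j) N) else 0) =
      (if size (a + replicate_mset j N) = k then groth mu (m + replicate_mset l N - (a +
          replicate_mset j N)) else 0)"
      by simp
  qed
  also have "\<dots> = (\<Sum>c | c \<subseteq># m + replicate_mset l N.
      if size c = k then groth mu (m + replicate_mset l N - c) else 0)"
    by (subst sum_submultisets_union) (use N in \<open>auto simp: sum_submultisets_replicate\<close>)
  finally show ?case by (simp add: P_def)
qed

text \<open>Splitting the largest variable off \<open>dual_groth\<close> leaves exactly the sum in
  the Pieri rule, and multiplication by h_k is the coefficient of the k-th power of that variable in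
  its part of the kernel.\<close>

lemma Cauchy_identity:
  assumes "finite F" "{nu. psize nu \<le> size m} \<subseteq> F"
  shows "(\<Sum>nu\<in>F. dual_groth nu n * groth nu m) = kernel n m"
  using assms
proof (induction n arbitrary: m rule: mset_max_induct)
  case empty
  have "(\<Sum>nu\<in>F. dual_groth nu {#} * groth nu m) = (\<Sum>nu\<in>{empty_partition}.
      dual_groth nu {#} * groth nu m)"
    by (rule sum.mono_neutral_right) (use empty in \<open>auto simp: dual_groth_empty\<close>)
  then show ?case by (simp add: dual_groth_empty kernel_empty groth_empty_partition)
next
  case (add n N k)
  have N: "N \<notin># n" using add.hyps by blast
  \<comment> \<open>The smaller shapes \<open>mu\<close> need not lie in \<open>F\<close>; those
    outside it are dropped again later, since their \<open>groth\<close> factors vanish at divisors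
    of \<open>m\<close>.\<close>
  define F' where "F' = F \<union> (\<Union>nu\<in>F. {mu. diagram mu \<subseteq> diagram nu})"
  have F': "finite F'" "F \<subseteq> F'" using add.prems by (auto simp: F'_def)
  have "(\<Sum>nu\<in>F. dual_groth nu (n + replicate_mset k N) * groth nu m) =
      (\<Sum>nu\<in>F. \<Sum>mu\<in>F'. dual_groth mu n *
        (if diagram mu \<subseteq> diagram nu \<and> columns nu mu = k then groth nu m else 0))"
  proof (rule sum.cong[OF refl])
    fix nu assume nu: "nu \<in> F"
    have "dual_groth nu (n + replicate_mset k N) * groth nu m = (\<Sum>mu | diagram mu \<subseteq>
        diagram nu.
        (if columns nu mu = k then dual_groth mu n else 0) * groth nu m)"
      by (subst dual_groth_step) (use add.hyps in \<open>auto simp: sum_distrib_right\<close>)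
    also have "\<dots> = (\<Sum>mu\<in>F'. dual_groth mu n *
        (if diagram mu \<subseteq> diagram nu \<and> columns nu mu = k then groth nu m else 0))"
      by (rule sum.mono_neutral_cong_left) (use F' nu in \<open>auto simp: F'_def\<close>)
    finally show "dual_groth nu (n + replicate_mset k N) * groth nu m = (\<Sum>mu\<in>F'.
        dual_groth mu n *
        (if diagram mu \<subseteq> diagram nu \<and> columns nu mu = k then groth nu m else 0))" .
  qed
  also have "\<dots> = (\<Sum>mu\<in>F'. dual_groth mu n *
      (\<Sum>nu\<in>F. if diagram mu \<subseteq> diagram nu \<and> columns nu mu = k then groth nu
          m else 0))"
    by (subst sum.swap) (simp add: sum_distrib_left)
  also have "\<dots> = (\<Sum>mu\<in>F'. dual_groth mu n *
      (\<Sum>a | a \<subseteq># m. if size a = k then groth mu (m - a) else 0))"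
    by (simp only: groth_Pieri[OF add.prems])
  also have "\<dots> = (\<Sum>a | a \<subseteq># m. if size a = k then (\<Sum>mu\<in>F'. dual_groth
      mu n * groth mu (m - a)) else 0)"
    unfolding sum_distrib_left by (subst sum.swap) (intro sum.cong refl, auto)
  also have "\<dots> = (\<Sum>a | a \<subseteq># m. if size a = k then kernel n (m - a) else 0)"
  proof (intro sum.cong refl if_cong)
    fix a assume "a \<in> {a. a \<subseteq># m}"
    have "(\<Sum>mu\<in>F'. dual_groth mu n * groth mu (m - a)) = (\<Sum>mu\<in>F. dual_groth mu n
        * groth mu (m - a))"
    proof (rule sum.mono_neutral_right)
      show "\<forall>i\<in>F' - F. dual_groth i n * groth i (m - a) = 0"
      proof
        fix i assume "i \<in> F' - F"
        then have "\<not> psize i \<le> size m" using add.prems by auto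
        then have "groth i (m - a) = 0"
          using groth_nonzero[of i "m - a"] size_mset_mono[OF diff_subset_eq_self[of m a]] by linarith
        then show "dual_groth i n * groth i (m - a) = 0" by simp
      qed
    qed (use F' in auto)
    also have "\<dots> = kernel n (m - a)"
    proof (rule add.IH)
      show "{nu. psize nu \<le> size (m - a)} \<subseteq> F"
        using add.prems size_mset_mono[OF diff_subset_eq_self[of m a]] by auto
    qed (use add.prems in simp)
    finally show "(\<Sum>mu\<in>F'. dual_groth mu n * groth mu (m - a)) = kernel n (m - a)" .
  qed
  also have "\<dots> = (\<Sum>a | a \<subseteq># m. kernel (replicate_mset k N) a * kernel n (m - a))"
    by (rule sum.cong) (auto simp: kernel_replicate)
  also have "\<dots> = kernel (replicate_mset k N + n) m"
    by (rule kernel_add[symmetric]) (use N in \<open>auto split: if_splits\<close>)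
  finally show ?case by (simp add: add.commute)
qed

text \<open>For equal degrees, \<open>dual_groth nu n\<close> vanishes below that degree and
  \<open>groth nu m\<close> above it. Only shapes of exactly this size remain, and both factors are
  then Schur coefficients.\<close>

lemma schur_Cauchy_identity: "(\<Sum>nu | psize nu = size m. schur nu n * schur nu m) = kernel n m"
proof (cases "size n = size m")
  case True
  have "kernel n m = (\<Sum>nu | psize nu \<le> size m. dual_groth nu n * groth nu m)"
    by (rule Cauchy_identity[symmetric]) (auto simp: finite_psize_le)
  also have "\<dots> = (\<Sum>nu | psize nu = size m. dual_groth nu n * groth nu m)"
  proof (rule sum.mono_neutral_right)
    have "dual_groth nu n = 0" if "psize nu < size m" for nu
      using dual_groth_nonzero[of nu n] that True by force
    then show "\<forall>nu\<in>{nu. psize nu \<le> size m} - {nu. psize nu = size m}. dual_groth nu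
        n * groth nu m = 0"
      by (auto simp: le_less)
  qed (auto simp: finite_psize_le)
  also have "\<dots> = (\<Sum>nu | psize nu = size m. schur nu n * schur nu m)"
    by (rule sum.cong) (use True in \<open>auto simp: dual_groth_top groth_bottom\<close>)
  finally show ?thesis by simp
next
  case False
  have "(\<Sum>nu | psize nu = size m. schur nu n * schur nu m) = 0"
  proof (rule sum.neutral, rule ballI)
    fix nu assume "nu \<in> {nu. psize nu = size m}"
    then have "schur nu n = 0" using schur_nonzero[of nu n] False by (cases "schur nu n = 0") auto
    then show "schur nu n * schur nu m = 0" by simp
  qed
  then show ?thesis using kernel_size[OF False] by simp
qed

section \<open>Triangularity of Schur functions\<close>

text \<open>The monomial usually written x^mu.\<close>

definition part_mset :: "partition \<Rightarrow> monomial" where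
  "part_mset mu = (\<Sum>i<len mu. replicate_mset (row mu i) i)"

text \<open>Usually written \<open>n(\<mu>)\<close>.\<close>

definition row_sum :: "partition \<Rightarrow> nat" where
  "row_sum mu = (\<Sum>x\<in>diagram mu. fst x)"

lemma count_part_mset [simp]: "count (part_mset mu) i = row mu i"
proof -
  have "count (part_mset mu) i = (\<Sum>j<len mu. if j = i then row mu j else 0)"
    unfolding part_mset_def count_sum by (rule sum.cong) auto
  then show ?thesis using row_pos_iff[of mu i] by auto
qed

lemma size_part_mset [simp]: "size (part_mset mu) = psize mu"
  by (simp add: part_mset_def size_sum_multiset psize_eq)

lemma part_mset_inject: "part_mset mu = part_mset nu \<longleftrightarrow> mu = nu"
  by (metis count_part_mset partition_eqI)

lemma set_part_mset: "set_mset (part_mset mu) = {..<len mu}"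
  by (rule set_eqI) (simp only: count_greater_zero_iff[symmetric] count_part_mset row_pos_iff
      lessThan_iff)

lemma part_mset_eq: "part_mset mu = (\<Sum>x\<in>diagram mu. {#fst x#})"
proof -
  have "(\<Sum>x\<in>diagram mu. {#fst x#}) = (\<Sum>i<len mu. \<Sum>j<row mu i. {#i#})"
    unfolding diagram_eq_Sigma by (subst sum.Sigma) (auto simp: case_prod_beta)
  also have "\<dots> = part_mset mu"
  proof -
    have "(\<Sum>j<n. {#i#}) = replicate_mset n i" for n and i :: nat by (induction n) auto
    then show ?thesis by (simp add: part_mset_def)
  qed
  finally show ?thesis by simp
qed

lemma sum_mset_sum_singletons: "sum_mset (\<Sum>x\<in>A. {#f x :: nat#}) = (\<Sum>x\<in>A. f x)"
  by (induction A rule: infinite_finite_induct) auto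

lemma ssyt_entry_ge_row:
  assumes "T \<in> ssyts lam"
  shows "(i, j) \<in> diagram lam \<Longrightarrow> i \<le> T (i, j)"
proof (induction i)
  case (Suc i)
  have "T (i, j) < T (Suc i, j)" using assms Suc.prems by (auto simp: ssyts_def)
  moreover have "i \<le> T (i, j)" using Suc.IH diagram_up[OF Suc.prems] by simp
  ultimately show ?case by simp
qed simp

text \<open>Strict increase down columns makes an entry in row \<open>i\<close> at least
  \<open>i\<close>. Summing all entries compares the two values of \<open>row_sum\<close>, and
  equality forces every entry to be its row index. Thus \<open>row_sum\<close> takes the place of
  the dominance order.\<close>

lemma ssyt_part_mset:
  assumes T: "T \<in> ssyts nu" "ssyt_monomial nu T = part_mset mu"
  shows "row_sum nu \<le> row_sum mu"
    and "row_sum nu = row_sum mu \<Longrightarrow> x \<in> diagram nu \<Longrightarrow> T x = fst x"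
    and "row_sum nu = row_sum mu \<Longrightarrow> nu = mu"
proof -
  have sum: "(\<Sum>x\<in>diagram nu. T x) = row_sum mu"
    using arg_cong[OF T(2), of sum_mset]
    by (simp add: ssyt_monomial_def part_mset_eq sum_mset_sum_singletons row_sum_def)
  have ge: "fst x \<le> T x" if "x \<in> diagram nu" for x
    using ssyt_entry_ge_row[OF T(1), of "fst x" "snd x"] that by simp
  then have "(\<Sum>x\<in>diagram nu. fst x) \<le> (\<Sum>x\<in>diagram nu. T x)" by (rule sum_mono)
  then show "row_sum nu \<le> row_sum mu" by (simp add: sum row_sum_def[of nu])
  assume eq: "row_sum nu = row_sum mu"
  have *: "fst x = T x" if "x \<in> diagram nu" for x
    by (rule sum_mono_inv[OF _ ge that]) (use eq sum in \<open>simp_all add: row_sum_def\<close>)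
  then show "T x = fst x" if "x \<in> diagram nu" using that by simp
  have "ssyt_monomial nu T = part_mset nu"
    unfolding ssyt_monomial_def part_mset_eq by (rule sum.cong) (use * in auto)
  then show "nu = mu" using T(2) by (simp add: part_mset_inject)
qed

lemma schur_part_mset_nonzero:
  assumes "schur nu (part_mset mu) \<noteq> 0"
  shows "row_sum nu \<le> row_sum mu" "row_sum nu = row_sum mu \<Longrightarrow> nu = mu"
proof -
  have "{T \<in> ssyts nu. ssyt_monomial nu T = part_mset mu} \<noteq> {}"
    using assms unfolding schur_def by (metis card.empty of_nat_0)
  then obtain T where "T \<in> ssyts nu" "ssyt_monomial nu T = part_mset mu" by blast
  from ssyt_part_mset[OF this] show "row_sum nu \<le> row_sum mu" "row_sum nu = row_sum mu
      \<Longrightarrow> nu = mu"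
    by auto
qed

lemma schur_part_mset_self: "schur mu (part_mset mu) = 1"
proof -
  let ?T = "restrict fst (diagram mu)"
  have "{T \<in> ssyts mu. ssyt_monomial mu T = part_mset mu} = {?T}"
  proof (intro equalityI subsetI)
    fix T assume T: "T \<in> {T \<in> ssyts mu. ssyt_monomial mu T = part_mset mu}"
    then have "T x = fst x" if "x \<in> diagram mu" for x using ssyt_part_mset(2)[of T mu mu x]
        that by simp
    moreover have "T \<in> extensional (diagram mu)" using T by (simp add: ssyts_def PiE_def)
    ultimately have "T = ?T" by (intro extensionalityI[of _ "diagram mu"]) auto
    then show "T \<in> {?T}" by simp
  next
    fix T assume "T \<in> {?T}"
    moreover have "?T \<in> ssyts mu"
      unfolding ssyts_def
    proof (intro CollectI conjI allI impI)
      fix i j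
      show "?T (i, j) \<le> ?T (i, Suc j)" if "(i, Suc j) \<in> diagram mu"
        using that diagram_left[OF that] by simp
      show "?T (i, j) < ?T (Suc i, j)" if "(Suc i, j) \<in> diagram mu"
        using that diagram_up[OF that] by simp
    qed simp
    moreover have "ssyt_monomial mu ?T = part_mset mu"
      unfolding ssyt_monomial_def part_mset_eq by (rule sum.cong) auto
    ultimately show "T \<in> {T \<in> ssyts mu. ssyt_monomial mu T = part_mset mu}" by simp
  qed
  then show ?thesis by (simp add: schur_def)
qed

text \<open>At the monomial of \<open>nu\<close> the only contributions come from shapes of smaller
  \<open>row_sum\<close>, already known to have coefficient 0, and from \<open>nu\<close> itself
  with coefficient 1.\<close>

lemma schur_independent:
  assumes "\<And>m. size m = d \<Longrightarrow> (\<Sum>nu | psize nu = d. c nu * schur nu m) = 0"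
      and "psize nu = d"
  shows "c nu = 0"
  using assms(2)
proof (induction "row_sum nu" arbitrary: nu rule: less_induct)
  case less
  have "0 = (\<Sum>ka | psize ka = d. c ka * schur ka (part_mset nu))"
    using assms(1)[of "part_mset nu"] less.prems by simp
  also have "\<dots> = (\<Sum>ka\<in>{nu}. c ka * schur ka (part_mset nu))"
  proof (rule sum.mono_neutral_right)
    show "\<forall>ka\<in>{ka. psize ka = d} - {nu}. c ka * schur ka (part_mset nu) = 0"
    proof
      fix ka assume ka: "ka \<in> {ka. psize ka = d} - {nu}"
      show "c ka * schur ka (part_mset nu) = 0"
      proof (cases "schur ka (part_mset nu) = 0")
        case False
        then have "row_sum ka < row_sum nu"
          using schur_part_mset_nonzero[of ka nu] ka by force
        then show ?thesis using less.hyps[of ka] ka by simp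
      qed simp
    qed
  qed (use less.prems in auto)
  finally show ?case by (simp add: schur_part_mset_self)
qed

section \<open>Symmetric series\<close>

text \<open>Injectivity is required on the variables of \<open>m\<close> only. Such a renaming
  extends to a permutation of all variables, so this is ordinary symmetry, in a form that also
  applies directly to maps such as i to 2 i in the coproduct.\<close>

definition symmetric :: "series \<Rightarrow> bool" where
  "symmetric f \<longleftrightarrow> (\<forall>\<sigma> m. inj_on \<sigma> (set_mset m)
      \<longrightarrow> f (image_mset \<sigma> m) = f m)"

lemma symmetricD: "symmetric f \<Longrightarrow> inj_on \<sigma> (set_mset m) \<Longrightarrow> f
    (image_mset \<sigma> m) = f m"
  by (auto simp: symmetric_def)

text \<open>The kernel does not change when the variables of \<open>m\<close> are renamed, so the
  changes \<open>c\<close> of the coefficients form a linear relation between Schur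
  functions.\<close>

lemma symmetric_schur: "symmetric (schur nu)"
  unfolding symmetric_def
proof (intro allI impI)
  fix \<sigma> :: "nat \<Rightarrow> nat" and m :: monomial
  assume inj: "inj_on \<sigma> (set_mset m)"
  define c where "c = (\<lambda>ka. schur ka (image_mset \<sigma> m) - schur ka m)"
  have "(\<Sum>ka | psize ka = size m. c ka * schur ka n) = 0" for n
  proof -
    have "(\<Sum>ka | psize ka = size m. c ka * schur ka n) =
        (\<Sum>ka | psize ka = size m. schur ka n * schur ka (image_mset \<sigma> m)) -
        (\<Sum>ka | psize ka = size m. schur ka n * schur ka m)"
      by (simp add: c_def algebra_simps flip: sum_subtractf)
    then show ?thesis
      using schur_Cauchy_identity[of n "image_mset \<sigma> m"] schur_Cauchy_identity[of n m]
      by (simp add: kernel_image[OF inj])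
  qed
  then have "c nu = 0" if "psize nu = size m"
    using schur_independent[of "size m" c nu] that by blast
  moreover have "c nu = 0" if "psize nu \<noteq> size m"
    using that schur_nonzero[of nu] unfolding c_def by (metis diff_self size_image_mset)
  ultimately show "schur nu (image_mset \<sigma> m) = schur nu m" by (auto simp: c_def)
qed

text \<open>The same argument with a relation between \<open>dual_groth\<close> series. The
  induction runs downward in size: in degree \<open>psize nu\<close> smaller shapes vanish, larger
  ones are settled, and the remaining top parts are Schur functions.\<close>

lemma symmetric_groth: "symmetric (groth nu)"
  unfolding symmetric_def
proof (intro allI impI)
  fix \<sigma> :: "nat \<Rightarrow> nat" and m :: monomial
  assume inj: "inj_on \<sigma> (set_mset m)"
  define F where "F = {nu. psize nu \<le> size m}"
  have F: "finite F" by (simp add: F_def finite_psize_le)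
  define c where "c = (\<lambda>ka. groth ka (image_mset \<sigma> m) - groth ka m)"
  have sum: "(\<Sum>ka\<in>F. dual_groth ka n * c ka) = 0" for n
  proof -
    have "(\<Sum>ka\<in>F. dual_groth ka n * groth ka (image_mset \<sigma> m)) = kernel n
        (image_mset \<sigma> m)"
      "(\<Sum>ka\<in>F. dual_groth ka n * groth ka m) = kernel n m"
      by (rule Cauchy_identity; simp add: F_def finite_psize_le)+
    then show ?thesis by (simp add: c_def right_diff_distrib sum_subtractf kernel_image[OF inj])
  qed
  have "c nu = 0" if "nu \<in> F" for nu
    using that
  proof (induction "size m - psize nu" arbitrary: nu rule: less_induct)
    case less
    define d where "d = psize nu"
    have "(\<Sum>ka | psize ka = d. c ka * schur ka n) = 0" if n: "size n = d" for n
    proof -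
      have "0 = (\<Sum>ka\<in>F. dual_groth ka n * c ka)" by (simp add: sum)
      also have "\<dots> = (\<Sum>ka | psize ka = d. dual_groth ka n * c ka)"
      proof (rule sum.mono_neutral_right)
        show "\<forall>ka\<in>F - {ka. psize ka = d}. dual_groth ka n * c ka = 0"
        proof
          fix ka assume ka: "ka \<in> F - {ka. psize ka = d}"
          show "dual_groth ka n * c ka = 0"
          proof (cases "psize ka < d")
            case True
            then have "dual_groth ka n = 0" using dual_groth_nonzero[of ka n] n by force
            then show ?thesis by simp
          next
            case False
            then have "c ka = 0" using ka less by (intro less.hyps) (auto simp: F_def d_def)
            then show ?thesis by simp
          qed
        qed
        show "{ka. psize ka = d} \<subseteq> F" using less.prems by (auto simp: F_def d_def)
      qed (rule F)
      also have "\<dots> = (\<Sum>ka | psize ka = d. c ka * schur ka n)"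
        by (rule sum.cong) (use n in \<open>auto simp: dual_groth_top\<close>)
      finally show ?thesis by simp
    qed
    from schur_independent[OF this] show ?case by (simp add: d_def)
  qed
  moreover have "c nu = 0" if "nu \<notin> F"
    using that groth_nonzero[of nu] unfolding c_def F_def by (metis diff_self mem_Collect_eq
        size_image_mset)
  ultimately show "groth nu (image_mset \<sigma> m) = groth nu m" by (cases "nu \<in> F") (auto
      simp: c_def)
qed

text \<open>The mirror image: a relation between \<open>groth\<close> series, whose lowest parts are
  Schur functions, with the induction running upward in size.\<close>

lemma symmetric_dual_groth: "symmetric (dual_groth nu)"
  unfolding symmetric_def
proof (intro allI impI)
  fix \<sigma> :: "nat \<Rightarrow> nat" and n :: monomial
  assume inj: "inj_on \<sigma> (set_mset n)"
  define c where "c = (\<lambda>ka. dual_groth ka (image_mset \<sigma> n) - dual_groth ka n)"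
  have sum: "(\<Sum>ka | psize ka \<le> size m. c ka * groth ka m) = 0" for m
  proof -
    have "(\<Sum>ka | psize ka \<le> size m. dual_groth ka (image_mset \<sigma> n) * groth ka m) =
        kernel (image_mset \<sigma> n) m"
      "(\<Sum>ka | psize ka \<le> size m. dual_groth ka n * groth ka m) = kernel n m"
      by (rule Cauchy_identity; simp add: finite_psize_le)+
    moreover have "kernel (image_mset \<sigma> n) m = kernel n m"
      unfolding kernel_commute[of _ m] by (rule kernel_image[OF inj])
    ultimately show ?thesis by (simp add: c_def left_diff_distrib sum_subtractf)
  qed
  have "c nu = 0" for nu
  proof (induction "psize nu" arbitrary: nu rule: less_induct)
    case less
    define d where "d = psize nu"
    have "(\<Sum>ka | psize ka = d. c ka * schur ka m) = 0" if m: "size m = d" for m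
    proof -
      have "0 = (\<Sum>ka | psize ka \<le> size m. c ka * groth ka m)" by (simp add: sum)
      also have "\<dots> = (\<Sum>ka | psize ka = d. c ka * groth ka m)"
        by (rule sum.mono_neutral_right) (use m less in \<open>auto simp: finite_psize_le d_def\<close>)
      also have "\<dots> = (\<Sum>ka | psize ka = d. c ka * schur ka m)"
        by (rule sum.cong) (use m in \<open>auto simp: groth_bottom\<close>)
      finally show ?thesis by simp
    qed
    from schur_independent[OF this] show ?case by (simp add: d_def)
  qed
  then show "dual_groth nu (image_mset \<sigma> n) = dual_groth nu n" by (simp add: c_def)
qed

text \<open>The variables are listed by decreasing exponent, and \<open>\<sigma>\<close> sends a
  position in the list to the variable found there.\<close>

lemma ex_part_mset_image:
  fixes m :: monomial
  shows "\<exists>mu \<sigma>. inj_on \<sigma> (set_mset (part_mset mu)) \<and> m = image_mset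
      \<sigma> (part_mset mu)"
proof -
  define xs where "xs = rev (sort_key (count m) (sorted_list_of_set (set_mset m)))"
  have xs: "set xs = set_mset m" "distinct xs" by (simp_all add: xs_def)
  define ps where "ps = map (count m) xs"
  have "sorted_wrt (\<ge>) ps"
  proof -
    have "ps = rev (map (count m) (sort_key (count m) (sorted_list_of_set (set_mset m))))"
      by (simp add: ps_def xs_def rev_map)
    then show ?thesis
      using sorted_sort_key[of "count m" "sorted_list_of_set (set_mset m)"] by (simp only:
          sorted_wrt_rev)
  qed
  moreover have "0 \<notin> set ps" using xs by (auto simp: ps_def count_eq_zero_iff)
  ultimately have parts: "parts (Partition ps) = ps" by (intro Partition_inverse) simp
  let ?mu = "Partition ps"
  have len: "len ?mu = length xs" unfolding len_def parts by (simp add: ps_def)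
  have row: "row ?mu i = count m (xs ! i)" if "i < length xs" for i
    unfolding row_def parts using that by (simp add: ps_def)
  have inj: "inj_on ((!) xs) {..<length xs}"
    using xs(2) by (auto simp: inj_on_def nth_eq_iff_index_eq)
  have "m = (\<Sum>x\<in>set_mset m. replicate_mset (count m x) x)"
    by (rule multiset_eqI) (auto simp: count_sum not_in_iff)
  also have "\<dots> = (\<Sum>i<length xs. replicate_mset (count m (xs ! i)) (xs ! i))"
    by (rule sum.reindex_bij_betw[symmetric]) (use bij_betw_nth[OF xs(2) refl refl] xs(1) in simp)
  also have "\<dots> = (\<Sum>i<length xs. image_mset ((!) xs) (replicate_mset (row ?mu i) i))"
    by (rule sum.cong) (auto simp: row)
  also have "\<dots> = image_mset ((!) xs) (part_mset ?mu)"
  proof -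
    have "image_mset f (\<Sum>i\<in>A. g i) = (\<Sum>i\<in>A. image_mset f (g i))" for f :: "nat
        \<Rightarrow> nat" and g and A :: "nat set"
      by (induction A rule: infinite_finite_induct) auto
    then show ?thesis by (simp add: part_mset_def len)
  qed
  finally have m: "m = image_mset ((!) xs) (part_mset ?mu)" .
  show ?thesis
  proof (rule exI[of _ ?mu], rule exI[of _ "(!) xs"], rule conjI)
    show "inj_on ((!) xs) (set_mset (part_mset ?mu))"
      unfolding set_part_mset len by (rule inj)
  qed (rule m)
qed

lemma symmetric_eqI:
  assumes "symmetric f" "symmetric g" "\<And>mu. f (part_mset mu) = g (part_mset mu)"
  shows "f = g"
proof
  fix m :: monomial
  obtain mu \<sigma> where "inj_on \<sigma> (set_mset (part_mset mu))" "m = image_mset \<sigma>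
      (part_mset mu)"
    using ex_part_mset_image[of m] by blast
  then show "f m = g m" using assms by (simp add: symmetricD)
qed

text \<open>The solution of the unitriangular system given by the coefficients at the monomials
  \<open>part_mset mu\<close>. It stays within the integers because the diagonal entries are
  1.\<close>

function schur_coeff :: "series \<Rightarrow> partition \<Rightarrow> int" where
  "schur_coeff f mu = f (part_mset mu) -
     (\<Sum>nu\<in>{nu. psize nu = psize mu \<and> row_sum nu < row_sum mu}.
       schur_coeff f nu * schur nu (part_mset mu))"
  by auto
termination
  by (relation "measure (\<lambda>(f, mu). row_sum mu)") auto

declare schur_coeff.simps [simp del]

lemma schur_finite_nonzero: "finite {nu. schur nu m \<noteq> 0}"
  by (rule finite_subset[OF _ finite_psize_eq[of "size m"]]) (auto dest: schur_nonzero)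

lemma comb_schur: "comb schur c m = (\<Sum>nu | psize nu = size m. c nu * schur nu m)"
  by (rule comb_eq_sum) (auto dest: schur_nonzero)

interpretation schur: graded_family schur psize
proof
  fix c assume *: "comb schur c = (\<lambda>m. 0)"
  show "c = (\<lambda>i. 0)"
  proof
    fix nu
    show "c nu = 0"
    proof (rule schur_independent[of "psize nu"])
      fix m :: monomial assume "size m = psize nu"
      then show "(\<Sum>ka | psize ka = psize nu. c ka * schur ka m) = 0"
        using fun_cong[OF *, of m] by (simp add: comb_schur)
    qed simp
  qed
qed (simp_all add: schur_finite_nonzero finite_psize_le)

lemma symmetric_comb_schur: "symmetric (comb schur c)"
  unfolding symmetric_def comb_schur by (simp add: symmetricD[OF symmetric_schur])

lemma comb_schur_coeff:
  assumes "symmetric f"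
  shows "comb schur (schur_coeff f) = f"
proof (rule symmetric_eqI[OF symmetric_comb_schur assms])
  fix mu
  have "comb schur (schur_coeff f) (part_mset mu) =
      (\<Sum>nu | psize nu = psize mu. schur_coeff f nu * schur nu (part_mset mu))"
    by (simp add: comb_schur)
  also have "\<dots> = (\<Sum>nu\<in>insert mu {nu. psize nu = psize mu \<and> row_sum nu < row_sum mu}.
      schur_coeff f nu * schur nu (part_mset mu))"
  proof (rule sum.mono_neutral_right)
    show "\<forall>nu\<in>{nu. psize nu = psize mu} - insert mu {nu. psize nu = psize mu \<and>
        row_sum nu < row_sum mu}.
        schur_coeff f nu * schur nu (part_mset mu) = 0"
      using schur_part_mset_nonzero[of _ mu] by (auto simp: le_less)
  qed auto
  also have "\<dots> = schur_coeff f mu + (\<Sum>nu\<in>{nu. psize nu = psize mu \<and> row_sum nu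
      < row_sum mu}.
      schur_coeff f nu * schur nu (part_mset mu))"
    by (subst sum.insert) (auto simp: schur_part_mset_self intro: finite_subset[OF _
        finite_psize_eq[of "psize mu"]])
  also have "\<dots> = f (part_mset mu)" by (subst schur_coeff.simps) simp
  finally show "comb schur (schur_coeff f) (part_mset mu) = f (part_mset mu)" .
qed

lemma symmetric_iff_comb: "symmetric f \<longleftrightarrow> (\<exists>c. f = comb schur c)"
  by (metis comb_schur_coeff symmetric_comb_schur)

lemma inf_span_schur: "inf_span schur = Collect symmetric"
  by (auto simp: schur.inf_span_eq symmetric_iff_comb)

lemma comb_coords_schur: "symmetric f \<Longrightarrow> comb schur (coords schur f) = f"
  by (rule schur.comb_coords) (simp add: inf_span_schur)

definition bounded_degree :: "series \<Rightarrow> bool" where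
  "bounded_degree f \<longleftrightarrow> (\<exists>d. \<forall>m. d < size m \<longrightarrow> f m = 0)"

text \<open>Schur functions are homogeneous, so the coordinates of one size depend only on the
  homogeneous part of that degree.\<close>

lemma coords_schur_eq_0:
  assumes "symmetric f" "\<And>m. size m = psize nu \<Longrightarrow> f m = 0"
  shows "coords schur f nu = 0"
proof (rule schur_independent[of "psize nu"])
  fix m :: monomial assume "size m = psize nu"
  then show "(\<Sum>ka | psize ka = psize nu. coords schur f ka * schur ka m) = 0"
    using assms comb_coords_schur[OF assms(1)] comb_schur[of "coords schur f" m] by simp
qed simp

lemma fin_span_schur: "fin_span schur = {f. symmetric f \<and> bounded_degree f}"
proof (intro equalityI subsetI)
  fix f assume "f \<in> fin_span schur"
  then obtain c where c: "finite {nu. c nu \<noteq> 0}" "f = comb schur c" by (auto simp: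
      schur.fin_span_eq)
  obtain d where "\<And>nu. d < psize nu \<Longrightarrow> c nu = 0"
    using finite_support_bound[OF c(1)] by blast
  then have "f m = 0" if "d < size m" for m
    unfolding c(2) comb_schur using that by (intro sum.neutral) auto
  then show "f \<in> {f. symmetric f \<and> bounded_degree f}"
    using symmetric_comb_schur c(2) by (auto simp: bounded_degree_def)
next
  fix f assume "f \<in> {f. symmetric f \<and> bounded_degree f}"
  then obtain d where f: "symmetric f" and d: "\<And>m. d < size m \<Longrightarrow> f m = 0"
    by (auto simp: bounded_degree_def)
  have "coords schur f nu = 0" if "d < psize nu" for nu
    by (rule coords_schur_eq_0[OF f]) (use that d in simp)
  then have "finite {nu. coords schur f nu \<noteq> 0}"
    by (intro finite_subset[OF _ finite_psize_le[of d]]) (auto simp: not_le[symmetric])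
  then show "f \<in> fin_span schur"
    unfolding schur.fin_span_eq using comb_coords_schur[OF f] by (metis (mono_tags) image_eqI
        mem_Collect_eq)
qed

section \<open>The tensor square\<close>

definition bisymmetric :: "(monomial \<times> monomial \<Rightarrow> int) \<Rightarrow> bool" where
  "bisymmetric F \<longleftrightarrow> (\<forall>b. symmetric (\<lambda>a. F (a, b))) \<and>
      (\<forall>a. symmetric (\<lambda>b. F (a, b)))"

definition psize2 :: "partition \<times> partition \<Rightarrow> nat" where
  "psize2 p = psize (fst p) + psize (snd p)"

lemma psize2_Pair [simp]: "psize2 (lam, mu) = psize lam + psize mu"
  by (simp add: psize2_def)

lemma finite_psize2_le: "finite {p. psize2 p \<le> d}"
proof (rule finite_subset)
  show "{p. psize2 p \<le> d} \<subseteq> {lam. psize lam \<le> d} \<times> {lam. psize lam \<le> d}"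
    by (auto simp: psize2_def)
qed (simp add: finite_psize_le)

lemma finite_psize2_eq [simp]: "finite {p. psize2 p = d}"
  by (rule finite_subset[OF _ finite_psize2_le[of d]]) auto

lemma tensor_family_Pair [simp]: "tensor_family v (lam, mu) (a, b) = v lam a * v mu b"
  by (simp add: tensor_family_def tensor_def)

lemma tensor_schur_nonzero:
  assumes "tensor_family schur p (a, b) \<noteq> 0"
  shows "psize (fst p) = size a" "psize (snd p) = size b" "psize2 p = size a + size b"
  using assms schur_nonzero[of "fst p" a] schur_nonzero[of "snd p" b]
  by (cases p; auto)+

text \<open>Nesting the two expansions reduces questions about two sets of variables to questions
  about one.\<close>

lemma comb_tensor_schur:
  "comb (tensor_family schur) c (a, b) = comb schur (\<lambda>lam. comb schur (\<lambda>mu. c (lam,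
      mu)) b) a"
proof -
  have "comb (tensor_family schur) c (a, b) =
      (\<Sum>p\<in>{lam. psize lam = size a} \<times> {mu. psize mu = size b}. c p * tensor_family
          schur p (a, b))"
  proof (rule comb_eq_sum)
    fix p assume "p \<notin> {lam. psize lam = size a} \<times> {mu. psize mu = size b}"
    then have "tensor_family schur p (a, b) = 0"
      using tensor_schur_nonzero(1,2)[of p a b] by (cases p) auto
    then show "c p * tensor_family schur p (a, b) = 0" by simp
  qed simp
  also have "\<dots> = comb schur (\<lambda>lam. comb schur (\<lambda>mu. c (lam, mu)) b) a"
    by (simp add: comb_schur sum_distrib_left sum_distrib_right mult_ac sum.cartesian_product
        case_prod_beta tensor_family_def tensor_def)
  finally show ?thesis .
qed

lemma comb_tensor_schur_degree:
  "comb (tensor_family schur) c (a, b) =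
    (\<Sum>p | psize2 p = size a + size b. c p * tensor_family schur p (a, b))"
  by (rule comb_eq_sum) (use tensor_schur_nonzero(3)[of _ a b] in auto)

interpretation schur2: graded_family "tensor_family schur" psize2
proof
  fix m :: "monomial \<times> monomial"
  obtain a b where m: "m = (a, b)" by fastforce
  show "finite {p. tensor_family schur p m \<noteq> 0}"
    unfolding m by (rule finite_subset[OF _ finite_psize2_eq[of "size a + size b"]])
      (use tensor_schur_nonzero(3)[of _ a b] in auto)
next
  fix c :: "partition \<times> partition \<Rightarrow> int"
  assume *: "comb (tensor_family schur) c = (\<lambda>m. 0)"
  have "comb schur (\<lambda>lam. comb schur (\<lambda>mu. c (lam, mu)) b) = (\<lambda>m. 0)" for b
  proof
    fix a show "comb schur (\<lambda>lam. comb schur (\<lambda>mu. c (lam, mu)) b) a = 0"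
      using fun_cong[OF *, of "(a, b)"] by (simp only: comb_tensor_schur)
  qed
  then have "(\<lambda>lam. comb schur (\<lambda>mu. c (lam, mu)) b) = (\<lambda>i. 0)" for b
    by (rule schur.independent)
  then have "comb schur (\<lambda>mu. c (lam, mu)) = (\<lambda>m. 0)" for lam
    by (simp add: fun_eq_iff)
  then have "(\<lambda>mu. c (lam, mu)) = (\<lambda>i. 0)" for lam
    by (rule schur.independent)
  then show "c = (\<lambda>i. 0)" by (simp add: fun_eq_iff)
qed (rule finite_psize2_le)

lemma bisymmetric_comb: "bisymmetric (comb (tensor_family schur) c)"
  unfolding bisymmetric_def
proof (intro conjI allI)
  show "symmetric (\<lambda>a. comb (tensor_family schur) c (a, b))" for b
    unfolding comb_tensor_schur by (rule symmetric_comb_schur)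
  show "symmetric (\<lambda>b. comb (tensor_family schur) c (a, b))" for a
    unfolding comb_tensor_schur by (simp add: symmetric_def symmetricD[OF symmetric_comb_schur])
qed

text \<open>The series is expanded in the first set of variables with the monomial \<open>b\<close>
  fixed. Renaming \<open>b\<close> does not change the series being expanded, so the coordinates
  \<open>d lam b\<close> are symmetric in \<open>b\<close> and can be expanded in turn.\<close>

lemma bisymmetric_iff_comb: "bisymmetric F \<longleftrightarrow> (\<exists>c. F = comb
    (tensor_family schur) c)"
proof
  assume F: "bisymmetric F"
  define d where "d = (\<lambda>lam b. coords schur (\<lambda>a. F (a, b)) lam)"
  have sym1: "symmetric (\<lambda>a. F (a, b))" for b using F by (simp add: bisymmetric_def)
  have sym2: "symmetric (\<lambda>b. F (a, b))" for a using F by (simp add: bisymmetric_def)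
  have "symmetric (d lam)" for lam
    unfolding symmetric_def d_def using symmetricD[OF sym2] by simp
  then have "comb schur (coords schur (d lam)) b = d lam b" for lam b
    by (simp add: comb_coords_schur)
  moreover have "comb schur (\<lambda>lam. d lam b) a = F (a, b)" for a b
    unfolding d_def comb_coords_schur[OF sym1] ..
  ultimately have "F = comb (tensor_family schur) (\<lambda>(lam, mu). coords schur (d lam) mu)"
    by (auto simp: fun_eq_iff comb_tensor_schur)
  then show "\<exists>c. F = comb (tensor_family schur) c" by blast
qed (auto simp: bisymmetric_comb)

lemma inf_span_tensor_schur: "inf_span (tensor_family schur) = Collect bisymmetric"
  by (auto simp: schur2.inf_span_eq bisymmetric_iff_comb)

lemma comb_coords_tensor: "bisymmetric F \<Longrightarrow> comb (tensor_family schur) (coords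
    (tensor_family schur) F) = F"
  by (rule schur2.comb_coords) (simp add: inf_span_tensor_schur)

definition bounded_degree2 :: "(monomial \<times> monomial \<Rightarrow> int) \<Rightarrow> bool" where
  "bounded_degree2 F \<longleftrightarrow> (\<exists>d. \<forall>a b. d < size a + size b
      \<longrightarrow> F (a, b) = 0)"

lemma fin_span_tensor_schur: "fin_span (tensor_family schur) = {F. bisymmetric F \<and>
    bounded_degree2 F}"
proof (intro equalityI subsetI)
  fix F assume "F \<in> fin_span (tensor_family schur)"
  then obtain c where c: "finite {p. c p \<noteq> 0}" "F = comb (tensor_family schur) c"
    by (auto simp: schur2.fin_span_eq)
  obtain d where d: "\<And>p. d < psize2 p \<Longrightarrow> c p = 0"
    using finite_support_bound[OF c(1)] by blast
  have "F (a, b) = 0" if "d < size a + size b" for a b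
    unfolding c(2) comb_tensor_schur_degree using that d by (intro sum.neutral) auto
  then show "F \<in> {F. bisymmetric F \<and> bounded_degree2 F}"
    using bisymmetric_comb c(2) by (auto simp: bounded_degree2_def)
next
  fix F assume "F \<in> {F. bisymmetric F \<and> bounded_degree2 F}"
  then obtain d where F: "bisymmetric F" and d: "\<And>a b. d < size a + size b \<Longrightarrow> F
      (a, b) = 0"
    by (auto simp: bounded_degree2_def)
  define c where "c = coords (tensor_family schur) F"
  have Fc: "F = comb (tensor_family schur) c" using comb_coords_tensor[OF F] by (simp add: c_def)
  \<comment> \<open>Expansions are evaluated degree by degree and \<open>F\<close> vanishes above
    degree \<open>d\<close>, so truncating the coordinates there does not change the series.\<close>
  define c' where "c' = (\<lambda>p. if psize2 p \<le> d then c p else 0)"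
  have "comb (tensor_family schur) c' = F"
  proof
    fix m :: "monomial \<times> monomial"
    obtain a b where m: "m = (a, b)" by fastforce
    show "comb (tensor_family schur) c' m = F m"
    proof (cases "size a + size b \<le> d")
      case True
      then show ?thesis unfolding m Fc comb_tensor_schur_degree by (intro sum.cong) (auto simp: c'_def)
    next
      case False
      then have "comb (tensor_family schur) c' (a, b) = 0"
        unfolding comb_tensor_schur_degree by (intro sum.neutral) (auto simp: c'_def)
      then show ?thesis using d[of a b] False by (simp add: m)
    qed
  qed
  moreover have "finite {p. c' p \<noteq> 0}"
    by (rule finite_subset[OF _ finite_psize2_le[of d]]) (auto simp: c'_def)
  ultimately show "F \<in> fin_span (tensor_family schur)"
    unfolding schur2.fin_span_eq by (metis (mono_tags) image_eqI mem_Collect_eq)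
qed

section \<open>Dual bases\<close>

definition groth_to_schur :: "partition \<Rightarrow> partition \<Rightarrow> int" where
  "groth_to_schur lam = coords schur (groth lam)"

definition dual_groth_to_schur :: "partition \<Rightarrow> partition \<Rightarrow> int" where
  "dual_groth_to_schur lam = coords schur (dual_groth lam)"

lemma comb_groth_to_schur: "comb schur (groth_to_schur lam) = groth lam"
  unfolding groth_to_schur_def by (rule comb_coords_schur[OF symmetric_groth])

lemma comb_dual_groth_to_schur: "comb schur (dual_groth_to_schur lam) = dual_groth lam"
  unfolding dual_groth_to_schur_def by (rule comb_coords_schur[OF symmetric_dual_groth])

text \<open>Taken as coefficients of the products s_j(x) s_k(y), both matrices expand to the kernel:
  the left one by the Cauchy identity for the two new families, the identity matrix by the one for
  Schur functions.\<close>

lemma groth_transition_inverse: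
  "(\<Sum>i | psize i \<le> psize k. dual_groth_to_schur i j * groth_to_schur i k) = (if j = k then
      1 else 0)"
proof -
  define X where "X = (\<lambda>(j, k). \<Sum>i | psize i \<le> psize k. dual_groth_to_schur i j *
      groth_to_schur i k)"
  have "comb (tensor_family schur) X = comb (tensor_family schur) (\<lambda>(j, k). if j = k then 1
      else 0)"
  proof
    fix nm :: "monomial \<times> monomial"
    obtain n m where nm: "nm = (n, m)" by fastforce
    have "comb (tensor_family schur) X (n, m) = (\<Sum>j | psize j = size n. \<Sum>k | psize k = size m.
        \<Sum>i | psize i \<le> size m. (dual_groth_to_schur i j * schur j n) * (groth_to_schur i k
            * schur k m))"
      by (simp add: comb_tensor_schur comb_schur X_def sum_distrib_left sum_distrib_right mult_ac)
    also have "\<dots> = (\<Sum>i | psize i \<le> size m. (\<Sum>j | psize j = size n.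
        dual_groth_to_schur i j * schur j n) *
        (\<Sum>k | psize k = size m. groth_to_schur i k * schur k m))"
      unfolding sum_product by (subst (2) sum.swap, subst sum.swap, rule sum.cong[OF refl], rule
          sum.cong[OF refl], rule refl)
    also have "\<dots> = (\<Sum>i | psize i \<le> size m. dual_groth i n * groth i m)"
      unfolding comb_schur[symmetric] comb_groth_to_schur comb_dual_groth_to_schur ..
    also have "\<dots> = kernel n m"
      by (rule Cauchy_identity) (auto simp: finite_psize_le)
    also have "\<dots> = comb (tensor_family schur) (\<lambda>(j, k). if j = k then 1 else 0) (n, m)"
    proof -
      have "comb schur (\<lambda>mu. if lam = mu then 1 else 0) m = schur lam m" for lam
        using schur.comb_unit[of lam] by (simp add: eq_commute[of lam])
      then have "comb (tensor_family schur) (\<lambda>(j, k). if j = k then 1 else 0) (n, m) =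
          (\<Sum>nu | psize nu = size n. schur nu m * schur nu n)"
        by (simp add: comb_tensor_schur comb_schur[of _ n])
      then show ?thesis using schur_Cauchy_identity[of m n] by (simp add: kernel_commute)
    qed
    finally show "comb (tensor_family schur) X nm =
        comb (tensor_family schur) (\<lambda>(j, k). if j = k then 1 else 0) nm" by (simp add: nm)
  qed
  then have "X = (\<lambda>(j, k). if j = k then 1 else 0)" by (simp only: schur2.comb_inject)
  then show ?thesis by (auto simp: X_def fun_eq_iff)
qed

lemma groth_to_schur_upper: "groth_to_schur i j \<noteq> 0 \<Longrightarrow> psize i \<le> psize j"
  using coords_schur_eq_0[OF symmetric_groth, of j i] groth_nonzero[of i]
  unfolding groth_to_schur_def by (metis not_le)

lemma dual_groth_to_schur_lower: "dual_groth_to_schur i j \<noteq> 0 \<Longrightarrow> psize j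
    \<le> psize i"
  using coords_schur_eq_0[OF symmetric_dual_groth, of j i] dual_groth_nonzero[of i]
  unfolding dual_groth_to_schur_def by (metis not_le)

lemma groth_to_schur_diag:
  assumes "psize i = psize j"
  shows "groth_to_schur i j = (if i = j then 1 else 0)"
proof -
  have "groth_to_schur i j - (if j = i then 1 else 0) = 0"
  proof (rule schur_independent[of "psize j" "\<lambda>j. groth_to_schur i j - (if j = i then 1
      else 0)"])
    fix m :: monomial assume m: "size m = psize j"
    have "(\<Sum>nu | psize nu = psize j. (groth_to_schur i nu - (if nu = i then 1 else 0)) * schur
        nu m) =
        comb schur (groth_to_schur i) m - comb schur (\<lambda>nu. if nu = i then 1 else 0) m"
      using m by (simp add: comb_schur left_diff_distrib sum_subtractf)
    also have "\<dots> = 0"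
      unfolding comb_groth_to_schur schur.comb_unit using m assms by (simp add: groth_bottom)
    finally show "(\<Sum>nu | psize nu = psize j. (groth_to_schur i nu - (if nu = i then 1 else 0))
        * schur nu m) = 0" .
  qed simp
  then show ?thesis by (auto split: if_splits)
qed

interpretation groth: dual_transition schur psize groth_to_schur dual_groth_to_schur dual_groth groth
  by unfold_locales
    (simp_all add: groth_to_schur_upper dual_groth_to_schur_lower groth_to_schur_diag
      groth_transition_inverse comb_groth_to_schur comb_dual_groth_to_schur)

lemma sign_mult: "(- 1 :: int) ^ (a + b) * (- 1) ^ (a + c) = (- 1) ^ (b + c)"
  by (simp add: power_add)

text \<open>Negating the variables and multiplying by the sign of the shape conjugates both
  transition matrices by a diagonal matrix of signs, which preserves triangularity and the inverse
  relation.\<close>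

interpretation groth_tilde: dual_transition schur psize
  "\<lambda>i j. (- 1) ^ (psize i + psize j) * groth_to_schur i j"
  "\<lambda>i j. (- 1) ^ (psize i + psize j) * dual_groth_to_schur i j" dual_groth_tilde K_tilde
proof unfold_locales
  fix j k
  have "(\<Sum>i | psize i \<le> psize k. (- 1) ^ (psize i + psize j) * dual_groth_to_schur i j *
      ((- 1) ^ (psize i + psize k) * groth_to_schur i k)) =
      (\<Sum>i | psize i \<le> psize k. (- 1) ^ (psize j + psize k) * (dual_groth_to_schur i j *
          groth_to_schur i k))"
  proof (rule sum.cong[OF refl])
    fix i
    show "(- 1) ^ (psize i + psize j) * dual_groth_to_schur i j *
      ((- 1) ^ (psize i + psize k) * groth_to_schur i k) =
      (- 1) ^ (psize j + psize k) * (dual_groth_to_schur i j * groth_to_schur i k)"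
      unfolding sign_mult[of "psize i" "psize j" "psize k", symmetric] by (simp only: mult_ac)
  qed
  also have "\<dots> = (if j = k then 1 else 0)"
    unfolding sum_distrib_left[symmetric] groth_transition_inverse by (simp add: power_add)
  finally show "(\<Sum>i | psize i \<le> psize k. (- 1) ^ (psize i + psize j) * dual_groth_to_schur i j *
      ((- 1) ^ (psize i + psize k) * groth_to_schur i k)) = (if j = k then 1 else 0)" .
next
  fix i
  show "dual_groth_tilde i = comb schur (\<lambda>j. (- 1) ^ (psize i + psize j) *
      dual_groth_to_schur i j)"
  proof
    fix m
    have "dual_groth i m = (\<Sum>nu | psize nu = size m. dual_groth_to_schur i nu * schur nu m)"
      by (simp only: comb_dual_groth_to_schur flip: comb_schur)
    then show "dual_groth_tilde i m = comb schur (\<lambda>j. (- 1) ^ (psize i + psize j) *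
        dual_groth_to_schur i j) m"
      by (simp add: dual_groth_tilde_def negate_vars_def comb_schur sum_distrib_left power_add mult_ac)
  qed
  show "K_tilde i = comb schur (\<lambda>j. (- 1) ^ (psize i + psize j) * groth_to_schur i j)"
  proof
    fix m
    have "groth i m = (\<Sum>nu | psize nu = size m. groth_to_schur i nu * schur nu m)"
      by (simp only: comb_groth_to_schur flip: comb_schur)
    then have "comb schur (\<lambda>j. (- 1) ^ (psize i + psize j) * groth_to_schur i j) m =
        (- 1) ^ (psize i + size m) * groth i m"
      by (simp add: comb_schur sum_distrib_left power_add mult_ac)
    also have "\<dots> = K_tilde i m"
    proof (cases "psize i \<le> size m")
      case True
      then have "(- 1 :: int) ^ (psize i + size m) * (- 1) ^ (size m - psize i) = 1"
        by (simp flip: power_add)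
      then show ?thesis by (simp add: groth_eq flip: mult.assoc)
    next
      case False
      then have "groth i m = 0" "K_tilde i m = 0"
        using groth_nonzero[of i m] K_tilde_nonzero[of i m] by blast+
      then show ?thesis by simp
    qed
    finally show "K_tilde i m = comb schur (\<lambda>j. (- 1) ^ (psize i + psize j) *
        groth_to_schur i j) m" ..
  qed
qed (auto simp: groth_to_schur_upper dual_groth_to_schur_lower groth_to_schur_diag power_add)

text \<open>The transition matrices of the tensor families are Kronecker products. For the diagonal
  condition, neither degree decreases from \<open>p\<close> to \<open>q\<close> when both entries
  are nonzero, so equal total degrees force equality in each factor.\<close>

lemma dual_transition_tensor:
  assumes "dual_transition schur psize A B f G"
  shows "dual_transition (tensor_family schur) psize2
    (\<lambda>p q. A (fst p) (fst q) * A (snd p) (snd q)) (\<lambda>p q. B (fst p) (fst q) * B (snd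
        p) (snd q))
    (tensor_family f) (tensor_family G)"
proof -
  interpret dual_transition schur psize A B f G by (rule assms)
  have comb_prod: "comb (tensor_family schur) (\<lambda>q. c (fst q) * d (snd q)) = tensor (comb
      schur c) (comb schur d)" for c d
  proof
    fix m :: "monomial \<times> monomial"
    obtain a b where m: "m = (a, b)" by fastforce
    show "comb (tensor_family schur) (\<lambda>q. c (fst q) * d (snd q)) m = tensor (comb schur c)
        (comb schur d) m"
      by (simp add: m tensor_def comb_tensor_schur comb_schur sum_distrib_left sum_distrib_right mult_ac)
        (subst sum.swap, simp add: mult_ac)
  qed
  show ?thesis
  proof unfold_locales
    fix p q
    show "psize2 q \<le> psize2 p" if "B (fst p) (fst q) * B (snd p) (snd q) \<noteq> 0"
      using that B_lower[of "fst p" "fst q"] B_lower[of "snd p" "snd q"] by (simp add: psize2_def)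
    show "psize2 p \<le> psize2 q" if "A (fst p) (fst q) * A (snd p) (snd q) \<noteq> 0"
      using that A_upper[of "fst p" "fst q"] A_upper[of "snd p" "snd q"] by (simp add: psize2_def)
    show "A (fst p) (fst q) * A (snd p) (snd q) = (if p = q then 1 else 0)" if eq: "psize2 p = psize2 q"
    proof (cases "A (fst p) (fst q) = 0 \<or> A (snd p) (snd q) = 0")
      case True
      then show ?thesis using A_diag[of "fst p" "fst p"] A_diag[of "snd p" "snd p"] by auto
    next
      case False
      then have "psize (fst p) = psize (fst q)" "psize (snd p) = psize (snd q)"
        using A_upper[of "fst p" "fst q"] A_upper[of "snd p" "snd q"] eq by (auto simp: psize2_def)
      then show ?thesis by (simp add: A_diag prod_eq_iff)
    qed
    show "tensor_family f p = comb (tensor_family schur) (\<lambda>q. B (fst p) (fst q) * B (snd p)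
        (snd q))"
      by (cases p) (simp add: comb_prod tensor_family_def[of f] f_eq)
    show "tensor_family G p = comb (tensor_family schur) (\<lambda>q. A (fst p) (fst q) * A (snd p)
        (snd q))"
      by (cases p) (simp add: comb_prod tensor_family_def[of G] G_eq)
    have "(\<Sum>i | psize2 i \<le> psize2 q. B (fst i) (fst p) * B (snd i) (snd p) * (A (fst i)
        (fst q) * A (snd i) (snd q)))
      = (\<Sum>i\<in>{i. psize i \<le> psize (fst q)} \<times> {i. psize i \<le> psize (snd q)}.
        (B (fst i) (fst p) * A (fst i) (fst q)) * (B (snd i) (snd p) * A (snd i) (snd q)))"
    proof (rule sum.mono_neutral_cong_right)
      show "\<forall>i\<in>{i. psize2 i \<le> psize2 q} - {i. psize i \<le> psize (fst q)} \<times>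
          {i. psize i \<le> psize (snd q)}.
        B (fst i) (fst p) * B (snd i) (snd p) * (A (fst i) (fst q) * A (snd i) (snd q)) = 0"
        using A_upper[of _ "fst q"] A_upper[of _ "snd q"] by fastforce
    qed (rule finite_psize2_le, auto simp: psize2_def)
    also have "\<dots> = (\<Sum>i | psize i \<le> psize (fst q). B i (fst p) * A i (fst q)) *
        (\<Sum>i | psize i \<le> psize (snd q). B i (snd p) * A i (snd q))"
      by (simp add: sum_product sum.cartesian_product case_prod_beta)
    also have "\<dots> = (if p = q then 1 else 0)"
      by (simp add: inverse_left prod_eq_iff)
    finally show "(\<Sum>i | psize2 i \<le> psize2 q.
        B (fst i) (fst p) * B (snd i) (snd p) * (A (fst i) (fst q) * A (snd i) (snd q))) = (if p =
            q then 1 else 0)" .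
  qed
qed

lemmas groth_tensor = dual_transition_tensor[OF groth.dual_transition_axioms]
lemmas groth_tilde_tensor = dual_transition_tensor[OF groth_tilde.dual_transition_axioms]

text \<open>A description without bases, on which the Hopf algebra axioms are checked.\<close>

lemma M_Sym_simps:
  "carr M_Sym = {f. symmetric f \<and> bounded_degree f}"
  "square M_Sym = {F. bisymmetric F \<and> bounded_degree2 F}"
  "one M_Sym = series_one" "mul M_Sym = series_mul" "counit M_Sym = (\<lambda>f. f {#})"
  "comul M_Sym = series_comul" "antip M_Sym = series_antip"
  using dual_transition.fin_span_f[OF groth_tensor]
  by (simp_all add: M_Sym_def groth.fin_span_f fin_span_schur fin_span_tensor_schur)

lemma m_Sym_simps:
  "carr m_Sym = Collect symmetric" "square m_Sym = Collect bisymmetric"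
  "one m_Sym = series_one" "mul m_Sym = series_mul" "counit m_Sym = (\<lambda>f. f {#})"
  "comul m_Sym = series_comul" "antip m_Sym = series_antip"
  using dual_transition.inf_span_G[OF groth_tilde_tensor]
  by (simp_all add: m_Sym_def groth_tilde.inf_span_G inf_span_schur inf_span_tensor_schur)

section \<open>Hopf algebra structure on symmetric series\<close>

definition even_vars :: "monomial \<Rightarrow> monomial" where
  "even_vars = image_mset (\<lambda>i. 2 * i)"

definition odd_vars :: "monomial \<Rightarrow> monomial" where
  "odd_vars = image_mset (\<lambda>i. 2 * i + 1)"

lemma series_comul_eq: "series_comul f (a, b) = f (even_vars a + odd_vars b)"
  by (simp add: series_comul_def even_vars_def odd_vars_def)

lemma even_odd_disjoint: "set_mset (even_vars a) \<inter> set_mset (odd_vars b) = {}"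
  by (auto simp: even_vars_def odd_vars_def) presburger

lemma even_odd_simps [simp]:
  "even_vars {#} = {#}" "odd_vars {#} = {#}"
  "even_vars (a + b) = even_vars a + even_vars b" "odd_vars (a + b) = odd_vars a + odd_vars b"
  "size (even_vars a) = size a" "size (odd_vars a) = size a"
  "even_vars a = {#} \<longleftrightarrow> a = {#}" "odd_vars a = {#} \<longleftrightarrow> a = {#}"
  by (simp_all add: even_vars_def odd_vars_def)

lemma sum_submultisets_even_odd:
  "(\<Sum>c | c \<subseteq># even_vars a + odd_vars b. f c) =
    (\<Sum>a' | a' \<subseteq># a. \<Sum>b' | b' \<subseteq># b. f (even_vars a' + odd_vars b'))"
proof -
  have "inj_on (\<lambda>i::nat. 2 * i) A" "inj_on (\<lambda>i::nat. 2 * i + 1) A" for A by (auto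
      simp: inj_on_def)
  then show ?thesis
    unfolding sum_submultisets_union[OF even_odd_disjoint]
    unfolding even_vars_def odd_vars_def
    by (simp add: sum_submultisets_image)
qed

text \<open>Passing to even and odd variables is only one way to keep the two sets of variables
  apart; by symmetry any other renaming to disjoint sets gives the same value.\<close>

lemma symmetric_comul_disjoint:
  assumes f: "symmetric f" and b': "b' = image_mset \<tau> b" "inj_on \<tau> (set_mset b)"
    and disj: "set_mset a \<inter> set_mset b' = {}"
  shows "series_comul f (a, b) = f (a + b')"
proof -
  define \<sigma> where "\<sigma> = (\<lambda>n. if even n then n div 2 else \<tau> (n div 2))"
  have "inj_on \<sigma> (set_mset (even_vars a + odd_vars b))"
  proof (rule inj_onI)
    fix x y assume x: "x \<in> set_mset (even_vars a + odd_vars b)" and y: "y \<in> set_mset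
        (even_vars a + odd_vars b)"
      and eq: "\<sigma> x = \<sigma> y"
    have cases: "(even x \<and> \<sigma> x \<in> set_mset a \<and> x = 2 * \<sigma> x) \<or>
        (odd x \<and> \<sigma> x \<in> set_mset b' \<and> (\<exists>i\<in>set_mset b. x = 2 * i + 1
            \<and> \<sigma> x = \<tau> i))"
      if "x \<in> set_mset (even_vars a + odd_vars b)" for x
      using that by (auto simp: even_vars_def odd_vars_def \<sigma>_def b'(1))
    show "x = y"
      using cases[OF x] cases[OF y] eq disj b'(2) by (auto simp: inj_on_def disjoint_iff)
  qed
  moreover have "image_mset \<sigma> (even_vars a) = a"
    by (simp add: even_vars_def multiset.map_comp comp_def \<sigma>_def)
  moreover have "image_mset \<sigma> (odd_vars b) = b'"
    by (simp add: odd_vars_def multiset.map_comp comp_def \<sigma>_def b'(1))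
  ultimately show ?thesis
    using symmetricD[OF f, of \<sigma> "even_vars a + odd_vars b"] by (simp add: series_comul_eq)
qed

lemma symmetric_comul_union:
  assumes "symmetric f" "set_mset a \<inter> set_mset b = {}"
  shows "series_comul f (a, b) = f (a + b)"
  by (rule symmetric_comul_disjoint[where \<tau> = id]) (use assms in auto)

lemma comul_empty_right: "symmetric f \<Longrightarrow> series_comul f (a, {#}) = f a"
  by (simp add: symmetric_comul_union)

lemma comul_empty_left: "symmetric f \<Longrightarrow> series_comul f ({#}, b) = f b"
  by (simp add: symmetric_comul_union)

text \<open>Cocommutativity: \<open>\<sigma>\<close> interchanges 2 i and 2 i + 1.\<close>

lemma comul_commute:
  assumes "symmetric f"
  shows "series_comul f (a, b) = series_comul f (b, a)"
proof -
  define \<sigma> :: "nat \<Rightarrow> nat" where "\<sigma> = (\<lambda>n. if even n then n + 1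
      else n - 1)"
  have "\<sigma> (\<sigma> n) = n" for n unfolding \<sigma>_def by presburger
  then have "inj_on \<sigma> A" for A by (rule inj_on_inverseI)
  then have "f (image_mset \<sigma> (even_vars b + odd_vars a)) = f (even_vars b + odd_vars a)"
    by (rule symmetricD[OF assms])
  moreover have "image_mset \<sigma> (even_vars b + odd_vars a) = even_vars a + odd_vars b"
    by (simp add: even_vars_def odd_vars_def multiset.map_comp comp_def \<sigma>_def)
  ultimately show ?thesis by (simp add: series_comul_eq)
qed

text \<open>A renaming of the first set of variables lifts to the even variables with the odd ones
  fixed; the second set follows by cocommutativity.\<close>

lemma bisymmetric_comul:
  assumes "symmetric f"
  shows "bisymmetric (series_comul f)"
proof -
  have left: "symmetric (\<lambda>a. series_comul f (a, b))" for b
    unfolding symmetric_def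
  proof (intro allI impI)
    fix \<sigma> :: "nat \<Rightarrow> nat" and a :: monomial
    assume inj: "inj_on \<sigma> (set_mset a)"
    define \<rho> where "\<rho> = (\<lambda>n. if even n then 2 * \<sigma> (n div 2) else n)"
    have "inj_on \<rho> (set_mset (even_vars a + odd_vars b))"
    proof (rule inj_onI)
      fix x y assume x: "x \<in> set_mset (even_vars a + odd_vars b)" and y: "y \<in> set_mset
          (even_vars a + odd_vars b)"
        and eq: "\<rho> x = \<rho> y"
      have cases: "(\<exists>i\<in>set_mset a. x = 2 * i \<and> \<rho> x = 2 * \<sigma> i) \<or>
          (odd x \<and> \<rho> x = x)"
        if "x \<in> set_mset (even_vars a + odd_vars b)" for x
        using that by (auto simp: even_vars_def odd_vars_def \<rho>_def)
      show "x = y"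
        using cases[OF x] cases[OF y] eq inj by (auto simp: inj_on_def)
    qed
    then have "f (image_mset \<rho> (even_vars a + odd_vars b)) = f (even_vars a + odd_vars b)"
      by (rule symmetricD[OF assms])
    moreover have "image_mset \<rho> (even_vars a) = even_vars (image_mset \<sigma> a)"
      by (simp add: even_vars_def multiset.map_comp comp_def \<rho>_def)
    moreover have "image_mset \<rho> (odd_vars b) = odd_vars b"
      by (simp add: odd_vars_def multiset.map_comp comp_def \<rho>_def)
    ultimately show "series_comul f (image_mset \<sigma> a, b) = series_comul f (a, b)"
      by (simp add: series_comul_eq)
  qed
  moreover have "symmetric (\<lambda>b. series_comul f (a, b))" for a
    using left[of a] by (simp only: comul_commute[OF assms, of _ a])
  ultimately show ?thesis by (simp add: bisymmetric_def)
qed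

text \<open>The two ways of interleaving three sets of variables differ by the renaming of 4 i to 2
  i, of 4 i + 2 to 4 i + 1 and of 2 i + 1 to 4 i + 3.\<close>

lemma comul_coassoc:
  assumes "symmetric f"
  shows "f (even_vars (even_vars a + odd_vars b) + odd_vars c) =
    f (even_vars a + odd_vars (even_vars b + odd_vars c))"
proof -
  define \<sigma> :: "nat \<Rightarrow> nat" where
    "\<sigma> = (\<lambda>n. if even n then (if even (n div 2) then n div 2 else n - 1) else 2 * n + 1)"
  define \<tau> :: "nat \<Rightarrow> nat" where
    "\<tau> = (\<lambda>n. if even n then 2 * n else if even (n div 2) then n + 1 else n div 2)"
  have \<sigma>: "\<sigma> (2 * (2 * i)) = 2 * i" "\<sigma> (2 * (2 * i + 1)) = 2 * (2 * i) + 1"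
      "\<sigma> (2 * i + 1) = 2 * (2 * i + 1) + 1" for i
    by (simp_all add: \<sigma>_def)
  have \<tau>: "\<tau> (2 * i) = 2 * (2 * i)" "\<tau> (2 * (2 * i) + 1) = 2 * (2 * i + 1)"
      "\<tau> (2 * (2 * i + 1) + 1) = 2 * i + 1" for i
    by (simp_all add: \<tau>_def)
  have "\<tau> (\<sigma> n) = n" for n
  proof -
    have "\<exists>i. n = 2 * (2 * i) \<or> n = 2 * (2 * i + 1) \<or> n = 2 * i + 1" by presburger
    then show ?thesis by (auto simp only: \<sigma> \<tau>)
  qed
  then have "inj_on \<sigma> A" for A by (rule inj_on_inverseI)
  then have "f (image_mset \<sigma> (even_vars (even_vars a + odd_vars b) + odd_vars c)) =
      f (even_vars (even_vars a + odd_vars b) + odd_vars c)"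
    by (rule symmetricD[OF assms])
  moreover have "image_mset \<sigma> (even_vars (even_vars a + odd_vars b) + odd_vars c) =
      even_vars a + odd_vars (even_vars b + odd_vars c)"
    unfolding even_vars_def odd_vars_def image_mset_union multiset.map_comp comp_def \<sigma>
    by (simp only: add.assoc)
  ultimately show ?thesis by simp
qed

lemma symmetric_mul:
  assumes "bisymmetric F"
  shows "symmetric (series_mul F)"
  unfolding symmetric_def
proof (intro allI impI)
  fix \<sigma> :: "nat \<Rightarrow> nat" and m :: monomial
  assume inj: "inj_on \<sigma> (set_mset m)"
  have "series_mul F (image_mset \<sigma> m) = (\<Sum>a | a \<subseteq># m. F (image_mset \<sigma>
      a, image_mset \<sigma> m - image_mset \<sigma> a))"
    unfolding series_mul_def by (rule sum_submultisets_image[OF inj])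
  also have "\<dots> = (\<Sum>a | a \<subseteq># m. F (a, m - a))"
  proof (rule sum.cong[OF refl])
    fix a assume "a \<in> {a. a \<subseteq># m}"
    then have a: "a \<subseteq># m" by simp
    have inj': "inj_on \<sigma> (set_mset a)" "inj_on \<sigma> (set_mset (m - a))"
      using inj set_mset_mono[OF a] by (auto intro: inj_on_subset dest: in_diffD)
    have "image_mset \<sigma> m - image_mset \<sigma> a = image_mset \<sigma> (m - a)" by (simp
        add: image_mset_Diff a)
    moreover have "F (image_mset \<sigma> a, image_mset \<sigma> (m - a)) = F (a, image_mset
        \<sigma> (m - a))"
    proof -
      have "symmetric (\<lambda>x. F (x, image_mset \<sigma> (m - a)))" using assms by (simp add:
          bisymmetric_def)
      from symmetricD[OF this inj'(1)] show ?thesis .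
    qed
    moreover have "F (a, image_mset \<sigma> (m - a)) = F (a, m - a)"
    proof -
      have "symmetric (\<lambda>x. F (a, x))" using assms by (simp add: bisymmetric_def)
      from symmetricD[OF this inj'(2)] show ?thesis .
    qed
    ultimately show "F (image_mset \<sigma> a, image_mset \<sigma> m - image_mset \<sigma> a) = F
        (a, m - a)" by simp
  qed
  finally show "series_mul F (image_mset \<sigma> m) = series_mul F m" by (simp add: series_mul_def)
qed

text \<open>Both sides run over the factorizations of \<open>m\<close> into three monomials, given
  by nested divisors on the left and by successive divisors on the right.\<close>

lemma series_mul_assoc:
  "series_mul (tensor (series_mul (tensor f g)) h) = series_mul (tensor f (series_mul (tensor g h)))"
proof
  fix m :: monomial
  have "series_mul (tensor (series_mul (tensor f g)) h) m =
      (\<Sum>(a, b)\<in>(SIGMA a:{a. a \<subseteq># m}. {b. b \<subseteq># a}). f b * g (a - b) * h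
          (m - a))"
    by (subst sum.Sigma[symmetric]) (auto simp: series_mul_def tensor_def sum_distrib_right)
  also have "\<dots> = (\<Sum>(b, c)\<in>(SIGMA b:{b. b \<subseteq># m}. {c. c \<subseteq># m -
      b}). f b * g c * h (m - b - c))"
  proof (rule sum.reindex_bij_witness[of _ "\<lambda>(b, c). (b + c, b)" "\<lambda>(a, b). (b, a - b)"])
    fix p assume "p \<in> (SIGMA a:{a. a \<subseteq># m}. {b. b \<subseteq># a})"
    then obtain a b where p: "p = (a, b)" "a \<subseteq># m" "b \<subseteq># a" by auto
    then show "(case case p of (a, b) \<Rightarrow> (b, a - b) of (b, c) \<Rightarrow> (b + c, b)) = p"
      by (simp add: subset_mset.add_diff_inverse)
    show "(case p of (a, b) \<Rightarrow> (b, a - b)) \<in> (SIGMA b:{b. b \<subseteq># m}. {c. c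
        \<subseteq># m - b})"
      using subset_mset.order_trans[OF p(3,2)] p by (auto simp: subseteq_mset_def diff_le_mono)
    show "(case case p of (a, b) \<Rightarrow> (b, a - b) of (b, c) \<Rightarrow> f b * g c * h (m
        - b - c)) =
        (case p of (a, b) \<Rightarrow> f b * g (a - b) * h (m - a))"
    proof -
      have "m - b - (a - b) = m - a"
        using p by (auto simp: multiset_eq_iff subseteq_mset_def)
      then show ?thesis by (simp add: p)
    qed
  next
    fix q assume "q \<in> (SIGMA b:{b. b \<subseteq># m}. {c. c \<subseteq># m - b})"
    then obtain b c where q: "q = (b, c)" "b \<subseteq># m" "c \<subseteq># m - b" by auto
    then show "(case case q of (b, c) \<Rightarrow> (b + c, b) of (a, b) \<Rightarrow> (b, a - b))
        = q" by simp
    have "count b x + count c x \<le> count m x" for x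
    proof -
      have "count b x \<le> count m x" "count c x \<le> count m x - count b x"
        using q by (auto simp: subseteq_mset_def)
      then show ?thesis by simp
    qed
    then show "(case q of (b, c) \<Rightarrow> (b + c, b)) \<in> (SIGMA a:{a. a \<subseteq># m}.
        {b. b \<subseteq># a})"
      by (auto simp: q(1) subseteq_mset_def)
  qed
  also have "\<dots> = series_mul (tensor f (series_mul (tensor g h))) m"
    by (subst sum.Sigma[symmetric]) (auto simp: series_mul_def tensor_def sum_distrib_left mult.assoc)
  finally show "series_mul (tensor (series_mul (tensor f g)) h) m = series_mul (tensor f
      (series_mul (tensor g h))) m" .
qed

lemma series_one_mul: "series_mul (tensor series_one f) = f"
proof
  fix m :: monomial
  have "series_mul (tensor series_one f) m = (\<Sum>a\<in>{{#}}. series_one a * f (m - a))"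
    unfolding series_mul_def tensor_def prod.case
    by (rule sum.mono_neutral_right) (auto simp: series_one_def)
  then show "series_mul (tensor series_one f) m = f m" by (simp add: series_one_def)
qed

lemma series_mul_one: "series_mul (tensor f series_one) = f"
proof
  fix m :: monomial
  have "series_mul (tensor f series_one) m = (\<Sum>a\<in>{m}. f a * series_one (m - a))"
    unfolding series_mul_def tensor_def prod.case
    by (rule sum.mono_neutral_right) (auto simp: series_one_def Diff_eq_empty_iff_mset intro:
        subset_mset.antisym)
  then show "series_mul (tensor f series_one) m = f m" by (simp add: series_one_def)
qed

lemma comul_one: "series_comul series_one = tensor series_one series_one"
  by (auto simp: fun_eq_iff series_comul_eq tensor_def series_one_def)

text \<open>A divisor of an interleaved monomial is the interleaving of a divisor of
  \<open>a\<close> and a divisor of \<open>b\<close>.\<close>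

lemma comul_mul:
  "series_comul (series_mul (tensor f g)) (a, b) =
    series_mul (\<lambda>(a1, a2). series_mul (\<lambda>(b1, b2). series_comul f (a1, b1) *
        series_comul g (a2, b2)) b) a"
proof -
  have "series_comul (series_mul (tensor f g)) (a, b) =
      (\<Sum>a' | a' \<subseteq># a. \<Sum>b' | b' \<subseteq># b. f (even_vars a' + odd_vars b') *
        g (even_vars a + odd_vars b - (even_vars a' + odd_vars b')))"
    by (simp add: series_comul_eq series_mul_def tensor_def sum_submultisets_even_odd)
  also have "\<dots> = (\<Sum>a' | a' \<subseteq># a. \<Sum>b' | b' \<subseteq># b. f (even_vars a'
      + odd_vars b') *
        g (even_vars (a - a') + odd_vars (b - b')))"
  proof (intro sum.cong refl)
    fix a' b' assume "a' \<in> {a'. a' \<subseteq># a}" "b' \<in> {b'. b' \<subseteq># b}"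
    then have "a' \<subseteq># a" "b' \<subseteq># b" by simp_all
    moreover from this obtain a'' b'' where "a = a' + a''" "b = b' + b''"
      unfolding subset_mset.le_iff_add by blast
    ultimately have "even_vars a + odd_vars b - (even_vars a' + odd_vars b') = even_vars (a - a') +
        odd_vars (b - b')"
      by (simp add: add_ac)
    then show "f (even_vars a' + odd_vars b') * g (even_vars a + odd_vars b - (even_vars a' +
        odd_vars b')) =
        f (even_vars a' + odd_vars b') * g (even_vars (a - a') + odd_vars (b - b'))" by simp
  qed
  finally show ?thesis by (simp add: series_mul_def series_comul_eq)
qed

section \<open>The antipode\<close>

text \<open>The antipode in Schur coordinates.\<close>

definition conj_comb :: "(partition \<Rightarrow> int) \<Rightarrow> partition \<Rightarrow> int" where
  "conj_comb c lam = (- 1) ^ psize lam * c (conjugate lam)"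

lemma series_antip_comb: "series_antip (comb schur c) = comb schur (conj_comb c)"
proof
  fix m :: monomial
  have "series_antip (comb schur c) m = (\<Sum>lam | psize lam = size m. c lam * ((- 1) ^ psize lam
      * schur (conjugate lam) m))"
    unfolding series_antip_def schur.coords_comb
  proof (rule comb_eq_sum)
    fix lam assume "lam \<notin> {lam. psize lam = size m}"
    then have "schur (conjugate lam) m = 0" using schur_nonzero[of "conjugate lam" m] by auto
    then show "c lam * ((- 1) ^ psize lam * schur (conjugate lam) m) = 0" by simp
  qed simp
  also have "\<dots> = (\<Sum>lam | psize lam = size m. c (conjugate lam) * ((- 1) ^ psize lam *
      schur lam m))"
    by (rule sum.reindex_bij_witness[of _ conjugate conjugate]) auto
  finally show "series_antip (comb schur c) m = comb schur (conj_comb c) m"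
    by (simp add: comb_schur conj_comb_def mult_ac)
qed

lemma symmetric_antip: "symmetric f \<Longrightarrow> symmetric (series_antip f)"
  using series_antip_comb[of "coords schur f"] by (simp add: comb_coords_schur symmetric_comb_schur)

section \<open>Vertical strips and the sign cancellation\<close>

definition vertical_strip :: "partition \<Rightarrow> partition \<Rightarrow> bool" where
  "vertical_strip lam mu \<longleftrightarrow> horizontal_strip (conjugate lam) (conjugate mu)"

lemma vertical_strip_iff:
  "vertical_strip lam mu \<longleftrightarrow> (\<forall>i. row mu i \<le> row lam i \<and> row lam
      i \<le> row mu i + 1)"
proof -
  have "vertical_strip lam mu \<longleftrightarrow> diagram mu \<subseteq> diagram lam \<and>
     (\<forall>i j. (i, Suc j) \<in> diagram lam \<longrightarrow> (i, j) \<in> diagram mu)"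
    unfolding vertical_strip_def horizontal_strip_def conjugate_subset_iff
    by (auto simp: diagram_conjugate)
  moreover have "(\<forall>j. Suc j < row lam i \<longrightarrow> j < row mu i)
      \<longleftrightarrow> row lam i \<le> row mu i + 1" for i
    by (metis Suc_eq_plus1 less_Suc_eq_le less_irrefl less_trans_Suc not_less_eq_eq not_le
        Suc_lessD Suc_less_eq le_less_trans not_less)
  ultimately show ?thesis unfolding diagram_subset_iff diagram_iff by blast
qed

lemma schur_conjugate_step:
  assumes "\<And>x. x \<in># m \<Longrightarrow> x < N"
  shows "schur (conjugate lam) (m + replicate_mset l N) =
    (\<Sum>mu | vertical_strip lam mu \<and> psize lam = psize mu + l. schur (conjugate mu) m)"
proof -
  have "schur (conjugate lam) (m + replicate_mset l N) =
    (\<Sum>mu | diagram mu \<subseteq> diagram (conjugate lam).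
      if horizontal_strip (conjugate lam) mu \<and> psize (conjugate lam) = psize mu + l then schur
          mu m else 0)"
    by (rule schur_step) (rule assms)
  also have "\<dots> = (\<Sum>mu | horizontal_strip (conjugate lam) mu \<and> psize lam = psize mu
      + l. schur mu m)"
    by (rule sum.mono_neutral_cong_right) (auto simp: horizontal_strip_def)
  also have "\<dots> = (\<Sum>mu | vertical_strip lam mu \<and> psize lam = psize mu + l. schur
      (conjugate mu) m)"
    by (rule sum.reindex_bij_witness[of _ conjugate conjugate]) (auto simp: vertical_strip_def)
  finally show ?thesis .
qed

lemma schur_step':
  assumes "\<And>x. x \<in># m \<Longrightarrow> x < N"
  shows "schur lam (m + replicate_mset l N) =
    (\<Sum>mu | horizontal_strip lam mu \<and> psize lam = psize mu + l. schur mu m)"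
proof -
  have "schur lam (m + replicate_mset l N) = (\<Sum>mu | diagram mu \<subseteq> diagram lam.
      if horizontal_strip lam mu \<and> psize lam = psize mu + l then schur mu m else 0)"
    by (rule schur_step) (rule assms)
  also have "\<dots> = (\<Sum>mu | horizontal_strip lam mu \<and> psize lam = psize mu + l. schur mu m)"
    by (rule sum.mono_neutral_cong_right) (auto simp: horizontal_strip_def)
  finally show ?thesis .
qed

text \<open>Toggling the length of the last row in which \<open>\<lambda>\<close> and
    \<open>\<mu>\<close> differ is a sign-reversing
  involution on the intermediate partitions.\<close>

lemma strip_cancellation:
  "(\<Sum>nu | vertical_strip nu mu \<and> horizontal_strip lam nu. (- 1) ^ psize nu) =
    (if lam = mu then (- 1 :: int) ^ psize mu else 0)"
proof (cases "lam = mu")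
  case True
  have "{nu. vertical_strip nu mu \<and> horizontal_strip mu nu} = {mu}"
    by (auto simp: vertical_strip_iff horizontal_strip_iff intro: row_antimono partition_eqI
        order_antisym)
  then show ?thesis using True by simp
next
  case False
  define W where "W = {nu. vertical_strip nu mu \<and> horizontal_strip lam nu}"
  show ?thesis
  proof (cases "\<forall>i. row mu i \<le> row lam i")
    case False
    then have "W = {}" unfolding W_def vertical_strip_iff horizontal_strip_iff by (blast intro:
        order_trans)
    then show ?thesis using \<open>lam \<noteq> mu\<close> by (simp flip: W_def)
  next
    case le: True
    obtain q where q: "row mu q < row lam q"
      using le \<open>lam \<noteq> mu\<close> partition_eqI[of lam mu] by (metis le_neq_implies_less)
    define p where "p = (GREATEST q. row mu q < row lam q)"
    have bound: "q \<le> len lam" if "row mu q < row lam q" for q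
      using that row_pos_iff[of lam q] by linarith
    have p: "row mu p < row lam p"
      unfolding p_def using GreatestI_nat[of "\<lambda>q. row mu q < row lam q" q "len lam"] q
          bound by blast
    have "\<not> row mu (Suc p) < row lam (Suc p)"
    proof
      assume "row mu (Suc p) < row lam (Suc p)"
      then have "Suc p \<le> p"
        unfolding p_def using Greatest_le_nat[of "\<lambda>q. row mu q < row lam q" _ "len lam"]
            bound by blast
      then show False by simp
    qed
    then have p': "row lam (Suc p) = row mu (Suc p)" using le[rule_format, of "Suc p"] by linarith
    \<comment> \<open>In a vertical strip over \<open>mu\<close>, row \<open>p\<close> of
      \<open>nu\<close> has length \<open>row mu p\<close> or \<open>row mu p + 1\<close>, and the
      formula interchanges the two. Both are admissible: row \<open>p\<close> of \<open>lam\<close>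
      is longer than that of \<open>mu\<close>, and the next row of \<open>lam\<close> equals that
      of \<open>mu\<close> by the choice of \<open>p\<close>.\<close>
    define toggle where "toggle = (\<lambda>nu. of_rows ((row nu)(p := 2 * row mu p + 1 - row nu p)))"
    have toggle: "row (toggle nu) = (row nu)(p := 2 * row mu p + 1 - row nu p)" "toggle nu \<in> W"
      if nu: "nu \<in> W" for nu
    proof -
      have nu': "row mu i \<le> row nu i" "row nu i \<le> row mu i + 1" "row nu i \<le> row lam i"
          "row lam (Suc i) \<le> row nu i" for i
        using nu by (auto simp: W_def vertical_strip_iff horizontal_strip_iff)
      let ?r = "(row nu)(p := 2 * row mu p + 1 - row nu p)"
      have r: "row mu i \<le> ?r i \<and> ?r i \<le> row mu i + 1 \<and> ?r i \<le> row lam i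
          \<and> row lam (Suc i) \<le> ?r i" for i
        using nu'[of i] p p' row_antimono[of p "Suc p" mu] by (cases "i = p") auto
      show *: "row (toggle nu) = ?r"
        unfolding toggle_def
      proof (rule row_of_rows[of _ "len lam"])
        show "?r (Suc i) \<le> ?r i" for i using r[of i] r[of "Suc i"] by linarith
        show "?r i = 0" if "len lam \<le> i" for i
          using r[of i] that row_eq_0_iff[of lam i] by simp
      qed
      show "toggle nu \<in> W"
        unfolding W_def mem_Collect_eq vertical_strip_iff horizontal_strip_iff * using r by blast
    qed
    have twice: "toggle (toggle nu) = nu" if nu: "nu \<in> W" for nu
    proof (rule partition_eqI)
      fix i
      have "row nu p \<le> 2 * row mu p + 1" "row mu p \<le> row nu p" "row nu p \<le> row mu p + 1"
        using nu by (auto simp: W_def vertical_strip_iff intro: order_trans)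
      then show "row (toggle (toggle nu)) i = row nu i"
        using toggle(1)[OF nu] toggle(1)[OF toggle(2)[OF nu]] by auto
    qed
    have sign: "(- 1 :: int) ^ psize (toggle nu) = - ((- 1) ^ psize nu)" if nu: "nu \<in> W" for nu
    proof -
      define n where "n = Suc (len nu + len (toggle nu) + p)"
      have np: "p \<in> {..<n}" by (simp add: n_def)
      have sz: "psize nu = (\<Sum>i<n. row nu i)" "psize (toggle nu) = (\<Sum>i<n. row (toggle nu) i)"
        by (rule psize_eq_sum, simp add: n_def)+
      have "psize nu = row nu p + (\<Sum>i\<in>{..<n} - {p}. row nu i)"
        unfolding sz by (rule sum.remove) (use np in auto)
      moreover have "psize (toggle nu) = row (toggle nu) p + (\<Sum>i\<in>{..<n} - {p}. row (toggle
          nu) i)"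
        unfolding sz by (rule sum.remove) (use np in auto)
      moreover have "(\<Sum>i\<in>{..<n} - {p}. row (toggle nu) i) = (\<Sum>i\<in>{..<n} - {p}. row
          nu i)"
        by (rule sum.cong) (auto simp: toggle(1)[OF nu])
      moreover have "row (toggle nu) p + row nu p = 2 * row mu p + 1"
      proof -
        have "row mu p \<le> row nu p" "row nu p \<le> row mu p + 1"
          using nu by (auto simp: W_def vertical_strip_iff)
        then show ?thesis by (simp add: toggle(1)[OF nu])
      qed
      ultimately have "odd (psize nu + psize (toggle nu))" by presburger
      then show ?thesis by (auto simp: minus_one_power_iff)
    qed
    have "(\<Sum>nu\<in>W. (- 1 :: int) ^ psize nu) = (\<Sum>nu\<in>W. - ((- 1) ^ psize nu))"
      by (rule sum.reindex_bij_witness[of _ toggle toggle]) (use toggle(2) twice sign in auto)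
    then have "(\<Sum>nu\<in>W. (- 1 :: int) ^ psize nu) = 0" by (simp add: sum_negf)
    then show ?thesis using \<open>lam \<noteq> mu\<close> by (simp add: W_def)
  qed
qed

text \<open>On Schur coordinates, the adjoint of multiplication by the complete symmetric function
  h_j; \<open>skew_e\<close> plays the same role for the elementary symmetric function e_j.\<close>

definition skew_h :: "nat \<Rightarrow> (partition \<Rightarrow> int) \<Rightarrow> partition
    \<Rightarrow> int" where
  "skew_h j c mu = (\<Sum>lam | psize lam = psize mu + j \<and> horizontal_strip lam mu. c lam)"

definition skew_e :: "nat \<Rightarrow> (partition \<Rightarrow> int) \<Rightarrow> partition
    \<Rightarrow> int" where
  "skew_e j c mu = (\<Sum>lam | psize lam = psize mu + j \<and> vertical_strip lam mu. c lam)"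

lemma finite_psize_eq' [simp]: "finite {lam. psize lam = n \<and> P lam}"
  by (rule finite_subset[OF _ finite_psize_eq[of n]]) auto

text \<open>Taking the coefficient of the power \<open>l\<close> of a new largest variable amounts
  to skewing by h_l.\<close>

lemma comb_schur_step:
  assumes "\<And>x. x \<in># m \<Longrightarrow> x < N"
  shows "comb schur c (m + replicate_mset l N) = comb schur (skew_h l c) m"
proof -
  have st: "schur lam (m + replicate_mset l N) =
      (\<Sum>mu | horizontal_strip lam mu \<and> psize lam = psize mu + l. schur mu m)" for lam
    by (rule schur_step') (rule assms)
  have "comb schur c (m + replicate_mset l N) =
      (\<Sum>lam | psize lam = size m + l. \<Sum>mu | psize mu = size m. if horizontal_strip lam mu
          then c lam * schur mu m else 0)"
    unfolding comb_schur st sum_distrib_left size_union size_replicate_mset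
  proof (rule sum.cong[OF refl])
    fix lam assume "lam \<in> {lam. psize lam = size m + l}"
    then show "(\<Sum>mu | horizontal_strip lam mu \<and> psize lam = psize mu + l. c lam * schur mu m) =
        (\<Sum>mu | psize mu = size m. if horizontal_strip lam mu then c lam * schur mu m else 0)"
      by (intro sum.mono_neutral_cong_left) auto
  qed
  also have "\<dots> = (\<Sum>mu | psize mu = size m. \<Sum>lam | psize lam = size m + l. if
      horizontal_strip lam mu then c lam * schur mu m else 0)"
    by (rule sum.swap)
  also have "\<dots> = (\<Sum>mu | psize mu = size m. skew_h l c mu * schur mu m)"
  proof (rule sum.cong[OF refl])
    fix mu assume "mu \<in> {mu. psize mu = size m}"
    then show "(\<Sum>lam | psize lam = size m + l. if horizontal_strip lam mu then c lam * schur
        mu m else 0) =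
        skew_h l c mu * schur mu m"
      unfolding skew_h_def sum_distrib_right by (intro sum.mono_neutral_cong_right) auto
  qed
  finally show ?thesis by (simp add: comb_schur)
qed

lemma comb_conj_comb: "comb schur (conj_comb c) m =
    (- 1) ^ size m * (\<Sum>lam | psize lam = size m. c lam * schur (conjugate lam) m)"
proof -
  have "comb schur (conj_comb c) m = (\<Sum>lam | psize lam = size m. conj_comb c (conjugate lam) *
      schur (conjugate lam) m)"
    unfolding comb_schur by (rule sum.reindex_bij_witness[of _ conjugate conjugate]) auto
  then show ?thesis by (simp add: conj_comb_def sum_distrib_left mult_ac)
qed

text \<open>Behind the antipode, conjugation turns horizontal strips into vertical ones, so a new
  largest variable skews by e_l, up to the sign of degree \<open>l\<close>.\<close>

lemma comb_conj_comb_step: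
  assumes "\<And>x. x \<in># m \<Longrightarrow> x < N"
  shows "comb schur (conj_comb c) (m + replicate_mset l N) = (- 1) ^ l * comb schur (conj_comb
      (skew_e l c)) m"
proof -
  have st: "schur (conjugate lam) (m + replicate_mset l N) =
      (\<Sum>mu | vertical_strip lam mu \<and> psize lam = psize mu + l. schur (conjugate mu) m)" for lam
    by (rule schur_conjugate_step) (rule assms)
  have "(\<Sum>lam | psize lam = size m + l. c lam * schur (conjugate lam) (m + replicate_mset l N)) =
      (\<Sum>lam | psize lam = size m + l. \<Sum>mu | psize mu = size m. if vertical_strip lam mu
          then c lam * schur (conjugate mu) m else 0)"
    unfolding st sum_distrib_left
  proof (rule sum.cong[OF refl])
    fix lam assume "lam \<in> {lam. psize lam = size m + l}"
    then show "(\<Sum>mu | vertical_strip lam mu \<and> psize lam = psize mu + l. c lam * schur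
        (conjugate mu) m) =
        (\<Sum>mu | psize mu = size m. if vertical_strip lam mu then c lam * schur (conjugate mu) m
            else 0)"
      by (intro sum.mono_neutral_cong_left) auto
  qed
  also have "\<dots> = (\<Sum>mu | psize mu = size m. \<Sum>lam | psize lam = size m + l. if
      vertical_strip lam mu then c lam * schur (conjugate mu) m else 0)"
    by (rule sum.swap)
  also have "\<dots> = (\<Sum>mu | psize mu = size m. skew_e l c mu * schur (conjugate mu) m)"
  proof (rule sum.cong[OF refl])
    fix mu assume "mu \<in> {mu. psize mu = size m}"
    then show "(\<Sum>lam | psize lam = size m + l. if vertical_strip lam mu then c lam * schur
        (conjugate mu) m else 0) =
        skew_e l c mu * schur (conjugate mu) m"
      unfolding skew_e_def sum_distrib_right by (intro sum.mono_neutral_cong_right) auto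
  qed
  finally show ?thesis by (simp add: comb_conj_comb power_add mult_ac)
qed

text \<open>The adjoint form of the relation that the sum of (-1)^i e_i h_(k-i) is zero for k > 0.
  The composite runs over chains from \<open>mu\<close> by a vertical strip to \<open>nu\<close> and
  by a horizontal strip to \<open>lam\<close>; for each \<open>lam\<close> the signs cancel over
  \<open>nu\<close>.\<close>

lemma skew_cancellation:
  "(\<Sum>i\<le>k. (- 1) ^ i * skew_e i (skew_h (k - i) c) mu) = (if k = 0 then c mu else 0)"
proof -
  let ?L = "{lam. psize lam = psize mu + k}"
  have "(\<Sum>i\<le>k. (- 1) ^ i * skew_e i (skew_h (k - i) c) mu) =
      (\<Sum>i\<le>k. \<Sum>nu | psize nu = psize mu + i \<and> vertical_strip nu mu. \<Sum>lam\<in>?L.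
        if horizontal_strip lam nu then (- 1) ^ (psize nu + psize mu) * c lam else 0)"
    unfolding skew_e_def skew_h_def sum_distrib_left
  proof (rule sum.cong[OF refl], rule sum.cong[OF refl])
    fix i nu assume "i \<in> {..k}" and nu: "nu \<in> {nu. psize nu = psize mu + i \<and>
        vertical_strip nu mu}"
    moreover have "(- 1 :: int) ^ (psize nu + psize mu) = (- 1) ^ i" using nu by (simp add: power_add)
    ultimately show "(\<Sum>lam | psize lam = psize nu + (k - i) \<and> horizontal_strip lam nu. (-
        1) ^ i * c lam) =
        (\<Sum>lam\<in>?L. if horizontal_strip lam nu then (- 1) ^ (psize nu + psize mu) * c lam else 0)"
      by (intro sum.mono_neutral_cong_left) auto
  qed
  also have "\<dots> = (\<Sum>lam\<in>?L. \<Sum>i\<le>k. \<Sum>nu | psize nu = psize mu + i \<and>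
      vertical_strip nu mu.
        if horizontal_strip lam nu then (- 1) ^ (psize nu + psize mu) * c lam else 0)"
    by (subst (2) sum.swap, subst sum.swap) simp
  also have "\<dots> = (\<Sum>lam\<in>?L. (- 1) ^ psize mu * c lam *
      (\<Sum>nu | vertical_strip nu mu \<and> horizontal_strip lam nu. (- 1) ^ psize nu))"
  proof (rule sum.cong[OF refl])
    fix lam assume lam: "lam \<in> ?L"
    have bounds: "psize mu \<le> psize nu" "psize nu \<le> psize lam" if "vertical_strip nu mu"
        "horizontal_strip lam nu" for nu
      using that psize_mono[of mu nu] psize_mono[of nu lam]
      by (auto simp: vertical_strip_iff horizontal_strip_iff diagram_subset_iff)
    have fin: "finite {nu. psize nu \<le> psize lam \<and> vertical_strip nu mu}"
      by (rule finite_subset[OF _ finite_psize_le[of "psize lam"]]) auto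
    have "(\<Sum>i\<le>k. \<Sum>nu | psize nu = psize mu + i \<and> vertical_strip nu mu.
        if horizontal_strip lam nu then (- 1) ^ (psize nu + psize mu) * c lam else 0) =
      (\<Sum>i\<le>k. \<Sum>nu | vertical_strip nu mu \<and> horizontal_strip lam nu \<and> psize
          nu - psize mu = i.
        (- 1) ^ (psize nu + psize mu) * c lam)"
      by (rule sum.cong[OF refl], rule sum.mono_neutral_cong_right) (use bounds in \<open>auto
          dest: bounds\<close>)
    also have "\<dots> = (\<Sum>nu | vertical_strip nu mu \<and> horizontal_strip lam nu. (- 1) ^
        (psize nu + psize mu) * c lam)"
    proof -
      have "finite {nu. vertical_strip nu mu \<and> horizontal_strip lam nu}"
        by (rule finite_subset[OF _ fin]) (use bounds in auto)
      moreover have "psize nu - psize mu \<le> k" if "vertical_strip nu mu" "horizontal_strip lam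
          nu" for nu
        using bounds[OF that] lam by simp
      ultimately show ?thesis
        using sum.group[of "{nu. vertical_strip nu mu \<and> horizontal_strip lam nu}" "{..k}"
            "\<lambda>nu. psize nu - psize mu"
            "\<lambda>nu. (- 1) ^ (psize nu + psize mu) * c lam"]
        by (force simp: conj_assoc)
    qed
    finally show "(\<Sum>i\<le>k. \<Sum>nu | psize nu = psize mu + i \<and> vertical_strip nu mu.
        if horizontal_strip lam nu then (- 1) ^ (psize nu + psize mu) * c lam else 0) =
      (- 1) ^ psize mu * c lam * (\<Sum>nu | vertical_strip nu mu \<and> horizontal_strip lam nu.
          (- 1) ^ psize nu)"
      by (simp add: sum_distrib_left power_add mult_ac)
  qed
  also have "\<dots> = (\<Sum>lam\<in>?L. if lam = mu then c mu else 0)"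
    unfolding strip_cancellation by (rule sum.cong) (auto simp flip: power_add)
  also have "\<dots> = (if k = 0 then c mu else 0)" by simp
  finally show ?thesis .
qed

text \<open>Let the largest variable have exponent \<open>k\<close>. Its \<open>i\<close> copies in
  the factor with the antipode act by \<open>(- 1) ^ i\<close> times \<open>skew_e i\<close>, the
  other \<open>k - i\<close> copies by \<open>skew_h (k - i)\<close>, both on the same coordinates
  \<open>c a\<close>. The cancellation over \<open>i\<close> leaves only \<open>k = 0\<close>, which
  is the induction hypothesis.\<close>

lemma antip_convolution:
  assumes "symmetric f"
  shows "(\<Sum>a | a \<subseteq># m. series_antip (\<lambda>x. series_comul f (x, m - a)) a) = (if
      m = {#} then f {#} else 0)"
proof (induction m rule: mset_max_induct)
  case empty
  have "{a. a \<subseteq># {#}} = {{#} :: monomial}" by auto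
  moreover obtain c where c: "f = comb schur c" using assms symmetric_iff_comb by blast
  have "series_antip f {#} = f {#}"
    unfolding c series_antip_comb comb_conj_comb unfolding comb_schur by simp
  ultimately show ?case by (simp add: comul_empty_right[OF assms])
next
  case (add m N k)
  have N: "N \<notin># m" using add.hyps by blast
  define c where "c = (\<lambda>a. coords schur (\<lambda>x. series_comul f (x, m - a)))"
  have sym: "symmetric (\<lambda>x. series_comul f (x, b))" for b
    using bisymmetric_comul[OF assms] by (simp add: bisymmetric_def)
  have comb_c: "comb schur (c a) = (\<lambda>x. series_comul f (x, m - a))" for a
    unfolding c_def by (rule comb_coords_schur[OF sym])
  have step: "(\<lambda>x. series_comul f (x, m - a + replicate_mset j N)) = comb schur (skew_h j (c a))"
    if a: "a \<subseteq># m" for a j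
  proof (rule symmetric_eqI[OF sym symmetric_comb_schur])
    fix mu
    define x where "x = part_mset mu"
    text \<open>Rename the variables of the second factor beyond those of \<open>x\<close>.\<close>
    define d where "d = Suc (Max (insert 0 (set_mset x)))"
    define \<tau> where "\<tau> = (\<lambda>i. i + d)"
    have xd: "i < d" if "i \<in># x" for i
      using that by (auto simp: d_def less_Suc_eq_le intro!: Max_ge)
    have inj: "inj_on \<tau> A" for A by (auto simp: \<tau>_def inj_on_def)
    define b where "b = image_mset \<tau> (m - a)"
    have disj: "set_mset x \<inter> set_mset (image_mset \<tau> e) = {}" for e
      using xd by (fastforce simp: \<tau>_def)
    have "series_comul f (x, m - a + replicate_mset j N) = f (x + image_mset \<tau> (m - a +
        replicate_mset j N))"
      by (rule symmetric_comul_disjoint[OF assms refl inj disj])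
    also have "\<dots> = f ((x + replicate_mset j (N + d)) + b)"
      by (simp add: b_def \<tau>_def add_ac)
    \<comment> \<open>By symmetry the shifted variable \<open>N + d\<close> may change sides. In the
      first factor it exceeds all variables of \<open>x\<close>, so its exponent acts by
      skewing.\<close>
    also have "\<dots> = series_comul f (x + replicate_mset j (N + d), m - a)"
    proof (rule symmetric_comul_disjoint[OF assms b_def inj, symmetric])
      have "N \<notin># m - a" using N in_diffD by fast
      then show "set_mset (x + replicate_mset j (N + d)) \<inter> set_mset b = {}"
        using disj[of "m - a"] by (auto simp: b_def \<tau>_def)
    qed
    also have "\<dots> = comb schur (c a) (x + replicate_mset j (N + d))" by (simp add: comb_c)
    also have "\<dots> = comb schur (skew_h j (c a)) x"
      by (rule comb_schur_step) (use xd in \<open>auto intro: trans_less_add2\<close>)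
    finally show "series_comul f (part_mset mu, m - a + replicate_mset j N) =
        comb schur (skew_h j (c a)) (part_mset mu)" by (simp add: x_def)
  qed
  have "(\<Sum>a | a \<subseteq># m + replicate_mset k N. series_antip (\<lambda>x. series_comul f
      (x, m + replicate_mset k N - a)) a) =
      (\<Sum>a | a \<subseteq># m. \<Sum>i\<le>k. series_antip (\<lambda>x. series_comul f (x, m +
          replicate_mset k N - (a + replicate_mset i N))) (a + replicate_mset i N))"
    by (subst sum_submultisets_union) (use N in \<open>auto simp: sum_submultisets_replicate\<close>)
  also have "\<dots> = (\<Sum>a | a \<subseteq># m. \<Sum>i\<le>k. (- 1) ^ i * comb schur
      (conj_comb (skew_e i (skew_h (k - i) (c a)))) a)"
  proof (intro sum.cong refl)
    fix a i assume "a \<in> {a. a \<subseteq># m}" and i: "i \<in> {..k}"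
    then have a: "a \<subseteq># m" by simp
    have st: "comb schur (conj_comb e) (a + replicate_mset i N) = (- 1) ^ i * comb schur (conj_comb
        (skew_e i e)) a" for e
      by (rule comb_conj_comb_step) (use add.hyps mset_subset_eqD[OF a] in blast)
    have "m + replicate_mset k N - (a + replicate_mset i N) = m - a + replicate_mset (k - i) N"
      using a i N by (auto simp: multiset_eq_iff not_in_iff subseteq_mset_def)
    then show "series_antip (\<lambda>x. series_comul f (x, m + replicate_mset k N - (a +
        replicate_mset i N))) (a + replicate_mset i N) =
        (- 1) ^ i * comb schur (conj_comb (skew_e i (skew_h (k - i) (c a)))) a"
      by (simp only: step[OF a] series_antip_comb st)
  qed
  also have "\<dots> = (\<Sum>a | a \<subseteq># m. (- 1) ^ size a * (\<Sum>lam | psize lam = size a.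
      (\<Sum>i\<le>k. (- 1) ^ i * skew_e i (skew_h (k - i) (c a)) lam) * schur (conjugate lam) a))"
    unfolding comb_conj_comb sum_distrib_right sum_distrib_left
    by (rule sum.cong[OF refl], subst sum.swap) (simp add: mult_ac)
  also have "\<dots> = (if k = 0 then \<Sum>a | a \<subseteq># m. series_antip (\<lambda>x.
      series_comul f (x, m - a)) a else 0)"
    unfolding skew_cancellation comb_c[symmetric] series_antip_comb comb_conj_comb by simp
  also have "\<dots> = (if m + replicate_mset k N = {#} then f {#} else 0)"
    unfolding add.IH by (cases k) auto
  finally show ?case .
qed

section \<open>The two Hopf algebras\<close>

lemma series_antip_eq_comb: "symmetric f \<Longrightarrow> series_antip f = comb schur (conj_comb
    (coords schur f))"
  using series_antip_comb[of "coords schur f"] by (simp add: comb_coords_schur)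

lemma symmetric_add: "symmetric f \<Longrightarrow> symmetric g \<Longrightarrow> symmetric (f + g)"
  by (simp add: symmetric_def)

lemma symmetric_minus: "symmetric f \<Longrightarrow> symmetric (- f)"
  by (simp add: symmetric_def)

lemma symmetric_zero: "symmetric 0"
  by (simp add: symmetric_def)

lemma bisymmetric_tensor: "symmetric f \<Longrightarrow> symmetric g \<Longrightarrow> bisymmetric
    (tensor f g)"
  by (simp add: bisymmetric_def symmetric_def tensor_def)

lemma symmetric_one: "symmetric series_one"
  by (simp add: symmetric_def series_one_def)

lemma series_one_empty: "series_one {#} = 1"
  by (simp add: series_one_def)

lemma series_antip_add:
  assumes "symmetric f" "symmetric g"
  shows "series_antip (f + g) = series_antip f + series_antip g"
proof -
  obtain c d where c: "f = comb schur c" and d: "g = comb schur d"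
    using assms symmetric_iff_comb by blast
  have "conj_comb (\<lambda>i. c i + d i) = (\<lambda>i. conj_comb c i + conj_comb d i)"
    by (auto simp: conj_comb_def distrib_left)
  then show ?thesis
    unfolding c d by (simp add: series_antip_comb flip: schur.comb_plus)
qed

text \<open>The algebraic laws hold for all symmetric series, so a carrier inside them only has to
  be closed under the operations. Both Hopf algebras are obtained this way.\<close>

lemma hopf_algebra_symmetric:
  assumes carr: "C \<subseteq> Collect symmetric" "additive_subgroup C"
    and square: "Q \<subseteq> Collect bisymmetric" "additive_subgroup Q"
    and tensor: "\<And>f g. f \<in> C \<Longrightarrow> g \<in> C \<Longrightarrow> tensor f g \<in> Q"
    and one: "series_one \<in> C"
    and mul: "\<And>F. F \<in> Q \<Longrightarrow> series_mul F \<in> C"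
    and comul: "\<And>f. f \<in> C \<Longrightarrow> series_comul f \<in> Q"
    and antip: "\<And>f. f \<in> C \<Longrightarrow> series_antip f \<in> C"
  shows "hopf_algebra \<lparr>carr = C, square = Q, one = series_one, mul = series_mul,
    counit = (\<lambda>f. f {#}), comul = series_comul, antip = series_antip\<rparr>"
proof -
  have sym: "symmetric f" if "f \<in> C" for f using carr that by blast
  have sub_empty: "{a. a \<subseteq># {#}} = {{#} :: monomial}" by auto
  show ?thesis
  proof (unfold_locales, unfold hopf.simps)
    show "additive_on Q series_mul"
      by (auto simp: additive_on_def series_mul_def sum.distrib fun_eq_iff)
    show "additive_on C (\<lambda>f. f {#})" by (simp add: additive_on_def)
    show "additive_on C series_comul"
      by (auto simp: additive_on_def series_comul_def fun_eq_iff)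
    show "additive_on C series_antip"
      by (simp add: additive_on_def series_antip_add sym)
  next
    fix f a b c assume "f \<in> C"
    then show "on_left series_comul (series_comul f) ((a, b), c) =
        on_right series_comul (series_comul f) (a, (b, c))"
      using comul_coassoc[OF sym, of f a b c] by (simp add: on_left_def on_right_def series_comul_eq)
  next
    fix f g assume "f \<in> C" "g \<in> C"
    show "series_comul (series_mul (tensor f g)) = square_mul
        \<lparr>carr = C, square = Q, one = series_one, mul = series_mul,
          counit = (\<lambda>f. f {#}), comul = series_comul, antip = series_antip\<rparr>
        (series_comul f) (series_comul g)"
      by (simp add: square_mul_def fun_eq_iff comul_mul split_def)
    show "series_mul (tensor f g) {#} = f {#} * g {#}"
      by (simp add: series_mul_def tensor_def sub_empty)
  next
    fix f assume f: "f \<in> C"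
    show "series_mul (on_left series_antip (series_comul f)) = (\<lambda>m. f {#} * series_one m)"
    proof
      fix m
      show "series_mul (on_left series_antip (series_comul f)) m = f {#} * series_one m"
        using antip_convolution[OF sym[OF f], of m]
        by (simp add: series_mul_def on_left_def series_one_def)
    qed
    \<comment> \<open>Cocommutativity and passing to complementary divisors reduce this axiom to the
      preceding one.\<close>
    show "series_mul (on_right series_antip (series_comul f)) = (\<lambda>m. f {#} * series_one m)"
    proof
      fix m
      have "series_mul (on_right series_antip (series_comul f)) m =
          (\<Sum>a | a \<subseteq># m. series_antip (\<lambda>x. series_comul f (x, a)) (m - a))"
        unfolding series_mul_def on_right_def prod.case
        by (simp only: comul_commute[OF sym[OF f]])
      also have "\<dots> = (\<Sum>a | a \<subseteq># m. series_antip (\<lambda>x. series_comul f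
          (x, m - a)) a)"
        using sum_submultisets_complement[of "\<lambda>a b. series_antip (\<lambda>x. series_comul
            f (x, a)) b" m] by simp
      finally show "series_mul (on_right series_antip (series_comul f)) m = f {#} * series_one m"
        using antip_convolution[OF sym[OF f], of m] by (simp add: series_one_def)
    qed
  qed (use carr square tensor one mul comul antip in
      \<open>simp_all add: series_mul_assoc series_one_mul series_mul_one comul_one sym
        comul_empty_left comul_empty_right series_one_empty\<close>)
qed

lemma bisymmetric_add: "bisymmetric F \<Longrightarrow> bisymmetric G \<Longrightarrow> bisymmetric
    (F + G)"
  by (simp add: bisymmetric_def symmetric_def)

lemma bisymmetric_minus: "bisymmetric F \<Longrightarrow> bisymmetric (- F)"
  by (simp add: bisymmetric_def symmetric_def)

lemma bisymmetric_zero: "bisymmetric 0"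
  by (simp add: bisymmetric_def symmetric_def)

lemmas symmetric_closed = symmetric_add symmetric_minus symmetric_zero symmetric_one symmetric_mul
  symmetric_antip bisymmetric_add bisymmetric_minus bisymmetric_zero bisymmetric_tensor bisymmetric_comul

lemma hopf_algebra_m_Sym: "hopf_algebra m_Sym"
proof -
  have "m_Sym = \<lparr>carr = Collect symmetric, square = Collect bisymmetric, one = series_one,
      mul = series_mul,
    counit = (\<lambda>f. f {#}), comul = series_comul, antip = series_antip\<rparr>"
    using m_Sym_simps(1,2) by (simp add: m_Sym_def)
  moreover have "hopf_algebra \<dots>"
    by (rule hopf_algebra_symmetric) (auto simp: additive_subgroup_def symmetric_closed)
  ultimately show ?thesis by simp
qed

lemma bounded_degree_antip:
  assumes "symmetric f" "bounded_degree f"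
  shows "bounded_degree (series_antip f)"
proof -
  obtain d where d: "\<And>m. d < size m \<Longrightarrow> f m = 0" using assms by (auto simp:
      bounded_degree_def)
  have "coords schur f lam = 0" if "d < psize lam" for lam
    by (rule coords_schur_eq_0[OF assms(1)]) (use d that in simp)
  then have "series_antip f m = 0" if "d < size m" for m
    unfolding series_antip_eq_comb[OF assms(1)] comb_schur
    using that by (intro sum.neutral) (auto simp: conj_comb_def)
  then show ?thesis by (auto simp: bounded_degree_def)
qed

lemma bounded_degree_mul: "bounded_degree2 F \<Longrightarrow> bounded_degree (series_mul F)"
proof -
  assume "bounded_degree2 F"
  then obtain d where d: "\<And>a b. d < size a + size b \<Longrightarrow> F (a, b) = 0" by (auto
      simp: bounded_degree2_def)
  have "series_mul F m = 0" if "d < size m" for m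
    unfolding series_mul_def
  proof (rule sum.neutral, rule ballI)
    fix a assume "a \<in> {a. a \<subseteq># m}"
    then have "size a + size (m - a) = size m" by (simp flip: size_union)
    then show "F (a, m - a) = 0" using d[of a "m - a"] that by simp
  qed
  then show ?thesis by (auto simp: bounded_degree_def)
qed

lemma bounded_degree_comul: "bounded_degree f \<Longrightarrow> bounded_degree2 (series_comul f)"
proof -
  assume "bounded_degree f"
  then obtain d where "\<And>m. d < size m \<Longrightarrow> f m = 0" by (auto simp: bounded_degree_def)
  then have "\<forall>a b. d < size a + size b \<longrightarrow> series_comul f (a, b) = 0" by
      (simp add: series_comul_eq)
  then show ?thesis unfolding bounded_degree2_def by blast
qed

lemma bounded_degree_tensor:
  assumes "bounded_degree f" "bounded_degree g"
  shows "bounded_degree2 (tensor f g)"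
proof -
  obtain d e where "\<And>m. d < size m \<Longrightarrow> f m = 0" "\<And>m. e < size m
      \<Longrightarrow> g m = 0"
    using assms by (auto simp: bounded_degree_def)
  then have "tensor f g (a, b) = 0" if "d + e < size a + size b" for a b
    using that by (cases "d < size a") (auto simp: tensor_def)
  then show ?thesis by (auto simp: bounded_degree2_def)
qed

lemma bounded_degree_add: "bounded_degree f \<Longrightarrow> bounded_degree g \<Longrightarrow>
    bounded_degree (f + g)"
proof -
  assume "bounded_degree f" "bounded_degree g"
  then obtain d e where "\<And>m. d < size m \<Longrightarrow> f m = 0" "\<And>m. e < size m
      \<Longrightarrow> g m = 0"
    by (auto simp: bounded_degree_def)
  then have "\<forall>m. max d e < size m \<longrightarrow> (f + g) m = 0" by simp
  then show ?thesis unfolding bounded_degree_def by blast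
qed

lemma bounded_degree2_add: "bounded_degree2 f \<Longrightarrow> bounded_degree2 g \<Longrightarrow>
    bounded_degree2 (f + g)"
proof -
  assume "bounded_degree2 f" "bounded_degree2 g"
  then obtain d e where "\<And>a b. d < size a + size b \<Longrightarrow> f (a, b) = 0" "\<And>a b.
      e < size a + size b \<Longrightarrow> g (a, b) = 0"
    by (auto simp: bounded_degree2_def)
  then have "\<forall>a b. max d e < size a + size b \<longrightarrow> (f + g) (a, b) = 0" by simp
  then show ?thesis unfolding bounded_degree2_def by blast
qed

lemma bounded_degree_simple: "bounded_degree 0" "bounded_degree2 0" "bounded_degree series_one"
    "bounded_degree f \<Longrightarrow> bounded_degree (- f)" "bounded_degree2 F \<Longrightarrow>
        bounded_degree2 (- F)"
  by (auto simp: bounded_degree_def bounded_degree2_def series_one_def)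

lemma hopf_algebra_M_Sym: "hopf_algebra M_Sym"
proof -
  have "M_Sym = \<lparr>carr = {f. symmetric f \<and> bounded_degree f}, square = {F. bisymmetric F
      \<and> bounded_degree2 F},
    one = series_one, mul = series_mul,
    counit = (\<lambda>f. f {#}), comul = series_comul, antip = series_antip\<rparr>"
    using M_Sym_simps(1,2) by (simp add: M_Sym_def)
  moreover have "hopf_algebra \<dots>"
    by (rule hopf_algebra_symmetric)
      (auto simp: additive_subgroup_def symmetric_closed bounded_degree_simple bounded_degree_add
        bounded_degree2_add bounded_degree_tensor bounded_degree_mul bounded_degree_comul
            bounded_degree_antip)
  ultimately show ?thesis by simp
qed

section \<open>Adjointness of product and coproduct\<close>

text \<open>The Littlewood-Richardson coefficients, defined through the coproduct.\<close>

definition lr :: "partition \<Rightarrow> partition \<times> partition \<Rightarrow> int" where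
  "lr nu = coords (tensor_family schur) (series_comul (schur nu))"

lemma comb_lr: "comb (tensor_family schur) (lr nu) = series_comul (schur nu)"
  unfolding lr_def by (rule comb_coords_tensor[OF bisymmetric_comul[OF symmetric_schur]])

lemma kernel_even_odd:
  "kernel (even_vars a + odd_vars b) m = (\<Sum>c | c \<subseteq># m. kernel a c * kernel b (m - c))"
proof -
  have "inj_on (\<lambda>i::nat. 2 * i) A" "inj_on (\<lambda>i::nat. 2 * i + 1) A" for A by (auto
      simp: inj_on_def)
  then have "kernel (even_vars a) c = kernel a c" "kernel (odd_vars b) c = kernel b c" for c
    unfolding kernel_commute[of _ c] even_vars_def odd_vars_def by (simp_all add: kernel_image)
  then show ?thesis by (simp add: kernel_add[OF even_odd_disjoint])
qed

text \<open>The kernel is multiplicative in its first argument, which makes the structure constants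
    of the
  coproduct those of the product.\<close>

lemma mul_schur: "series_mul (tensor (schur lam) (schur mu)) = comb schur (\<lambda>nu. lr nu (lam, mu))"
proof
  fix m :: monomial
  \<comment> \<open>The claim is tested for all pairs at once: both coefficient functions, expanded
    in the tensor basis, give the coefficient of \<open>m\<close> in the product of two
    kernels.\<close>
  have "comb (tensor_family schur) (\<lambda>p. \<Sum>nu | psize nu = size m. lr nu p * schur nu m) =
      comb (tensor_family schur) (\<lambda>p. series_mul (tensor_family schur p) m)"
  proof
    fix ab :: "monomial \<times> monomial"
    obtain a b where ab: "ab = (a, b)" by fastforce
    have "comb (tensor_family schur) (\<lambda>p. \<Sum>nu | psize nu = size m. lr nu p * schur nu
        m) (a, b) =
        (\<Sum>nu | psize nu = size m. comb (tensor_family schur) (lr nu) (a, b) * schur nu m)"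
      unfolding comb_tensor_schur_degree sum_distrib_right
      by (subst sum.swap) (simp add: mult_ac)
    also have "\<dots> = (\<Sum>c | c \<subseteq># m. kernel a c * kernel b (m - c))"
      unfolding comb_lr series_comul_eq schur_Cauchy_identity kernel_even_odd ..
    also have "\<dots> = (\<Sum>c | c \<subseteq># m. (\<Sum>lam | psize lam = size a. schur lam c
        * schur lam a) *
        (\<Sum>mu | psize mu = size b. schur mu (m - c) * schur mu b))"
      unfolding schur_Cauchy_identity by (simp add: kernel_commute)
    also have "\<dots> = comb schur (\<lambda>lam. comb schur (\<lambda>mu. series_mul
        (tensor_family schur (lam, mu)) m) b) a"
      unfolding comb_schur series_mul_def sum_product sum_distrib_right tensor_family_Pair
      by (subst sum.swap, rule sum.cong[OF refl], subst sum.swap) (simp add: sum_distrib_left mult_ac)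
    finally show "comb (tensor_family schur) (\<lambda>p. \<Sum>nu | psize nu = size m. lr nu p *
        schur nu m) ab =
      comb (tensor_family schur) (\<lambda>p. series_mul (tensor_family schur p) m) ab"
      by (simp add: ab comb_tensor_schur)
  qed
  then have "(\<lambda>p. \<Sum>nu | psize nu = size m. lr nu p * schur nu m) = (\<lambda>p.
      series_mul (tensor_family schur p) m)"
    by (simp only: schur2.comb_inject)
  from fun_cong[OF this, of "(lam, mu)"]
  show "series_mul (tensor (schur lam) (schur mu)) m = comb schur (\<lambda>nu. lr nu (lam, mu)) m"
    by (simp add: comb_schur tensor_family_def)
qed

text \<open>Since degrees add, each coordinate of the product is a finite sum even for an infinite
  combination \<open>c\<close>.\<close>

lemma mul_comb:
  "series_mul (comb (tensor_family schur) c) = comb schur (\<lambda>nu. \<Sum>p | psize2 p = psize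
      nu. c p * lr nu p)"
proof
  fix m :: monomial
  have "series_mul (comb (tensor_family schur) c) m =
      (\<Sum>a | a \<subseteq># m. \<Sum>p | psize2 p = size m. c p * tensor_family schur p (a, m - a))"
    unfolding series_mul_def comb_tensor_schur_degree
  proof (rule sum.cong[OF refl])
    fix a assume "a \<in> {a. a \<subseteq># m}"
    then have "size a + size (m - a) = size m" by (simp flip: size_union)
    then show "(\<Sum>p | psize2 p = size a + size (m - a). c p * tensor_family schur p (a, m - a)) =
      (\<Sum>p | psize2 p = size m. c p * tensor_family schur p (a, m - a))" by simp
  qed
  also have "\<dots> = (\<Sum>p | psize2 p = size m. c p * series_mul (tensor_family schur p) m)"
    unfolding series_mul_def sum_distrib_left by (rule sum.swap)
  also have "\<dots> = (\<Sum>p | psize2 p = size m. \<Sum>nu | psize nu = size m. c p * lr nu p *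
      schur nu m)"
  proof (rule sum.cong[OF refl])
    fix p
    show "c p * series_mul (tensor_family schur p) m = (\<Sum>nu | psize nu = size m. c p * lr nu p
        * schur nu m)"
      by (cases p) (simp add: tensor_family_def mul_schur comb_schur sum_distrib_left mult_ac)
  qed
  also have "\<dots> = comb schur (\<lambda>nu. \<Sum>p | psize2 p = psize nu. c p * lr nu p) m"
    unfolding comb_schur sum_distrib_right by (subst sum.swap) (rule sum.cong, auto)
  finally show "series_mul (comb (tensor_family schur) c) m =
    comb schur (\<lambda>nu. \<Sum>p | psize2 p = psize nu. c p * lr nu p) m" .
qed

lemma comul_comb:
  "series_comul (comb schur d) = comb (tensor_family schur) (\<lambda>p. \<Sum>nu | psize nu =
      psize2 p. d nu * lr nu p)"
proof
  fix ab :: "monomial \<times> monomial"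
  obtain a b where ab: "ab = (a, b)" by fastforce
  have "series_comul (comb schur d) (a, b) =
      (\<Sum>nu | psize nu = size a + size b. d nu * comb (tensor_family schur) (lr nu) (a, b))"
    unfolding comb_lr series_comul_eq comb_schur by simp
  also have "\<dots> = (\<Sum>p | psize2 p = size a + size b. \<Sum>nu | psize nu = size a + size b.
      d nu * lr nu p * tensor_family schur p (a, b))"
    unfolding comb_tensor_schur_degree sum_distrib_left by (subst sum.swap) (simp add: mult_ac)
  also have "\<dots> = comb (tensor_family schur) (\<lambda>p. \<Sum>nu | psize nu = psize2 p. d nu
      * lr nu p) (a, b)"
    unfolding comb_tensor_schur_degree sum_distrib_right by (rule sum.cong) auto
  finally show "series_comul (comb schur d) ab =
    comb (tensor_family schur) (\<lambda>p. \<Sum>nu | psize nu = psize2 p. d nu * lr nu p) ab" by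
        (simp add: ab)
qed

text \<open>Both sides are the same finite double sum over \<open>nu\<close> and \<open>p\<close>
  with \<open>psize2 p = psize nu\<close>, taken in the two orders.\<close>

lemma mul_comul_pairing:
  assumes "(\<forall>p. D < psize2 p \<longrightarrow> c p = 0) \<or> (\<forall>nu. D < psize nu
      \<longrightarrow> d nu = 0)"
  shows "(\<Sum>nu | psize nu \<le> D. (\<Sum>p | psize2 p = psize nu. c p * lr nu p) * d nu) =
    (\<Sum>p | psize2 p \<le> D. c p * (\<Sum>nu | psize nu = psize2 p. d nu * lr nu p))"
proof -
  have "(\<Sum>nu | psize nu \<le> D. (\<Sum>p | psize2 p = psize nu. c p * lr nu p) * d nu) =
      (\<Sum>nu | psize nu \<le> D. \<Sum>p | psize2 p \<le> D. if psize2 p = psize nu then c p *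
          lr nu p * d nu else 0)"
    unfolding sum_distrib_right
    by (rule sum.cong[OF refl], rule sum.mono_neutral_cong_left) (auto simp: finite_psize2_le)
  also have "\<dots> = (\<Sum>p | psize2 p \<le> D. \<Sum>nu | psize nu \<le> D. if psize2 p =
      psize nu then c p * lr nu p * d nu else 0)"
    by (rule sum.swap)
  also have "\<dots> = (\<Sum>p | psize2 p \<le> D. c p * (\<Sum>nu | psize nu = psize2 p. d nu *
      lr nu p))"
    unfolding sum_distrib_left
    by (rule sum.cong[OF refl], rule sum.mono_neutral_cong_right) (auto simp: finite_psize_le)
  finally show ?thesis .
qed

section \<open>The Hall pairing in Schur coordinates\<close>

lemma hall_comb:
  assumes "\<And>nu. D < psize nu \<Longrightarrow> c nu * d nu = 0"
  shows "hall (comb schur c) (comb schur d) = (\<Sum>nu | psize nu \<le> D. c nu * d nu)"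
  unfolding hall_def by (rule schur.pairing_comb) (use assms in \<open>auto simp:
      finite_psize_le\<close>)

lemma hall2_comb:
  assumes "\<And>p. D < psize2 p \<Longrightarrow> c p * d p = 0"
  shows "hall2 (comb (tensor_family schur) c) (comb (tensor_family schur) d) = (\<Sum>p | psize2 p
      \<le> D. c p * d p)"
  unfolding hall2_def by (rule schur2.pairing_comb[OF finite_psize2_le]) (use assms in auto)

text \<open>The finite argument supplies a degree \<open>D\<close> at which both pairings can be cut
  off, whereupon \<open>mul_comul_pairing\<close> compares them. In \<open>hall_comul\<close> the
  bound comes from \<open>f\<close> instead.\<close>

lemma hall_mul:
  assumes F: "F \<in> fin_span (tensor_family schur)" and h: "symmetric h"
  shows "hall (series_mul F) h = hall2 F (series_comul h)"
proof -
  obtain c where c: "finite {p. c p \<noteq> 0}" "F = comb (tensor_family schur) c"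
    using F by (auto simp: schur2.fin_span_eq)
  obtain d where d: "h = comb schur d" using h symmetric_iff_comb by blast
  obtain D where D: "\<And>p. D < psize2 p \<Longrightarrow> c p = 0" using finite_support_bound[OF
      c(1)] by blast
  show ?thesis
    unfolding c(2) d mul_comb comul_comb
    by (subst hall_comb[of D], use D in simp, subst hall2_comb[of D], use D in simp,
      rule mul_comul_pairing, use D in blast)
qed

lemma hall_comul:
  assumes f: "f \<in> fin_span schur" and K: "bisymmetric K"
  shows "hall2 (series_comul f) K = hall f (series_mul K)"
proof -
  obtain d where d: "finite {p. d p \<noteq> 0}" "f = comb schur d"
    using f by (auto simp: schur.fin_span_eq)
  obtain c where c: "K = comb (tensor_family schur) c" using K bisymmetric_iff_comb by blast
  obtain D where D: "\<And>nu. D < psize nu \<Longrightarrow> d nu = 0" using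
      finite_support_bound[OF d(1)] by blast
  have "hall2 (series_comul f) K = (\<Sum>p | psize2 p \<le> D. (\<Sum>nu | psize nu = psize2 p. d
      nu * lr nu p) * c p)"
    unfolding c d(2) comul_comb by (rule hall2_comb) (use D in simp)
  moreover have "hall f (series_mul K) = (\<Sum>nu | psize nu \<le> D. d nu * (\<Sum>p | psize2 p =
      psize nu. c p * lr nu p))"
    unfolding c d(2) mul_comb by (rule hall_comb) (use D in simp)
  moreover have "(\<Sum>nu | psize nu \<le> D. (\<Sum>p | psize2 p = psize nu. c p * lr nu p) * d nu) =
    (\<Sum>p | psize2 p \<le> D. c p * (\<Sum>nu | psize nu = psize2 p. d nu * lr nu p))"
    by (rule mul_comul_pairing) (use D in blast)
  ultimately show ?thesis by (simp add: mult.commute)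
qed

text \<open>Conjugation preserves the size, so reindexing by it carries \<open>conj_comb\<close>
  from one argument to the other.\<close>

lemma hall_antip:
  assumes f: "f \<in> fin_span schur" and h: "symmetric h"
  shows "hall (series_antip f) h = hall f (series_antip h)"
proof -
  obtain c where c: "finite {p. c p \<noteq> 0}" "f = comb schur c"
    using f by (auto simp: schur.fin_span_eq)
  obtain d where d: "h = comb schur d" using h symmetric_iff_comb by blast
  obtain D where D: "\<And>nu. D < psize nu \<Longrightarrow> c nu = 0" using
      finite_support_bound[OF c(1)] by blast
  have "hall (series_antip f) h = (\<Sum>nu | psize nu \<le> D. conj_comb c nu * d nu)"
    unfolding c(2) d series_antip_comb by (rule hall_comb) (use D in \<open>simp add:
        conj_comb_def\<close>)
  also have "\<dots> = (\<Sum>nu | psize nu \<le> D. c nu * conj_comb d nu)"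
    by (rule sum.reindex_bij_witness[of _ conjugate conjugate]) (auto simp: conj_comb_def mult_ac)
  also have "\<dots> = hall f (series_antip h)"
    unfolding c(2) d series_antip_comb by (rule hall_comb[symmetric]) (use D in simp)
  finally show ?thesis .
qed

lemma series_one_eq_comb: "series_one = comb schur (\<lambda>nu. if nu = empty_partition then 1 else 0)"
proof
  fix m
  show "series_one m = comb schur (\<lambda>nu. if nu = empty_partition then 1 else 0) m"
    unfolding schur.comb_unit
    using schur_nonzero[of empty_partition m] by (auto simp: series_one_def schur_empty)
qed

lemma hall_one:
  assumes "symmetric h"
  shows "hall series_one h = h {#}" "hall h series_one = h {#}"
proof -
  obtain d where d: "h = comb schur d" using assms symmetric_iff_comb by blast
  have "h {#} = d empty_partition" by (simp add: d comb_schur schur_empty)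
  moreover have "hall series_one h = (\<Sum>nu | psize nu \<le> 0. (if nu = empty_partition then 1
      else 0) * d nu)"
    unfolding d series_one_eq_comb by (rule hall_comb) auto
  moreover have "hall h series_one = (\<Sum>nu | psize nu \<le> 0. d nu * (if nu = empty_partition
      then 1 else 0))"
    unfolding d series_one_eq_comb by (rule hall_comb) auto
  ultimately show "hall series_one h = h {#}" "hall h series_one = h {#}" by simp_all
qed

theorem theorem9p15:
  shows "continuously_dual_hopf hall hall2 M_Sym m_Sym dual_groth groth \<and>
    continuously_dual hall (carr M_Sym) (carr m_Sym) dual_groth groth \<and>
    continuously_dual hall (carr M_Sym) (carr m_Sym) dual_groth_tilde K_tilde"
proof -
  \<comment> \<open>\<open>m_Sym\<close> is given by the span of \<open>K_tilde\<close> and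
    \<open>M_Sym\<close> by that of \<open>dual_groth\<close>. In terms of Schur functions the same
    two carriers serve for both dual pairs.\<close>
  have carr: "carr M_Sym = fin_span schur" "carr m_Sym = inf_span schur"
    by (simp_all add: M_Sym_simps m_Sym_simps fin_span_schur inf_span_schur)
  have square: "square M_Sym = fin_span (tensor_family schur)" "square m_Sym = inf_span
      (tensor_family schur)"
    by (simp_all add: M_Sym_simps m_Sym_simps fin_span_tensor_schur inf_span_tensor_schur)
  have dual: "continuously_dual hall (carr M_Sym) (carr m_Sym) dual_groth groth"
    unfolding carr hall_def by (rule groth.continuously_dual)
  have dual_tilde: "continuously_dual hall (carr M_Sym) (carr m_Sym) dual_groth_tilde K_tilde"
    unfolding carr hall_def by (rule groth_tilde.continuously_dual)
  \<comment> \<open>The tensor squares need no separate argument: the general duality is applied to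
    the Kronecker products of the transition matrices.\<close>
  have dual2: "continuously_dual hall2 (square M_Sym) (square m_Sym) (tensor_family dual_groth)
      (tensor_family groth)"
    unfolding square hall2_def by (rule dual_transition.continuously_dual[OF groth_tensor])
  have "continuously_dual_hopf hall hall2 M_Sym m_Sym dual_groth groth"
    unfolding continuously_dual_hopf_def
  proof (intro conjI dual dual2 hopf_algebra_M_Sym hopf_algebra_m_Sym ballI)
    fix F h assume "F \<in> square M_Sym" "h \<in> carr m_Sym"
    then show "hall (mul M_Sym F) h = hall2 F (comul m_Sym h)"
      by (simp add: square carr inf_span_schur hall_mul M_Sym_simps(4) m_Sym_simps(6))
  next
    fix f K assume "f \<in> carr M_Sym" "K \<in> square m_Sym"
    then show "hall2 (comul M_Sym f) K = hall f (mul m_Sym K)"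
      by (simp add: square carr inf_span_tensor_schur hall_comul M_Sym_simps(6) m_Sym_simps(4))
  next
    fix h assume "h \<in> carr m_Sym"
    then show "hall (one M_Sym) h = counit m_Sym h"
      by (simp add: M_Sym_simps m_Sym_simps hall_one)
  next
    fix f assume "f \<in> carr M_Sym"
    then show "hall f (one m_Sym) = counit M_Sym f"
      by (simp add: M_Sym_simps m_Sym_simps hall_one)
  next
    fix f h assume "f \<in> carr M_Sym" "h \<in> carr m_Sym"
    then show "hall (antip M_Sym f) h = hall f (antip m_Sym h)"
      by (simp add: carr inf_span_schur hall_antip M_Sym_simps(7) m_Sym_simps(7))
  qed
  with dual dual_tilde show ?thesis by blast
qed

end
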